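(* For all $n\ge1$, $$d_{KS}(Y_n,Y)\le (12M^2)^{1/3}\,n^{-1/3}.$$ Consequently, using $M<16$, $$d_{KS}(Y_n,Y)<(3072/n)^{1/3}<15\,n^{-1/3}.$$
   Context: Let $X_n$ be the number of comparisons used by randomized Quicksort (uniform random pivot) on $n$ distinct numbers. Equivalently, $X_0=0$ and $$X_n\stackrel{d}{=}X_{U_n-1}+X^*_{n-U_n}+n-1,$$ with $U_n$ uniform on $\{1,\dots,n\}$, $X_j^*\stackrel{d}{=}X_j$, all independent. Let $\mu_n=\mathbf EX_n=2(n+1)H_n-4n$, where $H_n=\sum_{k\le n}1/k$, and $Y_n=(X_n-\mu_n)/n$. $Y$ is the distributional limit of $Y_n$. Its law is the unique law with mean $0$ and finite variance satisfying $Y\stackrel{d}{=}UY+(1-U)Y^*+C(U)$, where $U\sim\mathrm{unif}(0,1)$, $Y^*\stackrel{d}{=}Y$, $U,Y,Y^*$ are independent, and $C(u)=2u\ln u+2(1-u)\ln(1-u)+1$. $Y$ has a bounded density $f$. Let $M:=\sup_x f(x)$; it is known that $M<16$. $d_{KS}(X,Y):=\sup_x|P(X\le x)-P(Y\le x)|$. *)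

theory Defs
  imports "HOL-Probability.Probability"
begin

function qs_comparisons :: "nat \<Rightarrow> nat pmf" where
  "qs_comparisons 0 = return_pmf 0"
| "qs_comparisons (Suc m) =
     bind_pmf (pmf_of_set {1..Suc m}) (\<lambda>u.
       bind_pmf (qs_comparisons (u - 1)) (\<lambda>a.
         bind_pmf (qs_comparisons (Suc m - u)) (\<lambda>b.
           return_pmf (a + b + m))))"
  by pat_completeness auto
termination
  by (relation "Wellfounded.measure id") (auto simp: set_pmf_of_set)

definition qs_mean :: "nat \<Rightarrow> real" where
  "qs_mean n = 2 * (real n + 1) * (\<Sum>k=1..n. 1 / real k) - 4 * real n"

definition Yn_law :: "nat \<Rightarrow> real measure" where
  "Yn_law n = distr (measure_pmf (qs_comparisons n)) borel
                (\<lambda>k. (real k - qs_mean n) / real n)"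

definition toll :: "real \<Rightarrow> real" where
  "toll u = 2 * u * ln u + 2 * (1 - u) * ln (1 - u) + 1"

definition qs_fixpoint_law :: "real measure \<Rightarrow> bool" where
  "qs_fixpoint_law \<mu> \<longleftrightarrow>
     prob_space \<mu> \<and> sets \<mu> = sets borel \<and>
     integrable \<mu> (\<lambda>x. x) \<and> (\<integral>x. x \<partial>\<mu>) = 0 \<and>
     integrable \<mu> (\<lambda>x. x ^ 2) \<and>
     distr (uniform_measure lborel {0..1} \<Otimes>\<^sub>M (\<mu> \<Otimes>\<^sub>M \<mu>)) borel
        (\<lambda>(u, y, z). u * y + (1 - u) * z + toll u) = \<mu>"

definition Y_law :: "real measure" where
  "Y_law = (THE \<mu>. qs_fixpoint_law \<mu>)"

definition d_KS :: "real measure \<Rightarrow> real measure \<Rightarrow> real" where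
  "d_KS P Q = (SUP x. \<bar>measure P {..x} - measure Q {..x}\<bar>)"

end

theory Submission
  imports Defs "HOL-Real_Asymp.Real_Asymp"
begin

text \<open>Attach independent uniform labels to the nodes of the infinite binary tree. Let the label \<open>u\<close> of a
  node choose the pivot of rank $\lfloor nu\rfloor+1$ in the finite model and enter as \<open>U = u\<close> in the fixed-point
  equation; this realises \<open>X\<^sub>n - \<mu>\<^sub>n\<close> (\<open>Zn\<close>) and \<open>Y\<close> (\<open>Ylim\<close>) on the same space. The centred
  distances $D_n=\mathbf{E}(Z_n-(n+1)Y)^2$ satisfy a linear recursion, because the cross terms of the two subtrees vanish.
  Solving it with explicit constants gives \<open>D\<^sub>n \<le> 15/4 n - 7/16\<close> for \<open>n \<ge> 2\<close>, hence
  $\mathbf{E}(Z_n/n-Y)^2\le 15/(4n)$. If \<open>P(a \<le> Y \<le> b) \<le> K (b - a)\<close>, a truncation argument turns the quadratic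
  distance into \<open>d\<^sub>K\<^sub>S\<^sup>3 \<le> 3 K\<^sup>2 E(Z\<^sub>n/n - Y)\<^sup>2\<close>. The first bound uses \<open>K = M\<close>. For the second, the hypotheses
  do not include \<open>M < 16\<close>; instead the fixed-point equation, which averages over \<open>U\<close>, improves any Lipschitz bound
  \<open>K\<close> for the distribution function to \<open>50/9 + 0.663 K\<close>, so that \<open>K = 33/2\<close> is admissible.\<close>

section \<open>The uniform distribution and the toll function\<close>

text \<open>The two halves share one numerical budget. The target 3072 is 12 * 16^2; a Lipschitz
  constant slightly above 16 is affordable only because the quadratic distance has the constant 15/4
  instead of 4: 3 * 15/4 * (33/2)^2 = 3062.8. Neither estimate has much room, hence the exact
  variances and the explicit small cases. In the recursion for \<open>Dn\<close> the obstacle is the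
  covariance of \<open>Zn j\<close> and \<open>Ylim\<close>, which is not computed. It is traded for
  \<open>Dn j\<close> itself by means of the exact variance \<open>qs_var\<close>, whose growth also
  pins down the variance of the limit. The remaining forcing is bounded: the two tolls, of size n,
  differ by O(1) in quadratic mean, because the gap between \<open>cn n j\<close> and the cell mean
  of the limiting toll varies at most like a harmonic number, and harmonic numbers have bounded
  variance over the cells. Averaging over the split reproduces every multiple of n + 1, so the
  forcing decides only the constant term of the bound, and finitely many initial values decide its
  slope 15/4.\<close>

abbreviation unif :: "real measure" where
  "unif \<equiv> uniform_measure lborel {0..1}"

lemma prob_space_unif: "prob_space unif"
  by (rule prob_space_uniform_measure) auto

lemma sets_unif [measurable_cong, simp]: "sets unif = sets borel" by simp

lemma measurable_unif: "f \<in> measurable borel N \<Longrightarrow> f \<in> measurable unif N"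
  by (subst measurable_cong_sets[OF sets_unif refl])

interpretation unif: prob_space unif by (rule prob_space_unif)

lemma AE_unif_iff: "(AE u in unif. P u) \<longleftrightarrow> (AE u in lborel. u \<in> {0..1} \<longrightarrow> P u)"
  by (rule AE_uniform_measure) auto

lemma AE_unif_Icc: "AE u in unif. u \<in> {0..1}"
  by (simp add: AE_unif_iff)

lemma unif_eq_density: "unif = density lborel (indicator {0..1})"
  unfolding uniform_measure_def by (rule arg_cong[where f="density lborel"]) (auto simp: divide_ennreal_def)

lemma nn_integral_unif:
  assumes [measurable]: "f \<in> borel_measurable borel"
  shows "(\<integral>\<^sup>+u. f u \<partial>unif) = (\<integral>\<^sup>+u. f u * indicator {0..1} u \<partial>lborel)"
  unfolding unif_eq_density by (subst nn_integral_density) (auto intro!: nn_integral_cong simp: mult.commute)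

lemma nn_integral_unif_has_integral:
  assumes [measurable]: "f \<in> borel_measurable borel"
    and nn: "\<And>u. u \<in> {0..1} \<Longrightarrow> 0 \<le> f u" and I: "(f has_integral I) {0..1}"
  shows "(\<integral>\<^sup>+u. ennreal (f u) \<partial>unif) = ennreal I"
proof -
  have "(\<integral>\<^sup>+u. ennreal (f u) \<partial>unif) = (\<integral>\<^sup>+u. ennreal (if u \<in> {0..1} then f u else 0) \<partial>lborel)"
    by (subst nn_integral_unif) (auto intro!: nn_integral_cong simp: indicator_def)
  also have "\<dots> = ennreal I"
  proof (rule nn_integral_has_integral_lborel)
    show "(\<lambda>x. if x \<in> {0..1} then f x else 0) \<in> borel_measurable borel" by measurable
    show "((\<lambda>x. if x \<in> {0..1} then f x else 0) has_integral I) UNIV"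
      using I by (simp only: has_integral_restrict_UNIV)
  qed (use nn in auto)
  finally show ?thesis .
qed

lemma integral_unif:
  fixes f :: "real \<Rightarrow> real"
  assumes [measurable]: "f \<in> borel_measurable borel"
  shows "(\<integral>u. f u \<partial>unif) = (\<integral>u. indicator {0..1} u * f u \<partial>lborel)"
  using integral_density[of f lborel "indicator {0..1}"]
  unfolding unif_eq_density by (simp add: ennreal_indicator)

lemma integral_unif_has_integral:
  fixes f :: "real \<Rightarrow> real"
  assumes "continuous_on {0..1} f" and [measurable]: "f \<in> borel_measurable borel"
    and I: "(f has_integral I) {0..1}"
  shows "integrable unif f" "(\<integral>u. f u \<partial>unif) = I"
proof -
  have s: "set_integrable lborel {0..1} f"
    using borel_integrable_compact[OF _ assms(1)] by (simp add: set_integrable_def)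
  have "integrable (density lborel (\<lambda>x. ennreal (indicator {0..1} x))) f"
    by (subst integrable_density) (use s in \<open>auto simp: set_integrable_def\<close>)
  then show "integrable unif f"
    unfolding unif_eq_density by (simp add: ennreal_indicator)
  have "(\<integral>u. f u \<partial>unif) = (LINT u:{0..1}|lborel. f u)"
    by (simp add: integral_unif set_lebesgue_integral_def)
  also have "\<dots> = integral {0..1} f" using set_borel_integral_eq_integral(2)[OF s] by simp
  also have "\<dots> = I" using I by (rule integral_unique)
  finally show "(\<integral>u. f u \<partial>unif) = I" .
qed

text \<open>At 0 the product is 0 whatever \<open>ln 0\<close> is, and this is its limit from the
  right; continuity of \<open>toll\<close> up to both endpoints rests on it.\<close>

lemma continuous_on_x_ln_x: "continuous_on {0..} (\<lambda>x::real. x * ln x)"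
proof -
  have "continuous (at x within {0..}) (\<lambda>x::real. x * ln x)" if "x \<ge> 0" for x
  proof (cases "x = 0")
    case True
    have "((\<lambda>x::real. x * ln x) \<longlongrightarrow> 0) (at_right 0)" by real_asymp
    moreover have "at (0::real) within {0..} = at_right 0"
      by (auto simp: at_within_def intro!: arg_cong2[where f=inf] arg_cong[where f=principal])
    ultimately show ?thesis using True by (simp add: continuous_within)
  next
    case False
    then show ?thesis using that by (intro continuous_intros) auto
  qed
  then show ?thesis by (simp add: continuous_on_eq_continuous_within)
qed

lemma toll_alt: "toll u = 1 + 2 * (u * ln u) + 2 * ((1 - u) * ln (1 - u))"
  by (simp add: toll_def)

lemma continuous_on_ln_1m: "continuous_on {0..1} (\<lambda>x::real. (1 - x) * ln (1 - x))"
  by (rule continuous_on_compose2[OF continuous_on_x_ln_x, of _ "\<lambda>x. 1 - x"]) (auto intro!: continuous_intros)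

lemma continuous_on_ln_01: "continuous_on {0..1} (\<lambda>x::real. x * ln x)"
  by (rule continuous_on_subset[OF continuous_on_x_ln_x]) auto

lemma continuous_on_toll: "continuous_on {0..1} toll"
  unfolding toll_alt by (intro continuous_on_add continuous_on_const continuous_on_mult continuous_on_ln_1m continuous_on_ln_01)

lemma measurable_toll [measurable]: "toll \<in> borel_measurable borel"
  unfolding toll_def by measurable

lemma toll_symmetric: "toll (1 - u) = toll u"
  by (simp add: toll_def)

text \<open>An antiderivative of \<open>toll\<close>. The grouping \<open>u * (u * ln u)\<close>
  lets the continuity of x ln x apply at both ends. Both ends have the value 1/2, which is why the
  toll has mean 0.\<close>

definition toll_primitive :: "real \<Rightarrow> real" where
  "toll_primitive u = u * (u * ln u) - u^2 / 2 - (1 - u) * ((1 - u) * ln (1 - u)) + (1 - u)^2 / 2 + u"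

lemma continuous_on_toll_primitive: "continuous_on {0..1} toll_primitive"
  unfolding toll_primitive_def
  by (intro continuous_on_add continuous_on_diff continuous_on_const continuous_on_mult continuous_on_ln_1m
      continuous_on_ln_01 continuous_on_id continuous_on_power continuous_on_divide) auto

lemma toll_primitive_deriv:
  assumes "0 < u" "u < 1" shows "(toll_primitive has_real_derivative toll u) (at u)"
  unfolding toll_primitive_def toll_def
  by (rule derivative_eq_intros refl | use assms in force)+ (use assms in \<open>simp add: field_simps power2_eq_square\<close>)

lemma toll_deriv:
  assumes "0 < u" "u < 1" shows "(toll has_real_derivative 2 * (ln u - ln (1 - u))) (at u)"
  unfolding toll_def
  by (rule derivative_eq_intros refl | use assms in force)+ (use assms in \<open>simp add: field_simps\<close>)

lemma toll_has_integral:
  assumes "0 \<le> a" "a \<le> b" "b \<le> 1"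
  shows "(toll has_integral (toll_primitive b - toll_primitive a)) {a..b}"
proof (rule fundamental_theorem_of_calculus_interior)
  show "continuous_on {a..b} toll_primitive"
    by (rule continuous_on_subset[OF continuous_on_toll_primitive]) (use assms in auto)
  fix x assume "x \<in> {a<..<b}"
  then show "(toll_primitive has_vector_derivative toll x) (at x)"
    using toll_primitive_deriv[of x] assms by (auto simp: has_real_derivative_iff_has_vector_derivative)
qed fact

lemma toll_has_integral_0: "(toll has_integral 0) {0..1}"
  using toll_has_integral[of 0 1] by (simp add: toll_primitive_def)

lemma integral_toll_unif: "integrable unif toll" "(\<integral>u. toll u \<partial>unif) = 0"
  using integral_unif_has_integral[OF continuous_on_toll measurable_toll toll_has_integral_0] by auto

section \<open>Uniqueness of the fixed point\<close>

text \<open>The characteristic functions of two fixed points differ by at most a multiple of $t^2$, and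
  the fixed-point equation contracts this bound by the factor $\mathbf{E}(U^2+(1-U)^2)=2/3$.\<close>

lemma real_distribution_fixpoint:
  assumes "qs_fixpoint_law \<mu>" shows "real_distribution \<mu>"
  using assms unfolding qs_fixpoint_law_def real_distribution_def real_distribution_axioms_def
  by auto

lemma char_fixpoint:
  assumes fp: "qs_fixpoint_law \<mu>"
  shows "integrable unif (\<lambda>u. char \<mu> (t * u) * char \<mu> (t * (1 - u)) * iexp (t * toll u))"
    and "char \<mu> t = (\<integral>u. char \<mu> (t * u) * char \<mu> (t * (1 - u)) * iexp (t * toll u) \<partial>unif)"
proof -
  interpret real_distribution \<mu> by (rule real_distribution_fixpoint[OF fp])
  interpret mumu: pair_prob_space \<mu> \<mu> by unfold_locales
  interpret umumu: pair_prob_space unif "\<mu> \<Otimes>\<^sub>M \<mu>" by unfold_locales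
  have [measurable_cong]: "sets \<mu> = sets borel" by simp
  have fe: "\<mu> = distr (unif \<Otimes>\<^sub>M (\<mu> \<Otimes>\<^sub>M \<mu>)) borel (\<lambda>(u, y, z). u * y + (1 - u) * z + toll u)"
    using fp by (simp add: qs_fixpoint_law_def)
  have m: "(\<lambda>(u, y, z). u * y + (1 - u) * z + toll u) \<in> borel_measurable (unif \<Otimes>\<^sub>M (\<mu> \<Otimes>\<^sub>M \<mu>))"
    by measurable
  let ?h = "\<lambda>x. iexp (t * (case x of (u, y, z) \<Rightarrow> u * y + (1 - u) * z + toll u))"
  have hm: "?h \<in> borel_measurable (unif \<Otimes>\<^sub>M (\<mu> \<Otimes>\<^sub>M \<mu>))"
    using m by measurable
  have i: "integrable (unif \<Otimes>\<^sub>M (\<mu> \<Otimes>\<^sub>M \<mu>)) ?h"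
    by (rule umumu.P.integrable_const_bound[where B=1]) (use hm in auto)
  have inner: "(\<integral>p. ?h (u, p) \<partial>(\<mu> \<Otimes>\<^sub>M \<mu>)) = char \<mu> (t * u) * char \<mu> (t * (1 - u)) * iexp (t * toll u)" for u
  proof -
    have i2: "integrable (\<mu> \<Otimes>\<^sub>M \<mu>) (\<lambda>p. ?h (u, p))"
      by (rule mumu.P.integrable_const_bound[where B=1]) auto
    have "(\<integral>p. ?h (u, p) \<partial>(\<mu> \<Otimes>\<^sub>M \<mu>)) = (\<integral>y. \<integral>z. ?h (u, y, z) \<partial>\<mu> \<partial>\<mu>)"
      using mumu.integral_fst'[OF i2] by simp
    also have "\<dots> = (\<integral>y. \<integral>z. iexp (t * u * y) * iexp (t * toll u) * iexp (t * (1 - u) * z) \<partial>\<mu> \<partial>\<mu>)"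
      by (simp add: exp_add[symmetric] algebra_simps)
    also have "\<dots> = (\<integral>y. iexp (t * u * y) * iexp (t * toll u) * char \<mu> (t * (1 - u)) \<partial>\<mu>)"
      unfolding char_def by simp
    also have "\<dots> = char \<mu> (t * u) * iexp (t * toll u) * char \<mu> (t * (1 - u))"
      unfolding char_def by simp
    finally show ?thesis by (simp add: mult_ac)
  qed
  show "integrable unif (\<lambda>u. char \<mu> (t * u) * char \<mu> (t * (1 - u)) * iexp (t * toll u))"
    using umumu.integrable_fst'[OF i] unfolding inner .
  have "char \<mu> t = (\<integral>x. iexp (t * x) \<partial>distr (unif \<Otimes>\<^sub>M (\<mu> \<Otimes>\<^sub>M \<mu>)) borel (\<lambda>(u, y, z). u * y + (1 - u) * z + toll u))"
    unfolding char_def by (subst (1) fe) simp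
  also have "\<dots> = (\<integral>x. ?h x \<partial>(unif \<Otimes>\<^sub>M (\<mu> \<Otimes>\<^sub>M \<mu>)))"
    by (rule integral_distr[OF m]) measurable
  also have "\<dots> = (\<integral>u. char \<mu> (t * u) * char \<mu> (t * (1 - u)) * iexp (t * toll u) \<partial>unif)"
    unfolding umumu.integral_fst'[OF i, symmetric] inner ..
  finally show "char \<mu> t = (\<integral>u. char \<mu> (t * u) * char \<mu> (t * (1 - u)) * iexp (t * toll u) \<partial>unif)" .
qed

text \<open>The mean 0 removes the first-order term. This matters: a bound of order t would not
  contract, because U + (1 - U) = 1, whereas order t^2 does.\<close>

lemma char_fixpoint_quadratic:
  assumes fp: "qs_fixpoint_law \<mu>"
  shows "cmod (char \<mu> t - 1) \<le> 2 * t^2 * (\<integral>x. x^2 \<partial>\<mu>)"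
proof -
  interpret real_distribution \<mu> by (rule real_distribution_fixpoint[OF fp])
  have I: "integrable \<mu> (\<lambda>x. x)" "(\<integral>x. x \<partial>\<mu>) = 0" "integrable \<mu> (\<lambda>x. x^2)"
    using fp by (auto simp: qs_fixpoint_law_def)
  have "integrable \<mu> (\<lambda>x. x^k)" if "k \<le> 2" for k
  proof -
    from that consider "k = 0" | "k = 1" | "k = 2" by linarith
    then show ?thesis using I by cases auto
  qed
  then have "cmod (char \<mu> t - (\<Sum>k \<le> 2. ((\<i> * t)^k / fact k) * (\<integral>x. x^k \<partial>\<mu>))) \<le> (2*\<bar>t\<bar>^2 / fact 2) * (\<integral>x. \<bar>x\<bar>^2 \<partial>\<mu>)"
    by (rule char_approx1)
  also have "(\<Sum>k \<le> 2. ((\<i> * t)^k / fact k) * complex_of_real (\<integral>x. x^k \<partial>\<mu>)) = 1 - t^2 / 2 * (\<integral>x. x^2 \<partial>\<mu>)"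
    using I prob_space by (simp add: numeral_2_eq_2 power_mult_distrib)
  finally have a: "cmod (char \<mu> t - (1 - t^2 / 2 * (\<integral>x. x^2 \<partial>\<mu>))) \<le> t^2 * (\<integral>x. x^2 \<partial>\<mu>)"
    by simp
  have "cmod (char \<mu> t - 1) = cmod ((char \<mu> t - (1 - t^2 / 2 * (\<integral>x. x^2 \<partial>\<mu>))) - complex_of_real (t^2 / 2 * (\<integral>x. x^2 \<partial>\<mu>)))"
    by (simp add: algebra_simps)
  also have "\<dots> \<le> cmod (char \<mu> t - (1 - t^2 / 2 * (\<integral>x. x^2 \<partial>\<mu>))) + cmod (complex_of_real (t^2 / 2 * (\<integral>x. x^2 \<partial>\<mu>)))"
    by (rule norm_triangle_ineq4)
  also have "cmod (complex_of_real (t^2 / 2 * (\<integral>x. x^2 \<partial>\<mu>))) = t^2 / 2 * (\<integral>x. x^2 \<partial>\<mu>)"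
    unfolding norm_of_real by (simp add: abs_mult)
  finally have "cmod (char \<mu> t - 1) \<le> t^2 * (\<integral>x. x^2 \<partial>\<mu>) + t^2 / 2 * (\<integral>x. x^2 \<partial>\<mu>)" using a by linarith
  moreover have "0 \<le> t^2 * (\<integral>x. x^2 \<partial>\<mu>)" by simp
  moreover have "t^2 / 2 * (\<integral>x. x^2 \<partial>\<mu>) = t^2 * (\<integral>x. x^2 \<partial>\<mu>) / 2" "2 * t^2 * (\<integral>x. x^2 \<partial>\<mu>) = 2 * (t^2 * (\<integral>x. x^2 \<partial>\<mu>))"
    by simp_all
  ultimately show ?thesis by linarith
qed

lemma fixpoint_unique:
  assumes fp: "qs_fixpoint_law \<mu>" and fq: "qs_fixpoint_law \<nu>"
  shows "\<mu> = \<nu>"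
proof -
  interpret mu: real_distribution \<mu> by (rule real_distribution_fixpoint[OF fp])
  interpret nu: real_distribution \<nu> by (rule real_distribution_fixpoint[OF fq])
  define c where "c = 2 * (\<integral>x. x^2 \<partial>\<mu>) + 2 * (\<integral>x. x^2 \<partial>\<nu>)"
  have quad: "integrable unif (\<lambda>u. u^2 + (1-u)^2)" "(\<integral>u. u^2 + (1-u)^2 \<partial>unif) = (2/3 :: real)"
  proof -
    have "((\<lambda>u::real. u^2 + (1-u)^2) has_integral ((1^3/3 - (1-1)^3/3) - (0^3/3 - (1-0)^3/3))) {0..1}"
      by (rule fundamental_theorem_of_calculus)
        (auto intro!: derivative_eq_intros simp flip: has_real_derivative_iff_has_vector_derivative)
    then have h: "((\<lambda>u::real. u^2 + (1-u)^2) has_integral 2/3) {0..1}" by simp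
    show "integrable unif (\<lambda>u. u^2 + (1-u)^2)" "(\<integral>u. u^2 + (1-u)^2 \<partial>unif) = (2/3 :: real)"
    proof -
      have "continuous_on {0..1} (\<lambda>u::real. u^2 + (1-u)^2)" by (intro continuous_intros)
      from integral_unif_has_integral[OF this _ h]
      show "integrable unif (\<lambda>u. u^2 + (1-u)^2)" "(\<integral>u. u^2 + (1-u)^2 \<partial>unif) = (2/3 :: real)" by simp_all
    qed
  qed
  have bound: "cmod (char \<mu> t - char \<nu> t) \<le> c * (2/3)^k * t^2" for k t
  proof (induction k arbitrary: t)
    case 0
    have "cmod (char \<mu> t - char \<nu> t) = cmod ((char \<mu> t - 1) - (char \<nu> t - 1))" by simp
    also have "\<dots> \<le> cmod (char \<mu> t - 1) + cmod (char \<nu> t - 1)" by (rule norm_triangle_ineq4)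
    finally have "cmod (char \<mu> t - char \<nu> t) \<le> cmod (char \<mu> t - 1) + cmod (char \<nu> t - 1)" .
    then show ?case using char_fixpoint_quadratic[OF fp, of t] char_fixpoint_quadratic[OF fq, of t]
      by (simp add: c_def algebra_simps)
  next
    case (Suc k)
    let ?M = "\<lambda>u. char \<mu> (t * u) * char \<mu> (t * (1 - u)) * iexp (t * toll u)"
    let ?N = "\<lambda>u. char \<nu> (t * u) * char \<nu> (t * (1 - u)) * iexp (t * toll u)"
    have "cmod (char \<mu> t - char \<nu> t) = cmod (\<integral>u. ?M u - ?N u \<partial>unif)"
      using char_fixpoint[OF fp, of t] char_fixpoint[OF fq, of t] by simp
    also have "\<dots> \<le> (\<integral>u. cmod (?M u - ?N u) \<partial>unif)" by (rule integral_norm_bound)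
    also have "\<dots> \<le> (\<integral>u. c * (2/3)^k * t^2 * (u^2 + (1-u)^2) \<partial>unif)"
    proof (rule integral_mono)
      show "integrable unif (\<lambda>u. cmod (?M u - ?N u))"
        using char_fixpoint(1)[OF fp, of t] char_fixpoint(1)[OF fq, of t] by simp
      show "integrable unif (\<lambda>u. c * (2/3)^k * t^2 * (u^2 + (1-u)^2))" using quad(1) by simp
      fix u
      let ?a = "char \<mu> (t * u)" and ?b = "char \<mu> (t * (1 - u))" and ?a' = "char \<nu> (t * u)" and ?b' = "char \<nu> (t * (1 - u))"
      have "?M u - ?N u = ((?a - ?a') * ?b + ?a' * (?b - ?b')) * iexp (t * toll u)" by (simp add: algebra_simps)
      then have "cmod (?M u - ?N u) = cmod ((?a - ?a') * ?b + ?a' * (?b - ?b'))" by (simp add: norm_mult)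
      also have "\<dots> \<le> cmod (?a - ?a') * cmod ?b + cmod ?a' * cmod (?b - ?b')"
        by (metis norm_mult norm_triangle_ineq)
      also have "\<dots> \<le> cmod (?a - ?a') * 1 + 1 * cmod (?b - ?b')"
        by (intro add_mono mult_left_mono mult_right_mono mu.cmod_char_le_1 nu.cmod_char_le_1) auto
      also have "\<dots> \<le> c * (2/3)^k * (t * u)^2 + c * (2/3)^k * (t * (1-u))^2"
        using Suc[of "t * u"] Suc[of "t * (1 - u)"] by simp
      also have "\<dots> = c * (2/3)^k * t^2 * (u^2 + (1-u)^2)" by (simp add: power_mult_distrib distrib_left)
      finally show "cmod (?M u - ?N u) \<le> c * (2/3)^k * t^2 * (u^2 + (1-u)^2)" .
    qed
    also have "\<dots> = c * (2/3)^k * t^2 * (2/3)" using quad by simp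
    finally show ?case by (simp add: algebra_simps)
  qed
  have "char \<mu> = char \<nu>"
  proof
    fix t
    have "(\<lambda>k. c * (2/3)^k * t^2) \<longlonglongrightarrow> c * 0 * t^2"
      by (intro tendsto_intros LIMSEQ_realpow_zero) auto
    then have "cmod (char \<mu> t - char \<nu> t) \<le> c * 0 * t^2"
      using bound[of t] by (intro LIMSEQ_le_const) auto
    then show "char \<mu> t = char \<nu> t" by simp
  qed
  then show ?thesis by (rule Levy_uniqueness[OF mu.real_distribution_axioms nu.real_distribution_axioms])
qed

section \<open>From quadratic to Kolmogorov--Smirnov distance\<close>

context prob_space
begin

text \<open>Truncating at \<open>c = prob E / K\<close>: on \<open>E\<close> we have $c^2 \le Q + (c^2-W^2)^+$, and the last term is controlled
  through $(c^2-W^2)^+ = \int_0^c 2s\,1_{W\le s}\,ds$.\<close>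

lemma cube_prob_le:
  assumes [measurable]: "W \<in> borel_measurable M" "E \<in> events" and Q: "integrable M Q" "\<And>\<omega>. 0 \<le> Q \<omega>"
    and E: "\<And>\<omega>. \<omega> \<in> E \<Longrightarrow> 0 \<le> W \<omega> \<and> (W \<omega>)^2 \<le> Q \<omega>"
    and conc: "\<And>t. 0 \<le> t \<Longrightarrow> prob {\<omega> \<in> space M. 0 \<le> W \<omega> \<and> W \<omega> \<le> t} \<le> K * t" and K: "0 < K"
  shows "(prob E)^3 \<le> 3 * K^2 * expectation Q"
proof -
  have [measurable]: "Q \<in> borel_measurable M" using Q by auto
  \<comment> \<open>This value maximises \<open>c^2 * prob E - 2 * K * c^3 / 3\<close>, the lower
    bound for \<open>expectation Q\<close> that the truncation yields.\<close>
  define c where "c = prob E / K"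
  have c: "0 \<le> c" using K by (simp add: c_def)
  let ?h = "\<lambda>\<omega> s. ennreal (2 * s) * indicator {0..c} s * indicator {\<omega> \<in> space M. 0 \<le> W \<omega> \<and> W \<omega> \<le> s} \<omega>"
  interpret lb: pair_sigma_finite M lborel by unfold_locales
  have hm: "(\<lambda>(\<omega>, s). ?h \<omega> s) \<in> borel_measurable (M \<Otimes>\<^sub>M lborel)"
  proof -
    have "(\<lambda>x. ennreal (2 * snd x) * indicator {0..c} (snd x) * indicator {x \<in> space (M \<Otimes>\<^sub>M lborel). 0 \<le> W (fst x) \<and> W (fst x) \<le> snd x} x) \<in> borel_measurable (M \<Otimes>\<^sub>M lborel)"
      by measurable
    then show ?thesis
      by (rule measurable_cong[THEN iffD1, rotated]) (auto simp: space_pair_measure split: split_indicator)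
  qed
  have "(\<integral>\<^sup>+\<omega>. \<integral>\<^sup>+s. ?h \<omega> s \<partial>lborel \<partial>M) = (\<integral>\<^sup>+s. \<integral>\<^sup>+\<omega>. ?h \<omega> s \<partial>M \<partial>lborel)"
    using lb.Fubini'[OF hm] by simp
  also have "\<dots> \<le> (\<integral>\<^sup>+s. ennreal (2 * K * s^2) * indicator {0..c} s \<partial>lborel)"
  proof (rule nn_integral_mono)
    fix s :: real
    have "(\<integral>\<^sup>+\<omega>. ?h \<omega> s \<partial>M) = ennreal (2 * s) * indicator {0..c} s * emeasure M {\<omega> \<in> space M. 0 \<le> W \<omega> \<and> W \<omega> \<le> s}"
      by (subst nn_integral_cmult_indicator) auto
    also have "\<dots> \<le> ennreal (2 * K * s^2) * indicator {0..c} s"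
    proof (cases "s \<in> {0..c}")
      case True
      have "emeasure M {\<omega> \<in> space M. 0 \<le> W \<omega> \<and> W \<omega> \<le> s} \<le> ennreal (K * s)"
        using conc[of s] True by (simp add: emeasure_eq_measure ennreal_leI)
      then have "ennreal (2 * s) * emeasure M {\<omega> \<in> space M. 0 \<le> W \<omega> \<and> W \<omega> \<le> s} \<le> ennreal (2 * s) * ennreal (K * s)"
        by (intro mult_left_mono) auto
      also have "\<dots> = ennreal (2 * K * s^2)" using True K by (simp add: ennreal_mult[symmetric] power2_eq_square mult_ac)
      finally show ?thesis using True by simp
    qed simp
    finally show "(\<integral>\<^sup>+\<omega>. ?h \<omega> s \<partial>M) \<le> ennreal (2 * K * s^2) * indicator {0..c} s" .
  qed
  also have "\<dots> = ennreal (2 * K * c^3 / 3 - 2 * K * 0^3 / 3)"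
    by (rule nn_integral_FTC_Icc)
       (use c K in \<open>auto intro!: derivative_eq_intros simp: power2_eq_square field_simps\<close>)
  finally have int: "(\<integral>\<^sup>+\<omega>. \<integral>\<^sup>+s. ?h \<omega> s \<partial>lborel \<partial>M) \<le> ennreal (2 * K * c^3 / 3)" by simp
  have inner: "(\<integral>\<^sup>+s. ?h \<omega> s \<partial>lborel) = ennreal (c^2 - (W \<omega>)^2)" if "\<omega> \<in> space M" "0 \<le> W \<omega>" "W \<omega> \<le> c" for \<omega>
  proof -
    have "(\<integral>\<^sup>+s. ?h \<omega> s \<partial>lborel) = (\<integral>\<^sup>+s. ennreal (2 * s) * indicator {W \<omega>..c} s \<partial>lborel)"
      by (rule nn_integral_cong) (use that in \<open>auto split: split_indicator\<close>)
    also have "\<dots> = ennreal (c^2 - (W \<omega>)^2)"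
      by (rule nn_integral_FTC_Icc) (use that in \<open>auto intro!: derivative_eq_intros\<close>)
    finally show ?thesis .
  qed
  have pt: "ennreal (c^2) * indicator E \<omega> \<le> ennreal (Q \<omega>) + (\<integral>\<^sup>+s. ?h \<omega> s \<partial>lborel)" if "\<omega> \<in> space M" for \<omega>
  proof (cases "\<omega> \<in> E")
    case True
    show ?thesis
    proof (cases "W \<omega> \<le> c")
      case le: True
      have w: "(W \<omega>)^2 \<le> c^2" using E[OF True] le by (intro power_mono) auto
      have "ennreal (c^2) \<le> ennreal (Q \<omega> + (c^2 - (W \<omega>)^2))" using E[OF True] by (intro ennreal_leI) simp
      also have "\<dots> = ennreal (Q \<omega>) + ennreal (c^2 - (W \<omega>)^2)" using Q(2) w by (intro ennreal_plus) auto
      finally show ?thesis using True inner[OF that] E[OF True] le by simp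
    next
      case False
      then have "c^2 \<le> (W \<omega>)^2" using c by (intro power_mono) auto
      then have "c^2 \<le> Q \<omega>" using E[OF True] by linarith
      then have "ennreal (c^2) \<le> ennreal (Q \<omega>)" by (rule ennreal_leI)
      then have "ennreal (c^2) \<le> ennreal (Q \<omega>) + (\<integral>\<^sup>+s. ?h \<omega> s \<partial>lborel)" by (rule order_trans) simp
      then show ?thesis using True by simp
    qed
  qed simp
  have "ennreal (c^2) * emeasure M E = (\<integral>\<^sup>+\<omega>. ennreal (c^2) * indicator E \<omega> \<partial>M)"
    by (rule nn_integral_cmult_indicator[symmetric]) simp
  also have "\<dots> \<le> (\<integral>\<^sup>+\<omega>. ennreal (Q \<omega>) + (\<integral>\<^sup>+s. ?h \<omega> s \<partial>lborel) \<partial>M)"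
    by (rule nn_integral_mono) (rule pt)
  also have "\<dots> = (\<integral>\<^sup>+\<omega>. ennreal (Q \<omega>) \<partial>M) + (\<integral>\<^sup>+\<omega>. \<integral>\<^sup>+s. ?h \<omega> s \<partial>lborel \<partial>M)"
    by (rule nn_integral_add) (use lborel.borel_measurable_nn_integral[OF hm] in auto)
  also have "\<dots> \<le> ennreal (expectation Q) + ennreal (2 * K * c^3 / 3)"
    using int Q by (intro add_mono) (auto simp: nn_integral_eq_integral)
  also have "\<dots> = ennreal (expectation Q + 2 * K * c^3 / 3)"
    using K c Q(2) by (intro ennreal_plus[symmetric]) auto
  finally have "ennreal (c^2 * prob E) \<le> ennreal (expectation Q + 2 * K * c^3 / 3)"
    by (simp add: emeasure_eq_measure ennreal_mult)
  then have "c^2 * prob E \<le> expectation Q + 2 * K * c^3 / 3"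
    using K c Q(2) by (subst (asm) ennreal_le_iff) (auto intro!: add_nonneg_nonneg integral_nonneg_AE)
  moreover have "prob E = K * c" using K by (simp add: c_def)
  ultimately have "K * c^3 \<le> 3 * expectation Q" by (simp add: power2_eq_square power3_eq_cube algebra_simps)
  then have "K^2 * (K * c^3) \<le> K^2 * (3 * expectation Q)" by (intro mult_left_mono) auto
  then show ?thesis unfolding \<open>prob E = K * c\<close> by (simp add: power_mult_distrib power2_eq_square power3_eq_cube mult_ac)
qed

text \<open>If \<open>A\<close> puts more mass below x than \<open>B\<close>, the surplus lies in
  the event A <= x <= B, on which 0 <= B - x <= B - A; the other sign is symmetric. Only
  \<open>B\<close> has to spread its mass, so \<open>A\<close> may be discrete.\<close>

lemma d_KS_cube_le:
  assumes [measurable]: "A \<in> borel_measurable M" "B \<in> borel_measurable M"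
    and Q: "integrable M (\<lambda>\<omega>. (A \<omega> - B \<omega>)^2)"
    and conc: "\<And>a b. a \<le> b \<Longrightarrow> prob {\<omega> \<in> space M. a \<le> B \<omega> \<and> B \<omega> \<le> b} \<le> K * (b - a)" and K: "0 < K"
  shows "(d_KS (distr M borel A) (distr M borel B))^3 \<le> 3 * K^2 * expectation (\<lambda>\<omega>. (A \<omega> - B \<omega>)^2)"
proof -
  let ?V = "3 * K^2 * expectation (\<lambda>\<omega>. (A \<omega> - B \<omega>)^2)"
  have V: "0 \<le> ?V" by simp
  have *: "\<bar>measure (distr M borel A) {..x} - measure (distr M borel B) {..x}\<bar> \<le> root 3 ?V" for x
  proof -
    define E1 where "E1 = {\<omega> \<in> space M. A \<omega> \<le> x \<and> x \<le> B \<omega>}"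
    define E2 where "E2 = {\<omega> \<in> space M. B \<omega> \<le> x \<and> x \<le> A \<omega>}"
    have [measurable]: "E1 \<in> events" "E2 \<in> events" unfolding E1_def E2_def by measurable
    have e1: "(prob E1)^3 \<le> ?V"
    proof (rule cube_prob_le[where W="\<lambda>\<omega>. B \<omega> - x"])
      fix \<omega> assume "\<omega> \<in> E1"
      then have "0 \<le> B \<omega> - x" "B \<omega> - x \<le> B \<omega> - A \<omega>" by (auto simp: E1_def)
      then show "0 \<le> B \<omega> - x \<and> (B \<omega> - x)^2 \<le> (A \<omega> - B \<omega>)^2"
        using power_mono[of "B \<omega> - x" "B \<omega> - A \<omega>" 2] by (auto simp: power2_commute)
    next
      fix t :: real assume "0 \<le> t"
      then have "prob {\<omega> \<in> space M. x \<le> B \<omega> \<and> B \<omega> \<le> x + t} \<le> K * t" using conc[of x "x + t"] by simp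
      then show "prob {\<omega> \<in> space M. 0 \<le> B \<omega> - x \<and> B \<omega> - x \<le> t} \<le> K * t" by (simp add: algebra_simps)
    qed (use Q K in auto)
    have e2: "(prob E2)^3 \<le> ?V"
    proof (rule cube_prob_le[where W="\<lambda>\<omega>. x - B \<omega>"])
      fix \<omega> assume "\<omega> \<in> E2"
      then have "0 \<le> x - B \<omega>" "x - B \<omega> \<le> A \<omega> - B \<omega>" by (auto simp: E2_def)
      then show "0 \<le> x - B \<omega> \<and> (x - B \<omega>)^2 \<le> (A \<omega> - B \<omega>)^2"
        using power_mono[of "x - B \<omega>" "A \<omega> - B \<omega>" 2] by auto
    next
      fix t :: real assume "0 \<le> t"
      then have "prob {\<omega> \<in> space M. x - t \<le> B \<omega> \<and> B \<omega> \<le> x} \<le> K * t" using conc[of "x - t" x] by simp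
      moreover have "{\<omega> \<in> space M. x - t \<le> B \<omega> \<and> B \<omega> \<le> x} = {\<omega> \<in> space M. 0 \<le> x - B \<omega> \<and> x - B \<omega> \<le> t}" by auto
      ultimately show "prob {\<omega> \<in> space M. 0 \<le> x - B \<omega> \<and> x - B \<omega> \<le> t} \<le> K * t" by simp
    qed (use Q K in auto)
    have r: "p \<le> root 3 ?V" if "p^3 \<le> ?V" "0 \<le> p" for p
      using that real_root_le_mono[of 3 "p^3" ?V] by (simp add: real_root_power_cancel)
    have mA: "measure (distr M borel A) {..x} = prob {\<omega> \<in> space M. A \<omega> \<le> x}"
      by (subst measure_distr) (auto intro!: arg_cong[where f=prob])
    have mB: "measure (distr M borel B) {..x} = prob {\<omega> \<in> space M. B \<omega> \<le> x}"
      by (subst measure_distr) (auto intro!: arg_cong[where f=prob])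
    have "prob {\<omega> \<in> space M. A \<omega> \<le> x} \<le> prob ({\<omega> \<in> space M. B \<omega> \<le> x} \<union> E1)"
      by (rule finite_measure_mono) (auto simp: E1_def)
    also have "\<dots> \<le> prob {\<omega> \<in> space M. B \<omega> \<le> x} + prob E1" by (rule measure_Un_le) auto
    finally have u1: "prob {\<omega> \<in> space M. A \<omega> \<le> x} - prob {\<omega> \<in> space M. B \<omega> \<le> x} \<le> prob E1" by simp
    have "prob {\<omega> \<in> space M. B \<omega> \<le> x} \<le> prob ({\<omega> \<in> space M. A \<omega> \<le> x} \<union> E2)"
      by (rule finite_measure_mono) (auto simp: E2_def)
    also have "\<dots> \<le> prob {\<omega> \<in> space M. A \<omega> \<le> x} + prob E2" by (rule measure_Un_le) auto
    finally have u2: "prob {\<omega> \<in> space M. B \<omega> \<le> x} - prob {\<omega> \<in> space M. A \<omega> \<le> x} \<le> prob E2" by simp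
    show ?thesis unfolding mA mB using u1 u2 r[OF e1] r[OF e2] by (auto simp: abs_le_iff)
  qed
  have le: "d_KS (distr M borel A) (distr M borel B) \<le> root 3 ?V"
    unfolding d_KS_def by (rule cSUP_least) (use * in auto)
  have ge: "0 \<le> d_KS (distr M borel A) (distr M borel B)"
  proof -
    have "bdd_above (range (\<lambda>x. \<bar>measure (distr M borel A) {..x} - measure (distr M borel B) {..x}\<bar>))"
      using * by (intro bdd_aboveI[where M="root 3 ?V"]) auto
    then show ?thesis unfolding d_KS_def by (rule cSUP_upper2[of _ _ 0]) auto
  qed
  have "(d_KS (distr M borel A) (distr M borel B))^3 \<le> (root 3 ?V)^3"
    using le ge by (rule power_mono)
  then show ?thesis using V by (simp only: real_root_pow_pos2[of 3 ?V])
qed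

end

section \<open>Concentration of a fixed point\<close>

definition toll_slope :: "real \<Rightarrow> real" where "toll_slope u = 2 * (ln u - ln (1 - u))"

lemma measurable_toll_slope [measurable]: "toll_slope \<in> borel_measurable borel"
  unfolding toll_slope_def[abs_def] by measurable

text \<open>The second derivative of the toll is 2 / (u (1 - u)), which is at least 8: the toll is
  uniformly strongly convex.\<close>

lemma toll_slope_diff:
  assumes "0 < p" "p \<le> q" "q < 1" shows "8 * (q - p) \<le> toll_slope q - toll_slope p"
proof -
  have "(\<lambda>u. toll_slope u - 8 * u) p \<le> (\<lambda>u. toll_slope u - 8 * u) q"
  proof (rule deriv_nonneg_imp_mono[where a=p and b=q and g="\<lambda>u. toll_slope u - 8 * u" and g'="\<lambda>u. 2 * (1 / u + 1 / (1 - u)) - 8"])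
    fix u assume "u \<in> {p..q}"
    then have u: "0 < u" "u < 1" using assms by auto
    show "((\<lambda>u. toll_slope u - 8 * u) has_real_derivative 2 * (1 / u + 1 / (1 - u)) - 8) (at u)"
      unfolding toll_slope_def using u by (auto intro!: derivative_eq_intros)
    have "0 \<le> (2 * u - 1)^2" by simp
    then have "4 * (u * (1 - u)) \<le> 1" by (simp add: power2_eq_square algebra_simps)
    then have "4 \<le> 1 / (u * (1 - u))" using u by (simp add: field_simps)
    moreover have "1 / u + 1 / (1 - u) = 1 / (u * (1 - u))" using u by (simp add: field_simps)
    ultimately show "0 \<le> 2 * (1 / u + 1 / (1 - u)) - 8" by simp
  qed fact
  then show ?thesis by simp
qed

text \<open>The zero of \<open>d + toll_slope u\<close>, obtained from (1 - u) / u = exp (d / 2);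
  hence the minimiser of \<open>tilt c d\<close>.\<close>

definition crit :: "real \<Rightarrow> real" where "crit d = 1 / (1 + exp (d / 2))"

lemma crit_bounds: "0 < crit d" "crit d < 1"
  unfolding crit_def by (simp_all add: add_pos_pos)

lemma crit_minus: "crit (- d) = 1 - crit d"
proof -
  have gen: "1 / (1 + 1 / e) = 1 - 1 / (1 + e)" if "e > 0" for e :: real
  proof -
    have "1 / (1 + 1 / e) = e / (1 + e)" using that by (simp add: divide_simps)
    also have "\<dots> = 1 - 1 / (1 + e)" using that by (simp add: divide_simps)
    finally show ?thesis .
  qed
  have "crit (- d) = 1 / (1 + 1 / exp (d / 2))" unfolding crit_def by (simp add: exp_minus inverse_eq_divide)
  also have "\<dots> = 1 - crit d" unfolding crit_def by (rule gen) simp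
  finally show ?thesis .
qed

lemma toll_slope_crit: "toll_slope (crit d) = - d"
proof -
  have "1 + exp (d/2) > 0" by (simp add: add_pos_pos)
  then have "1 - crit d = exp (d/2) / (1 + exp (d/2))" by (simp add: crit_def field_simps)
  moreover have "ln (crit d) = - ln (1 + exp (d/2))" using \<open>1 + exp (d/2) > 0\<close> by (simp add: crit_def ln_div)
  moreover have "ln (exp (d/2) / (1 + exp (d/2))) = d / 2 - ln (1 + exp (d/2))"
    using \<open>1 + exp (d/2) > 0\<close> by (simp add: ln_div)
  ultimately show ?thesis by (simp add: toll_slope_def)
qed

text \<open>With \<open>c = z\<close> and \<open>d = y - z\<close> this is
  \<open>u * y + (1 - u) * z + toll u\<close>, the right-hand side of the fixed-point equation as a
  function of the split alone. It is convex, so every level set has one piece on each side of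
  \<open>crit d\<close>.\<close>

definition tilt :: "real \<Rightarrow> real \<Rightarrow> real \<Rightarrow> real" where "tilt c d u = c + u * d + toll u"

lemma measurable_tilt [measurable]: "tilt c d \<in> borel_measurable borel"
  unfolding tilt_def[abs_def] by measurable

lemma continuous_on_tilt: "continuous_on {0..1} (tilt c d)"
  unfolding tilt_def[abs_def] by (intro continuous_intros continuous_on_toll)

lemma tilt_reflect: "tilt c d (1 - u) = tilt (c + d) (- d) u"
  by (simp add: tilt_def toll_symmetric algebra_simps)

lemma tilt_deriv:
  assumes "0 < u" "u < 1" shows "(tilt c d has_real_derivative d + toll_slope u) (at u)"
  unfolding tilt_def[abs_def] toll_slope_def using toll_deriv[OF assms]
  by (auto intro!: derivative_eq_intros)

lemma slope_nonneg:
  assumes "crit d \<le> u" "u < 1" shows "0 \<le> d + toll_slope u"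
  using toll_slope_diff[of "crit d" u] toll_slope_crit[of d] crit_bounds[of d] assms by simp

text \<open>The slope is nonnegative at \<open>p\<close> and increases at rate at least 8, so it is
  at least 8 (v - p) at v. The bound survives at the flat point \<open>p = crit d\<close>.\<close>

lemma tilt_growth:
  assumes "crit d \<le> p" "p \<le> q" "q \<le> 1" shows "4 * (q - p)^2 \<le> tilt c d q - tilt c d p"
proof -
  define F where "F v = tilt c d v - 4 * (v - p)^2" for v
  have "F p \<le> F q"
  proof (rule DERIV_nonneg_imp_increasing_open[of p q F])
    have "continuous_on {0..1} F" unfolding F_def by (intro continuous_intros continuous_on_tilt)
    then show "continuous_on {p..q} F"
      by (rule continuous_on_subset) (use assms crit_bounds[of d] in auto)
    fix v assume v: "p < v" "v < q"
    then have v01: "0 < v" "v < 1" "0 < p" "p < 1" using assms crit_bounds[of d] by auto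
    have "(F has_real_derivative (d + toll_slope v - 8 * (v - p))) (at v)"
      unfolding F_def using tilt_deriv[OF v01(1,2), of c d] by (auto intro!: derivative_eq_intros)
    moreover have "0 \<le> d + toll_slope v - 8 * (v - p)"
      using toll_slope_diff[of p v] slope_nonneg[of d p] v v01 assms by auto
    ultimately show "\<exists>y. (F has_real_derivative y) (at v) \<and> 0 \<le> y" by blast
  qed fact
  then show ?thesis by (simp add: F_def)
qed

text \<open>On the increasing branch the preimage of an interval of length \<open>h\<close> is contained in an interval whose
  endpoints it attains.\<close>

lemma branch_interval:
  assumes "{u \<in> {crit d..1}. x \<le> tilt c d u \<and> tilt c d u \<le> x + h} \<noteq> {}"
  obtains p q where "crit d \<le> p" "p \<le> q" "q \<le> 1" "tilt c d q - tilt c d p \<le> h"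
    "{u \<in> {crit d..1}. x \<le> tilt c d u \<and> tilt c d u \<le> x + h} \<subseteq> {p..q}"
proof -
  define S where "S = {u \<in> {crit d..1}. x \<le> tilt c d u \<and> tilt c d u \<le> x + h}"
  have "continuous_on {crit d..1} (tilt c d)"
    by (rule continuous_on_subset[OF continuous_on_tilt]) (use crit_bounds[of d] in auto)
  then have "closed ({crit d..1} \<inter> tilt c d -` {x..x+h})"
    by (rule continuous_closed_preimage) auto
  moreover have "{crit d..1} \<inter> tilt c d -` {x..x+h} = S" by (auto simp: S_def)
  ultimately have "closed S" by simp
  moreover have "bounded S" by (rule bounded_subset[of "{crit d..1}"]) (auto simp: S_def)
  ultimately have cS: "compact S" by (simp add: compact_eq_bounded_closed)
  have ne: "S \<noteq> {}" using assms by (simp add: S_def)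
  obtain p where p: "p \<in> S" "\<And>u. u \<in> S \<Longrightarrow> p \<le> u" using compact_attains_inf[OF cS ne] by auto
  obtain q where q: "q \<in> S" "\<And>u. u \<in> S \<Longrightarrow> u \<le> q" using compact_attains_sup[OF cS ne] by auto
  show ?thesis
  proof (rule that)
    show "{u \<in> {crit d..1}. x \<le> tilt c d u \<and> tilt c d u \<le> x + h} \<subseteq> {p..q}" using p q unfolding S_def by auto
    show "p \<le> q" using p q by auto
  qed (use p(1) q(1) in \<open>auto simp: S_def\<close>)
qed

lemma nn_integral_unif_reflect:
  assumes [measurable]: "f \<in> borel_measurable borel"
  shows "(\<integral>\<^sup>+u. f (1 - u) \<partial>unif) = (\<integral>\<^sup>+u. f u \<partial>unif)"
proof -
  have "(\<integral>\<^sup>+u. f u \<partial>unif) = (\<integral>\<^sup>+u. f u * indicator {0..1} u \<partial>lborel)" by (rule nn_integral_unif) simp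
  also have "\<dots> = (\<integral>\<^sup>+u. f (1 + (-1) * u) * indicator {0..1} (1 + (-1) * u) \<partial>lborel)"
    by (subst nn_integral_real_affine[where c="-1" and t=1]) auto
  also have "\<dots> = (\<integral>\<^sup>+u. f (1 - u) * indicator {0..1} u \<partial>lborel)"
    by (rule nn_integral_cong) (auto split: split_indicator)
  also have "\<dots> = (\<integral>\<^sup>+u. f (1 - u) \<partial>unif)" by (rule nn_integral_unif[symmetric]) simp
  finally show ?thesis by simp
qed

text \<open>Quadratic growth turns a height h into a width of at most sqrt h / 2, uniformly in
  \<open>c\<close> and \<open>d\<close>.\<close>

lemma branch_length:
  assumes "0 \<le> h"
  shows "(\<integral>\<^sup>+u. indicator {x..x+h} (tilt c d u) * indicator {crit d..} u \<partial>unif) \<le> ennreal (sqrt h / 2)"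
proof (cases "{u \<in> {crit d..1}. x \<le> tilt c d u \<and> tilt c d u \<le> x + h} = {}")
  case True
  have "(\<integral>\<^sup>+u. indicator {x..x+h} (tilt c d u) * indicator {crit d..} u \<partial>unif)
      = (\<integral>\<^sup>+u. (indicator {x..x+h} (tilt c d u) * indicator {crit d..} u) * indicator {0..1} u \<partial>lborel)"
    by (rule nn_integral_unif) simp
  also have "\<dots> = (\<integral>\<^sup>+u. 0 \<partial>(lborel :: real measure))"
    by (rule nn_integral_cong) (use True in \<open>auto split: split_indicator\<close>)
  finally show ?thesis by simp
next
  case False
  then obtain p q where pq: "crit d \<le> p" "p \<le> q" "q \<le> 1" "tilt c d q - tilt c d p \<le> h"
    "{u \<in> {crit d..1}. x \<le> tilt c d u \<and> tilt c d u \<le> x + h} \<subseteq> {p..q}" by (rule branch_interval)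
  have "(\<integral>\<^sup>+u. indicator {x..x+h} (tilt c d u) * indicator {crit d..} u \<partial>unif)
      = (\<integral>\<^sup>+u. (indicator {x..x+h} (tilt c d u) * indicator {crit d..} u) * indicator {0..1} u \<partial>lborel)"
    by (rule nn_integral_unif) simp
  also have "\<dots> \<le> (\<integral>\<^sup>+u. indicator {p..q} u \<partial>lborel)"
    by (rule nn_integral_mono) (use pq(5) in \<open>auto split: split_indicator\<close>)
  also have "\<dots> = ennreal (q - p)" using pq by simp
  also have "\<dots> \<le> ennreal (sqrt h / 2)"
  proof (rule ennreal_leI)
    have "(2 * (q - p))^2 = 4 * (q - p)^2" by (simp add: power2_eq_square algebra_simps)
    then have "(2 * (q - p))^2 \<le> h" using tilt_growth[OF pq(1,2,3), of c] pq(4) by linarith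
    then show "q - p \<le> sqrt h / 2" using real_le_rsqrt by fastforce
  qed
  finally show ?thesis .
qed

text \<open>The slope is the Jacobian of the change of variables s = \<open>tilt c d u\<close>;
  weighting by it removes the singularity at the critical point and leaves the rise of the function
  over the preimage.\<close>

lemma branch_variation:
  assumes "0 \<le> h"
  shows "(\<integral>\<^sup>+u. indicator {x..x+h} (tilt c d u) * indicator {crit d..} u * ennreal (d + toll_slope u) \<partial>unif) \<le> ennreal h"
proof (cases "{u \<in> {crit d..1}. x \<le> tilt c d u \<and> tilt c d u \<le> x + h} = {}")
  case True
  have "(\<integral>\<^sup>+u. indicator {x..x+h} (tilt c d u) * indicator {crit d..} u * ennreal (d + toll_slope u) \<partial>unif)
      = (\<integral>\<^sup>+u. (indicator {x..x+h} (tilt c d u) * indicator {crit d..} u * ennreal (d + toll_slope u)) * indicator {0..1} u \<partial>lborel)"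
    by (rule nn_integral_unif) simp
  also have "\<dots> = (\<integral>\<^sup>+u. 0 \<partial>(lborel :: real measure))"
    by (rule nn_integral_cong) (use True in \<open>auto split: split_indicator\<close>)
  finally show ?thesis by simp
next
  case False
  then obtain p q where pq: "crit d \<le> p" "p \<le> q" "q \<le> 1" "tilt c d q - tilt c d p \<le> h"
    "{u \<in> {crit d..1}. x \<le> tilt c d u \<and> tilt c d u \<le> x + h} \<subseteq> {p..q}" by (rule branch_interval)
  have p0: "0 < p" using pq crit_bounds[of d] by auto
  let ?k = "\<lambda>u. if u \<in> {p..q} then max 0 (d + toll_slope u) else 0"
  have "(\<integral>\<^sup>+u. indicator {x..x+h} (tilt c d u) * indicator {crit d..} u * ennreal (d + toll_slope u) \<partial>unif)
      = (\<integral>\<^sup>+u. (indicator {x..x+h} (tilt c d u) * indicator {crit d..} u * ennreal (d + toll_slope u)) * indicator {0..1} u \<partial>lborel)"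
    by (rule nn_integral_unif) simp
  also have "\<dots> \<le> (\<integral>\<^sup>+u. ennreal (?k u) \<partial>lborel)"
    by (rule nn_integral_mono) (use pq(5) in \<open>auto simp: ennreal_leI split: split_indicator\<close>)
  also have "\<dots> = ennreal (tilt c d q - tilt c d p)"
  proof (rule nn_integral_has_integral_lborel)
    show "?k \<in> borel_measurable borel" by measurable
    have "((\<lambda>u. d + toll_slope u) has_integral (tilt c d q - tilt c d p)) {p..q}"
    proof (rule fundamental_theorem_of_calculus_interior)
      show "continuous_on {p..q} (tilt c d)"
        by (rule continuous_on_subset[OF continuous_on_tilt]) (use pq p0 in auto)
      fix u assume "u \<in> {p<..<q}"
      then show "(tilt c d has_vector_derivative d + toll_slope u) (at u)"
        using tilt_deriv[of u c d] p0 pq by (auto simp: has_real_derivative_iff_has_vector_derivative)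
    qed fact
    then have "((\<lambda>u. max 0 (d + toll_slope u)) has_integral (tilt c d q - tilt c d p)) {p..q}"
    \<comment> \<open>At u = 1 the value of \<open>ln 0\<close> makes the formal slope meaningless
      and possibly negative; one point does not affect the integral.\<close>
    proof (rule has_integral_spike_finite[where S="{1}", rotated 2])
      fix u assume "u \<in> {p..q} - {1}"
      then show "max 0 (d + toll_slope u) = d + toll_slope u" using slope_nonneg[of d u] pq by auto
    qed simp
    then show "(?k has_integral (tilt c d q - tilt c d p)) UNIV"
      by (simp only: has_integral_restrict_UNIV)
  qed simp
  also have "\<dots> \<le> ennreal h" using pq(4) by (rule ennreal_leI)
  finally show ?thesis .
qed

text \<open>The reflection u -> 1 - u turns the decreasing branch of \<open>tilt c d\<close> into
  the increasing branch of \<open>tilt (c + d) (- d)\<close> and changes the sign of the slope.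
  Hence the bound \<open>R\<close> is required for all \<open>c\<close> and \<open>d\<close>, and
  \<open>k\<close> has to be even.\<close>

lemma both_branches:
  assumes [measurable]: "k \<in> borel_measurable borel"
    and R: "\<And>c d. (\<integral>\<^sup>+u. indicator {x..x+h} (tilt c d u) * indicator {crit d..} u * k (d + toll_slope u) \<partial>unif) \<le> B"
    and even: "\<And>s. k (- s) = k s"
  shows "(\<integral>\<^sup>+u. indicator {x..x+h} (tilt c d u) * k (d + toll_slope u) \<partial>unif) \<le> 2 * (B :: ennreal)"
proof -
  let ?f = "\<lambda>u. indicator {x..x+h} (tilt c d u) * indicator {..crit d} u * k (d + toll_slope u)"
  have "(\<integral>\<^sup>+u. indicator {x..x+h} (tilt c d u) * k (d + toll_slope u) \<partial>unif)
     \<le> (\<integral>\<^sup>+u. indicator {x..x+h} (tilt c d u) * indicator {crit d..} u * k (d + toll_slope u) + ?f u \<partial>unif)"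
    by (rule nn_integral_mono) (auto split: split_indicator)
  also have "\<dots> = (\<integral>\<^sup>+u. indicator {x..x+h} (tilt c d u) * indicator {crit d..} u * k (d + toll_slope u) \<partial>unif) + (\<integral>\<^sup>+u. ?f u \<partial>unif)"
    by (rule nn_integral_add; rule measurable_unif; measurable)
  also have "(\<integral>\<^sup>+u. ?f u \<partial>unif) = (\<integral>\<^sup>+u. ?f (1 - u) \<partial>unif)"
    by (rule nn_integral_unif_reflect[symmetric]) measurable
  also have "\<dots> = (\<integral>\<^sup>+u. indicator {x..x+h} (tilt (c + d) (- d) u) * indicator {crit (- d)..} u * k (- d + toll_slope u) \<partial>unif)"
  proof (rule nn_integral_cong)
    fix u
    have "d + toll_slope (1 - u) = - (- d + toll_slope u)" by (simp add: toll_slope_def)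
    then have "k (d + toll_slope (1 - u)) = k (- d + toll_slope u)" using even by metis
    moreover have "indicator {..crit d} (1 - u) = (indicator {crit (- d)..} u :: ennreal)"
      by (auto simp: crit_minus split: split_indicator)
    ultimately show "?f (1 - u) = indicator {x..x+h} (tilt (c + d) (- d) u) * indicator {crit (- d)..} u * k (- d + toll_slope u)"
      by (simp add: tilt_reflect)
  qed
  also have "(\<integral>\<^sup>+u. indicator {x..x+h} (tilt c d u) * indicator {crit d..} u * k (d + toll_slope u) \<partial>unif)
     + (\<integral>\<^sup>+u. indicator {x..x+h} (tilt (c + d) (- d) u) * indicator {crit (- d)..} u * k (- d + toll_slope u) \<partial>unif) \<le> B + B"
    by (intro add_mono R)
  finally show ?thesis by (simp add: mult_2)
qed

lemma tilt_length:
  assumes "0 \<le> h" shows "(\<integral>\<^sup>+u. indicator {x..x+h} (tilt c d u) \<partial>unif) \<le> ennreal (sqrt h)"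
proof -
  have "(\<integral>\<^sup>+u. indicator {x..x+h} (tilt c d u) * (\<lambda>_. 1) (d + toll_slope u) \<partial>unif) \<le> 2 * ennreal (sqrt h / 2)"
    by (rule both_branches) (use branch_length[OF assms] in auto)
  also have "2 * ennreal (sqrt h / 2) = ennreal (sqrt h)"
    using assms by (simp add: ennreal_mult'[symmetric] flip: ennreal_numeral)
  finally show ?thesis by simp
qed

lemma tilt_variation:
  assumes h: "0 \<le> h" and a: "0 < a"
  shows "(\<integral>\<^sup>+u. indicator {x..x+h} (tilt c d u) * ennreal (min 1 (\<bar>d + toll_slope u\<bar> / a)) \<partial>unif) \<le> ennreal (2 * h / a)"
proof -
  have "(\<integral>\<^sup>+u. indicator {x..x+h} (tilt c d u) * (\<lambda>s. ennreal (min 1 (\<bar>s\<bar> / a))) (d + toll_slope u) \<partial>unif) \<le> 2 * ennreal (h / a)"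
  proof (rule both_branches)
    fix c d
    have "(\<integral>\<^sup>+u. indicator {x..x+h} (tilt c d u) * indicator {crit d..} u * ennreal (min 1 (\<bar>d + toll_slope u\<bar> / a)) \<partial>unif)
       \<le> (\<integral>\<^sup>+u. ennreal (1 / a) * (indicator {x..x+h} (tilt c d u) * indicator {crit d..} u * ennreal (d + toll_slope u)) \<partial>unif)"
    proof (rule nn_integral_mono_AE)
      have ne: "AE u in unif. u \<noteq> 1"
        by (simp add: AE_unif_iff AE_lborel_singleton eventually_mono[OF AE_lborel_singleton[of 1]])
      show "AE u in unif. indicator {x..x+h} (tilt c d u) * indicator {crit d..} u * ennreal (min 1 (\<bar>d + toll_slope u\<bar> / a))
          \<le> ennreal (1 / a) * (indicator {x..x+h} (tilt c d u) * indicator {crit d..} u * ennreal (d + toll_slope u))"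
        using AE_unif_Icc ne
      proof eventually_elim
        case (elim u)
        have "ennreal (min 1 (\<bar>d + toll_slope u\<bar> / a)) \<le> ennreal (1 / a) * ennreal (d + toll_slope u)" if "crit d \<le> u"
        proof -
          have "0 \<le> d + toll_slope u" using slope_nonneg[OF that] elim by auto
          then have "ennreal (1 / a) * ennreal (d + toll_slope u) = ennreal (\<bar>d + toll_slope u\<bar> / a)"
            using a by (simp add: ennreal_mult[symmetric])
          then show ?thesis by (simp add: ennreal_leI)
        qed
        then show ?case by (auto split: split_indicator)
      qed
    qed
    also have "\<dots> = ennreal (1 / a) * (\<integral>\<^sup>+u. indicator {x..x+h} (tilt c d u) * indicator {crit d..} u * ennreal (d + toll_slope u) \<partial>unif)"
      by (rule nn_integral_cmult, rule measurable_unif) measurable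
    also have "\<dots> \<le> ennreal (1 / a) * ennreal h" by (intro mult_left_mono branch_variation h) simp
    also have "\<dots> = ennreal (h / a)" using a h by (simp add: ennreal_mult[symmetric])
    finally show "(\<integral>\<^sup>+u. indicator {x..x+h} (tilt c d u) * indicator {crit d..} u * (\<lambda>s. ennreal (min 1 (\<bar>s\<bar> / a))) (d + toll_slope u) \<partial>unif) \<le> ennreal (h / a)" by simp
  qed auto
  also have "2 * ennreal (h / a) = ennreal (2 * h / a)"
    using h a by (simp add: ennreal_mult'[symmetric] flip: ennreal_numeral)
  finally show ?thesis by simp
qed

lemma ennreal_add_mult:
  "\<lbrakk>0 \<le> A; 0 \<le> B; 0 \<le> C\<rbrakk> \<Longrightarrow> ennreal (A + B * C) = ennreal A + ennreal B * ennreal C"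
  by (simp add: ennreal_mult)

lemma nn_integral_unif_affine:
  assumes [measurable]: "f \<in> borel_measurable borel"
  shows "(\<integral>\<^sup>+u. c + k * f u \<partial>unif) = c + k * (\<integral>\<^sup>+u. f u \<partial>unif)"
proof -
  have m: "f \<in> borel_measurable unif" "(\<lambda>u. k * f u) \<in> borel_measurable unif" by (rule measurable_unif, measurable)+
  have "(\<integral>\<^sup>+u. c + k * f u \<partial>unif) = (\<integral>\<^sup>+u. c \<partial>unif) + (\<integral>\<^sup>+u. k * f u \<partial>unif)"
    by (rule nn_integral_add) (use m in auto)
  also have "(\<integral>\<^sup>+u. c \<partial>unif) = c" using unif.emeasure_space_1 by (simp only: nn_integral_const mult_1_right)
  finally show ?thesis by (simp only: nn_integral_cmult[OF m(1)])
qed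

section \<open>Improving a Lipschitz bound for a fixed point\<close>

context
  fixes \<mu> :: "real measure"
  assumes fp: "qs_fixpoint_law \<mu>"
begin

interpretation real_distribution \<mu> by (rule real_distribution_fixpoint[OF fp])
interpretation mumu: pair_prob_space \<mu> \<mu> by unfold_locales
interpretation umumu: pair_prob_space unif "\<mu> \<Otimes>\<^sub>M \<mu>" by unfold_locales
interpretation mumur: pair_prob_space "\<mu> \<Otimes>\<^sub>M \<mu>" unif by unfold_locales

abbreviation slope_at :: "real \<times> real \<Rightarrow> real \<Rightarrow> real" where
  "slope_at q u \<equiv> (fst q - snd q) + toll_slope u"

abbreviation hit :: "real \<Rightarrow> real \<Rightarrow> real \<times> real \<Rightarrow> real \<Rightarrow> ennreal" where
  "hit x h q u \<equiv> indicator {x..x+h} (tilt (snd q) (fst q - snd q) u)"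

lemma measurable_hit [measurable]:
  "(\<lambda>p. hit x h (snd p) (fst p)) \<in> borel_measurable (unif \<Otimes>\<^sub>M (\<mu> \<Otimes>\<^sub>M \<mu>))"
  unfolding tilt_def by measurable

lemma emeasure_fixpoint: "emeasure \<mu> {x..x+h} = (\<integral>\<^sup>+p. hit x h (snd p) (fst p) \<partial>(unif \<Otimes>\<^sub>M (\<mu> \<Otimes>\<^sub>M \<mu>)))"
proof -
  have fe: "\<mu> = distr (unif \<Otimes>\<^sub>M (\<mu> \<Otimes>\<^sub>M \<mu>)) borel (\<lambda>(u, y, z). u * y + (1 - u) * z + toll u)"
    using fp by (simp add: qs_fixpoint_law_def)
  have "emeasure \<mu> {x..x+h} = (\<integral>\<^sup>+s. indicator {x..x+h} s \<partial>distr (unif \<Otimes>\<^sub>M (\<mu> \<Otimes>\<^sub>M \<mu>)) borel (\<lambda>(u, y, z). u * y + (1 - u) * z + toll u))"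
    using fe by simp
  also have "\<dots> = (\<integral>\<^sup>+p. indicator {x..x+h} (case p of (u, y, z) \<Rightarrow> u * y + (1 - u) * z + toll u) \<partial>(unif \<Otimes>\<^sub>M (\<mu> \<Otimes>\<^sub>M \<mu>)))"
    by (rule nn_integral_distr) measurable
  also have "\<dots> = (\<integral>\<^sup>+p. hit x h (snd p) (fst p) \<partial>(unif \<Otimes>\<^sub>M (\<mu> \<Otimes>\<^sub>M \<mu>)))"
    by (rule nn_integral_cong) (auto simp: tilt_def algebra_simps)
  finally show ?thesis .
qed

lemma nn_swap:
  assumes [measurable]: "f \<in> borel_measurable (unif \<Otimes>\<^sub>M (\<mu> \<Otimes>\<^sub>M \<mu>))"
  shows "(\<integral>\<^sup>+q. \<integral>\<^sup>+u. f (u, q) \<partial>unif \<partial>(\<mu> \<Otimes>\<^sub>M \<mu>)) = (\<integral>\<^sup>+p. f p \<partial>(unif \<Otimes>\<^sub>M (\<mu> \<Otimes>\<^sub>M \<mu>)))"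
    and "(\<integral>\<^sup>+u. \<integral>\<^sup>+q. f (u, q) \<partial>(\<mu> \<Otimes>\<^sub>M \<mu>) \<partial>unif) = (\<integral>\<^sup>+p. f p \<partial>(unif \<Otimes>\<^sub>M (\<mu> \<Otimes>\<^sub>M \<mu>)))"
  using umumu.nn_integral_snd[OF assms] mumu.P.nn_integral_fst[OF assms] by simp_all

text \<open>For every fixed pair (y, z) the randomness of the split alone gives this Hoelder bound,
  with no knowledge of the law of y and z.\<close>

lemma conc_sqrt:
  assumes h: "0 \<le> h" shows "emeasure \<mu> {x..x+h} \<le> ennreal (sqrt h)"
proof -
  have "emeasure \<mu> {x..x+h} = (\<integral>\<^sup>+q. \<integral>\<^sup>+u. hit x h q u \<partial>unif \<partial>(\<mu> \<Otimes>\<^sub>M \<mu>))"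
    unfolding emeasure_fixpoint using nn_swap(1)[OF measurable_hit] by simp
  also have "\<dots> \<le> (\<integral>\<^sup>+q. ennreal (sqrt h) \<partial>(\<mu> \<Otimes>\<^sub>M \<mu>))"
    by (rule nn_integral_mono) (rule tilt_length[OF h])
  also have "\<dots> = ennreal (sqrt h)" using mumu.P.emeasure_space_1 by simp
  finally show ?thesis .
qed

context
  fixes K :: real
  assumes K: "0 < K" and conc: "\<And>x h. 0 \<le> h \<Longrightarrow> emeasure \<mu> {x..x+h} \<le> ennreal (K * h)"
begin

text \<open>Given the second coordinate, the Lipschitz bound is spent on the first one; the second
  itself gets only the square-root bound. Spending the Lipschitz bound twice would make the result
  quadratic in \<open>K\<close>, and iteration could not bring a large \<open>K\<close>
  down.\<close>

lemma strip_first: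
  assumes l: "0 \<le> l" and d: "0 \<le> d" and [measurable]: "lo \<in> borel_measurable borel"
    and f: "\<And>y z. f (y, z) \<le> indicator {b..b+d} z * indicator {lo z..lo z + l} y"
  shows "(\<integral>\<^sup>+q. f q \<partial>(\<mu> \<Otimes>\<^sub>M \<mu>)) \<le> ennreal (K * l * sqrt d)"
proof -
  let ?g = "\<lambda>q. indicator {b..b+d} (snd q) * indicator {0..l} (fst q - lo (snd q)) :: ennreal"
  have gm: "?g \<in> borel_measurable (\<mu> \<Otimes>\<^sub>M \<mu>)" by measurable
  have "(\<integral>\<^sup>+q. f q \<partial>(\<mu> \<Otimes>\<^sub>M \<mu>)) \<le> (\<integral>\<^sup>+q. ?g q \<partial>(\<mu> \<Otimes>\<^sub>M \<mu>))"
  proof (rule nn_integral_mono)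
    fix q :: "real \<times> real"
    have "f q \<le> indicator {b..b+d} (snd q) * indicator {lo (snd q)..lo (snd q) + l} (fst q)" using f[of "fst q" "snd q"] by simp
    also have "\<dots> = ?g q" by (auto split: split_indicator)
    finally show "f q \<le> ?g q" .
  qed
  also have "\<dots> = (\<integral>\<^sup>+z. \<integral>\<^sup>+y. ?g (y, z) \<partial>\<mu> \<partial>\<mu>)" using mumu.nn_integral_snd[OF gm] by simp
  also have "\<dots> \<le> (\<integral>\<^sup>+z. ennreal (K * l) * indicator {b..b+d} z \<partial>\<mu>)"
  proof (rule nn_integral_mono)
    fix z
    have "(\<integral>\<^sup>+y. ?g (y, z) \<partial>\<mu>) = (\<integral>\<^sup>+y. indicator {b..b+d} z * indicator {lo z..lo z + l} y \<partial>\<mu>)"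
      by (rule nn_integral_cong) (auto split: split_indicator)
    also have "\<dots> = indicator {b..b+d} z * emeasure \<mu> {lo z..lo z + l}"
      by (rule nn_integral_cmult_indicator) simp
    also have "\<dots> \<le> indicator {b..b+d} z * ennreal (K * l)" by (intro mult_left_mono conc l) simp
    finally show "(\<integral>\<^sup>+y. ?g (y, z) \<partial>\<mu>) \<le> ennreal (K * l) * indicator {b..b+d} z" by (simp add: mult.commute)
  qed
  also have "\<dots> = ennreal (K * l) * emeasure \<mu> {b..b+d}" by (rule nn_integral_cmult_indicator) simp
  also have "\<dots> \<le> ennreal (K * l) * ennreal (sqrt d)" by (intro mult_left_mono conc_sqrt d) simp
  also have "\<dots> = ennreal (K * l * sqrt d)" using K l d by (simp add: ennreal_mult)
  finally show ?thesis .
qed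

lemma strip_second:
  assumes l: "0 \<le> l" and d: "0 \<le> d" and [measurable]: "lo \<in> borel_measurable borel"
    and fm: "f \<in> borel_measurable (\<mu> \<Otimes>\<^sub>M \<mu>)"
    and f: "\<And>y z. f (y, z) \<le> indicator {b..b+d} y * indicator {lo y..lo y + l} z"
  shows "(\<integral>\<^sup>+q. f q \<partial>(\<mu> \<Otimes>\<^sub>M \<mu>)) \<le> ennreal (K * l * sqrt d)"
proof -
  have fm': "(\<lambda>q. f (snd q, fst q)) \<in> borel_measurable (\<mu> \<Otimes>\<^sub>M \<mu>)"
    using fm by measurable
  have "(\<integral>\<^sup>+q. f q \<partial>(\<mu> \<Otimes>\<^sub>M \<mu>)) = (\<integral>\<^sup>+y. \<integral>\<^sup>+z. f (y, z) \<partial>\<mu> \<partial>\<mu>)"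
    using nn_integral_fst[OF fm] by simp
  also have "\<dots> = (\<integral>\<^sup>+q. f (snd q, fst q) \<partial>(\<mu> \<Otimes>\<^sub>M \<mu>))"
    using mumu.nn_integral_snd[OF fm'] by simp
  also have "\<dots> \<le> ennreal (K * l * sqrt d)"
    by (rule strip_first[OF l d assms(3), where b=b]) (use f in auto)
  finally show ?thesis .
qed

text \<open>Solving for the variable with the larger coefficient keeps h / V <= 2 h. For u >= 1/2
  the other one is confined by z = (u y + (1 - u) z) - u (y - z): both terms on the right lie in
  known intervals, of total length h + 2 r u. For u < 1/2 the roles of y and z are
  exchanged.\<close>

lemma near_critical:
  assumes u: "u \<in> {0..1}" and h: "0 \<le> h" and r: "0 \<le> r"
  shows "(\<integral>\<^sup>+q. hit x h q u * indicator {s. \<bar>s\<bar> < r} (slope_at q u) \<partial>(\<mu> \<Otimes>\<^sub>M \<mu>))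
     \<le> ennreal (K * (h / max u (1 - u)) * sqrt (h + 2 * r * max u (1 - u)))"
proof (cases "1/2 \<le> u")
  case True
  then have V: "max u (1 - u) = u" "0 < u" by auto
  show ?thesis unfolding V(1)
  proof (rule strip_first[where b="x - toll u + u * toll_slope u - u * r" and lo="\<lambda>z. (x - toll u - (1 - u) * z) / u"])
    fix y z
    show "hit x h (y, z) u * indicator {s. \<bar>s\<bar> < r} (slope_at (y, z) u)
       \<le> indicator {x - toll u + u * toll_slope u - u * r..x - toll u + u * toll_slope u - u * r + (h + 2 * r * u)} z
         * indicator {(x - toll u - (1 - u) * z) / u..(x - toll u - (1 - u) * z) / u + h / u} y"
    proof (cases "x \<le> tilt z (y - z) u \<and> tilt z (y - z) u \<le> x + h \<and> \<bar>y - z + toll_slope u\<bar> < r")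
      case T: True
      have t: "tilt z (y - z) u = u * y + (1 - u) * z + toll u" by (simp add: tilt_def algebra_simps)
      have "u * (y - z + toll_slope u) \<le> u * r" "- (u * r) \<le> u * (y - z + toll_slope u)"
        using T V(2) mult_left_mono[of "y - z + toll_slope u" r u] mult_left_mono[of "-r" "y - z + toll_slope u" u] by auto
      then have z: "z \<in> {x - toll u + u * toll_slope u - u * r..x - toll u + u * toll_slope u - u * r + (h + 2 * r * u)}"
        using T unfolding t by (auto simp: algebra_simps)
      have y: "y \<in> {(x - toll u - (1 - u) * z) / u..(x - toll u - (1 - u) * z) / u + h / u}"
        using T V(2) unfolding t by (auto simp: field_simps)
      show ?thesis using z y by (auto split: split_indicator)
    qed (auto split: split_indicator)
  qed (use V h r in auto)
next
  case False
  define w where "w = 1 - u"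
  have V: "max u (1 - u) = w" "0 < w" "u = 1 - w" using False by (auto simp: w_def)
  show ?thesis unfolding V(1)
  proof (rule strip_second[where b="x - toll u - w * toll_slope u - w * r" and lo="\<lambda>y. (x - toll u - u * y) / w"])
    fix y z
    show "hit x h (y, z) u * indicator {s. \<bar>s\<bar> < r} (slope_at (y, z) u)
       \<le> indicator {x - toll u - w * toll_slope u - w * r..x - toll u - w * toll_slope u - w * r + (h + 2 * r * w)} y
         * indicator {(x - toll u - u * y) / w..(x - toll u - u * y) / w + h / w} z"
    proof (cases "x \<le> tilt z (y - z) u \<and> tilt z (y - z) u \<le> x + h \<and> \<bar>y - z + toll_slope u\<bar> < r")
      case T: True
      have t: "tilt z (y - z) u = u * y + w * z + toll u" by (simp add: tilt_def w_def algebra_simps)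
      have "w * (y - z + toll_slope u) \<le> w * r" "- (w * r) \<le> w * (y - z + toll_slope u)"
        using T V(2) mult_left_mono[of "y - z + toll_slope u" r w] mult_left_mono[of "-r" "y - z + toll_slope u" w] by auto
      moreover have "u * y = y - w * y" by (subst V(3)) (simp add: left_diff_distrib)
      ultimately have z: "y \<in> {x - toll u - w * toll_slope u - w * r..x - toll u - w * toll_slope u - w * r + (h + 2 * r * w)}"
        using T unfolding t by (auto simp: algebra_simps)
      have y: "z \<in> {(x - toll u - u * y) / w..(x - toll u - u * y) / w + h / w}"
        using T V(2) unfolding t by (auto simp: field_simps)
      show ?thesis using z y by (auto split: split_indicator)
    qed (auto split: split_indicator)
  next
    show "(\<lambda>q. hit x h q u * indicator {s. \<bar>s\<bar> < r} (slope_at q u)) \<in> borel_measurable (\<mu> \<Otimes>\<^sub>M \<mu>)"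
      unfolding tilt_def by measurable
  qed (use V h r in auto)
qed

text \<open>A layer-cake formula: the complementary weight is the average over r of indicators of
  |s| < r a, to which \<open>near_critical\<close> applies.\<close>

lemma layer:
  fixes s a :: real assumes a: "0 < a"
  shows "(\<integral>\<^sup>+r. indicator {t. \<bar>t\<bar> < r * a} s \<partial>unif) = ennreal (1 - min 1 (\<bar>s\<bar> / a))"
proof -
  have "(\<integral>\<^sup>+r. indicator {t. \<bar>t\<bar> < r * a} s \<partial>unif) = (\<integral>\<^sup>+r. indicator {t. \<bar>t\<bar> < r * a} s * indicator {0..1} r \<partial>lborel)"
    by (rule nn_integral_unif) measurable
  also have "\<dots> = (\<integral>\<^sup>+r. indicator {min 1 (\<bar>s\<bar> / a)<..1} r \<partial>lborel)"
  proof (rule nn_integral_cong)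
    fix r :: real
    have "\<bar>s\<bar> < r * a \<longleftrightarrow> \<bar>s\<bar> / a < r" using a by (simp add: field_simps)
    moreover have "0 \<le> \<bar>s\<bar> / a" using a by simp
    ultimately show "indicator {t. \<bar>t\<bar> < r * a} s * indicator {0..1} r = (indicator {min 1 (\<bar>s\<bar> / a)<..1} r :: ennreal)"
      by (auto simp: min_def split: split_indicator)
  qed
  also have "\<dots> = ennreal (1 - min 1 (\<bar>s\<bar> / a))" by simp
  finally show ?thesis .
qed

lemma integral_sqrt_unif: "(\<integral>\<^sup>+r. ennreal (sqrt r) \<partial>unif) = ennreal (2/3)"
proof (rule nn_integral_unif_has_integral)
  have "(sqrt has_integral (2/3 * (1 * sqrt 1) - 2/3 * (0 * sqrt 0))) {0..1}"
  proof (rule fundamental_theorem_of_calculus_interior)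
    fix r :: real assume "r \<in> {0<..<1}"
    then have "((\<lambda>r. 2/3 * (r * sqrt r)) has_real_derivative 2/3 * (1 * sqrt r + r * (inverse (sqrt r) / 2))) (at r)"
      by (auto intro!: derivative_eq_intros)
    moreover have "2/3 * (1 * sqrt r + r * (inverse (sqrt r) / 2)) = sqrt r"
    proof -
      have "r * inverse (sqrt r) = sqrt r" using \<open>r \<in> {0<..<1}\<close> by (simp add: divide_inverse[symmetric] real_div_sqrt)
      then show ?thesis by simp
    qed
    ultimately show "((\<lambda>r. 2/3 * (r * sqrt r)) has_vector_derivative sqrt r) (at r)"
      by (simp add: has_real_derivative_iff_has_vector_derivative)
  qed (auto intro!: continuous_intros)
  then show "(sqrt has_integral 2/3) {0..1}" by simp
qed auto

lemma integral_max_unif: "(\<integral>\<^sup>+u. ennreal (1 / sqrt (max u (1 - u))) \<partial>unif) = ennreal (4 - 2 * sqrt 2)"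
proof (rule nn_integral_unif_has_integral)
  have s: "2 * sqrt (1/2) = sqrt (2::real)" by (simp add: real_sqrt_divide real_div_sqrt)
  have d: "(sqrt has_real_derivative inverse (sqrt v) / 2) (at v)" if "0 < v" for v :: real
    using that by (auto intro!: derivative_eq_intros)
  have "((\<lambda>u. 1 / sqrt u) has_integral (2 * sqrt 1 - 2 * sqrt (1/2))) {1/2..1}"
  proof (rule fundamental_theorem_of_calculus)
    fix u :: real assume "u \<in> {1/2..1}"
    then have "((\<lambda>u. 2 * sqrt u) has_real_derivative 2 * (inverse (sqrt u) / 2)) (at u)"
      by (intro DERIV_cmult d) auto
    then have "((\<lambda>u. 2 * sqrt u) has_real_derivative 1 / sqrt u) (at u within {1/2..1})"
      by (rule has_field_derivative_at_within[OF DERIV_cong]) (simp add: inverse_eq_divide)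
    then show "((\<lambda>u. 2 * sqrt u) has_vector_derivative 1 / sqrt u) (at u within {1/2..1})"
      by (simp only: has_real_derivative_iff_has_vector_derivative)
  qed simp
  then have "((\<lambda>u. 1 / sqrt u) has_integral (2 - sqrt 2)) {1/2..1}" unfolding s by simp
  then have R: "((\<lambda>u. 1 / sqrt (max u (1 - u))) has_integral (2 - sqrt 2)) {1/2..1}"
    by (rule has_integral_eq[rotated]) (auto simp: max_def)
  have "((\<lambda>u. 1 / sqrt (1 - u)) has_integral (- 2 * sqrt (1 - 1/2) - (- 2 * sqrt (1 - 0)))) {0..1/2}"
  proof (rule fundamental_theorem_of_calculus)
    fix u :: real assume u: "u \<in> {0..1/2}"
    have "((\<lambda>u. sqrt (1 - u)) has_real_derivative (inverse (sqrt (1 - u)) / 2) * (0 - 1)) (at u)"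
      by (rule DERIV_chain2[OF d DERIV_diff[OF DERIV_const DERIV_ident]]) (use u in auto)
    then have "((\<lambda>u. - 2 * sqrt (1 - u)) has_real_derivative - 2 * ((inverse (sqrt (1 - u)) / 2) * (0 - 1))) (at u)"
      by (rule DERIV_cmult)
    then have "((\<lambda>u. - 2 * sqrt (1 - u)) has_real_derivative 1 / sqrt (1 - u)) (at u within {0..1/2})"
      by (rule has_field_derivative_at_within[OF DERIV_cong]) (simp add: inverse_eq_divide)
    then show "((\<lambda>u. - 2 * sqrt (1 - u)) has_vector_derivative 1 / sqrt (1 - u)) (at u within {0..1/2})"
      by (simp only: has_real_derivative_iff_has_vector_derivative)
  qed simp
  then have "((\<lambda>u. 1 / sqrt (1 - u)) has_integral (2 - sqrt 2)) {0..1/2}" using s by simp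
  then have L: "((\<lambda>u. 1 / sqrt (max u (1 - u))) has_integral (2 - sqrt 2)) {0..1/2}"
    by (rule has_integral_eq[rotated]) (auto simp: max_def)
  show "((\<lambda>u. 1 / sqrt (max u (1 - u))) has_integral (4 - 2 * sqrt 2)) {0..1}"
    using has_integral_combine[OF _ _ L R] by simp
qed auto

text \<open>Weight the values of \<open>u\<close> by \<open>min 1 (|slope| / a)\<close> with \<open>a = 9/25\<close>. A change of variables bounds the weighted
  part by \<open>2 h / a = 50/9 h\<close>; the rest lives near the critical point of \<open>u \<mapsto> u y + (1 - u) z + toll u\<close>. For fixed \<open>u\<close> this
  confines \<open>(y, z)\<close> to a parallelogram, where the assumed bound \<open>K\<close> is used in one coordinate and the a priori bound
  \<open>conc_sqrt\<close> in the other.\<close>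

lemma conc_step:
  assumes h: "0 \<le> h"
  shows "emeasure \<mu> {x..x+h} \<le> ennreal (h * (50/9 + 663/1000 * K + 2 * K * sqrt h))"
proof -
  \<comment> \<open>Iteration leads to the limit (2/a) / (1 - c sqrt a) with c = sqrt 2 * (2/3) * (4
    - 2 sqrt 2). It is smallest at sqrt a = 2 / (3 c), about 0.6036; the nearby value 3/5 keeps
    \<open>sqrt (2 * a)\<close> a rational multiple of sqrt 2.\<close>
  define a :: real where "a = 9/25"
  have a: "0 < a" by (simp add: a_def)
  let ?w = "\<lambda>q u. min 1 (\<bar>slope_at q u\<bar> / a)"
  let ?F = "\<lambda>p. hit x h (snd p) (fst p) * ennreal (?w (snd p) (fst p))"
  let ?G = "\<lambda>p. hit x h (snd p) (fst p) * ennreal (1 - ?w (snd p) (fst p))"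
  have m: "?F \<in> borel_measurable (unif \<Otimes>\<^sub>M (\<mu> \<Otimes>\<^sub>M \<mu>))" "?G \<in> borel_measurable (unif \<Otimes>\<^sub>M (\<mu> \<Otimes>\<^sub>M \<mu>))"
    unfolding tilt_def by measurable
  have "emeasure \<mu> {x..x+h} = (\<integral>\<^sup>+p. ?F p + ?G p \<partial>(unif \<Otimes>\<^sub>M (\<mu> \<Otimes>\<^sub>M \<mu>)))"
    unfolding emeasure_fixpoint
  proof (rule nn_integral_cong)
    fix p :: "real \<times> real \<times> real"
    have "0 \<le> ?w (snd p) (fst p)" "?w (snd p) (fst p) \<le> 1" using a by auto
    then have "ennreal (?w (snd p) (fst p)) + ennreal (1 - ?w (snd p) (fst p)) = 1"
      by (simp add: ennreal_plus[symmetric] del: ennreal_plus)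
    then have "hit x h (snd p) (fst p) * (ennreal (?w (snd p) (fst p)) + ennreal (1 - ?w (snd p) (fst p))) = hit x h (snd p) (fst p)"
      by (simp only: mult_1_right)
    then show "hit x h (snd p) (fst p) = ?F p + ?G p" by (simp only: distrib_left)
  qed
  also have "\<dots> = (\<integral>\<^sup>+p. ?F p \<partial>(unif \<Otimes>\<^sub>M (\<mu> \<Otimes>\<^sub>M \<mu>))) + (\<integral>\<^sup>+p. ?G p \<partial>(unif \<Otimes>\<^sub>M (\<mu> \<Otimes>\<^sub>M \<mu>)))"
    by (rule nn_integral_add[OF m])
  finally have split: "emeasure \<mu> {x..x+h} = (\<integral>\<^sup>+p. ?F p \<partial>(unif \<Otimes>\<^sub>M (\<mu> \<Otimes>\<^sub>M \<mu>))) + (\<integral>\<^sup>+p. ?G p \<partial>(unif \<Otimes>\<^sub>M (\<mu> \<Otimes>\<^sub>M \<mu>)))" .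
  have F: "(\<integral>\<^sup>+p. ?F p \<partial>(unif \<Otimes>\<^sub>M (\<mu> \<Otimes>\<^sub>M \<mu>))) \<le> ennreal (2 * h / a)"
  proof -
    have "(\<integral>\<^sup>+p. ?F p \<partial>(unif \<Otimes>\<^sub>M (\<mu> \<Otimes>\<^sub>M \<mu>))) = (\<integral>\<^sup>+q. \<integral>\<^sup>+u. hit x h q u * ennreal (?w q u) \<partial>unif \<partial>(\<mu> \<Otimes>\<^sub>M \<mu>))"
      using nn_swap(1)[OF m(1)] by simp
    also have "\<dots> \<le> (\<integral>\<^sup>+q. ennreal (2 * h / a) \<partial>(\<mu> \<Otimes>\<^sub>M \<mu>))"
      by (rule nn_integral_mono) (rule tilt_variation[OF h a])
    also have "\<dots> = ennreal (2 * h / a)" using mumu.P.emeasure_space_1 by simp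
    finally show ?thesis .
  qed
  have G: "(\<integral>\<^sup>+p. ?G p \<partial>(unif \<Otimes>\<^sub>M (\<mu> \<Otimes>\<^sub>M \<mu>))) \<le> ennreal (2 * K * h * sqrt h + K * h * sqrt (2 * a) * (2/3) * (4 - 2 * sqrt 2))"
  proof -
    have "(\<integral>\<^sup>+p. ?G p \<partial>(unif \<Otimes>\<^sub>M (\<mu> \<Otimes>\<^sub>M \<mu>))) = (\<integral>\<^sup>+u. \<integral>\<^sup>+q. hit x h q u * ennreal (1 - ?w q u) \<partial>(\<mu> \<Otimes>\<^sub>M \<mu>) \<partial>unif)"
      using nn_swap(2)[OF m(2)] by simp
    also have "\<dots> \<le> (\<integral>\<^sup>+u. ennreal (2 * K * h * sqrt h) + ennreal (K * h * sqrt (2 * a) * (2/3)) * ennreal (1 / sqrt (max u (1 - u))) \<partial>unif)"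
    proof (rule nn_integral_mono_AE)
      show "AE u in unif. (\<integral>\<^sup>+q. hit x h q u * ennreal (1 - ?w q u) \<partial>(\<mu> \<Otimes>\<^sub>M \<mu>))
        \<le> ennreal (2 * K * h * sqrt h) + ennreal (K * h * sqrt (2 * a) * (2/3)) * ennreal (1 / sqrt (max u (1 - u)))"
        using AE_unif_Icc
      proof eventually_elim
        case (elim u)
        define V where "V = max u (1 - u)"
        have V: "1/2 \<le> V" "V \<le> 1" using elim by (auto simp: V_def max_def)
        let ?k = "\<lambda>(q, r). hit x h q u * indicator {t. \<bar>t\<bar> < r * a} (slope_at q u)"
        have km: "?k \<in> borel_measurable ((\<mu> \<Otimes>\<^sub>M \<mu>) \<Otimes>\<^sub>M unif)"
        proof -
          have "?k = (\<lambda>p. hit x h (fst p) u * indicator {p. \<bar>slope_at (fst p) u\<bar> < snd p * a} p)"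
            by (auto split: split_indicator)
          moreover have "(\<lambda>p. hit x h (fst p) u * indicator {p \<in> space ((\<mu> \<Otimes>\<^sub>M \<mu>) \<Otimes>\<^sub>M unif). \<bar>slope_at (fst p) u\<bar> < snd p * a} p) \<in> borel_measurable ((\<mu> \<Otimes>\<^sub>M \<mu>) \<Otimes>\<^sub>M unif)"
            unfolding tilt_def by measurable
          ultimately show ?thesis by (simp add: space_pair_measure)
        qed
        have "(\<integral>\<^sup>+q. hit x h q u * ennreal (1 - ?w q u) \<partial>(\<mu> \<Otimes>\<^sub>M \<mu>)) = (\<integral>\<^sup>+q. \<integral>\<^sup>+r. ?k (q, r) \<partial>unif \<partial>(\<mu> \<Otimes>\<^sub>M \<mu>))"
        proof (rule nn_integral_cong)
          fix q
          have lm: "(\<lambda>r. indicator {t. \<bar>t\<bar> < r * a} (slope_at q u) :: ennreal) \<in> borel_measurable unif"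
            by (rule measurable_unif) measurable
          show "hit x h q u * ennreal (1 - ?w q u) = (\<integral>\<^sup>+r. ?k (q, r) \<partial>unif)"
            using nn_integral_cmult[OF lm, of "hit x h q u"] layer[OF a, of "slope_at q u"] by simp
        qed
        also have "\<dots> = (\<integral>\<^sup>+r. \<integral>\<^sup>+q. ?k (q, r) \<partial>(\<mu> \<Otimes>\<^sub>M \<mu>) \<partial>unif)"
          using mumur.Fubini'[OF km, symmetric] by simp
        also have "\<dots> \<le> (\<integral>\<^sup>+r. ennreal (2 * K * h * sqrt h) + ennreal (K * h * sqrt (2 * a) / sqrt V) * ennreal (sqrt r) \<partial>unif)"
        proof (rule nn_integral_mono_AE)
          show "AE r in unif. (\<integral>\<^sup>+q. ?k (q, r) \<partial>(\<mu> \<Otimes>\<^sub>M \<mu>)) \<le> ennreal (2 * K * h * sqrt h) + ennreal (K * h * sqrt (2 * a) / sqrt V) * ennreal (sqrt r)"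
            using AE_unif_Icc
          proof eventually_elim
            case r: (elim r)
            have "(\<integral>\<^sup>+q. ?k (q, r) \<partial>(\<mu> \<Otimes>\<^sub>M \<mu>)) \<le> ennreal (K * (h / V) * sqrt (h + 2 * (r * a) * V))"
              using near_critical[OF elim h, of "r * a" x] r a by (simp add: V_def)
            also have "\<dots> \<le> ennreal (2 * K * h * sqrt h + K * h * sqrt (2 * a) / sqrt V * sqrt r)"
            proof (rule ennreal_leI)
              \<comment> \<open>Subadditivity of the root separates a part of order h^(3/2), which
                disappears in \<open>conc_improve\<close>, from a part linear in h. In the latter
                sqrt r averages to 2/3 and 1 / sqrt V to 4 - 2 sqrt 2.\<close>
              have "sqrt (h + 2 * (r * a) * V) \<le> sqrt h + sqrt (2 * (r * a) * V)"
                using h r a V by (intro sqrt_add_le_add_sqrt) auto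
              also have "sqrt (2 * (r * a) * V) = sqrt (2 * a) * sqrt r * sqrt V"
                by (simp add: real_sqrt_mult mult_ac)
              finally have "K * (h / V) * sqrt (h + 2 * (r * a) * V) \<le> K * (h / V) * (sqrt h + sqrt (2 * a) * sqrt r * sqrt V)"
                using K h V by (intro mult_left_mono) auto
              also have "\<dots> = K * h * sqrt h * (1 / V) + K * h * sqrt (2 * a) * sqrt r * (sqrt V / V)"
                by (simp add: algebra_simps)
              also have "sqrt V / V = 1 / sqrt V" using V by (simp add: field_simps)
              also have "K * h * sqrt h * (1 / V) \<le> K * h * sqrt h * 2"
                using K h V by (intro mult_left_mono) (auto simp: field_simps)
              finally show "K * (h / V) * sqrt (h + 2 * (r * a) * V) \<le> 2 * K * h * sqrt h + K * h * sqrt (2 * a) / sqrt V * sqrt r"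
                by (simp add: mult_ac)
            qed
            also have "\<dots> = ennreal (2 * K * h * sqrt h) + ennreal (K * h * sqrt (2 * a) / sqrt V) * ennreal (sqrt r)"
              using K h a V r by (intro ennreal_add_mult) auto
            finally show ?case .
          qed
        qed
        also have "\<dots> = ennreal (2 * K * h * sqrt h) + ennreal (K * h * sqrt (2 * a) / sqrt V) * ennreal (2/3)"
          by (subst nn_integral_unif_affine) (simp_all only: integral_sqrt_unif, measurable)
        also have "ennreal (K * h * sqrt (2 * a) / sqrt V) * ennreal (2/3) = ennreal (K * h * sqrt (2 * a) * (2/3)) * ennreal (1 / sqrt V)"
          using K h a V by (simp add: ennreal_mult[symmetric])
        finally show ?case unfolding V_def .
      qed
    qed
    also have "\<dots> = ennreal (2 * K * h * sqrt h) + ennreal (K * h * sqrt (2 * a) * (2/3)) * ennreal (4 - 2 * sqrt 2)"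
      by (subst nn_integral_unif_affine) (simp_all only: integral_max_unif, measurable)
    also have "\<dots> = ennreal (2 * K * h * sqrt h + K * h * sqrt (2 * a) * (2/3) * (4 - 2 * sqrt 2))"
    proof -
      have "sqrt 2 \<le> (2::real)" by (rule real_le_lsqrt) auto
      then show ?thesis using K h a by (intro ennreal_add_mult[symmetric]) auto
    qed
    finally show ?thesis .
  qed
  have "emeasure \<mu> {x..x+h} \<le> ennreal (2 * h / a) + ennreal (2 * K * h * sqrt h + K * h * sqrt (2 * a) * (2/3) * (4 - 2 * sqrt 2))"
    unfolding split by (rule add_mono[OF F G])
  also have "\<dots> \<le> ennreal (h * (50/9 + 663/1000 * K + 2 * K * sqrt h))"
  proof -
    have s2: "sqrt 2 \<le> (141437/100000::real)" by (rule real_le_lsqrt) (simp_all add: power2_eq_square)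
    have sa: "sqrt (2 * a) = 3/5 * sqrt 2"
    proof -
      have "2 * a = (3/5)^2 * 2" by (simp add: a_def power2_eq_square)
      then show ?thesis by (simp add: real_sqrt_mult)
    qed
    have "3/5 * r * (2/3) * (4 - 2 * r) = 8/5 * r - 8/5" if "r * r = 2" for r :: real
    proof -
      have "3/5 * r * (2/3) * (4 - 2 * r) = 2/5 * r * (4 - 2 * r)" by simp
      also have "\<dots> = 8/5 * r - 4/5 * (r * r)" unfolding right_diff_distrib by simp
      finally have "3/5 * r * (2/3) * (4 - 2 * r) = 8/5 * r - 4/5 * (r * r)" .
      then show ?thesis unfolding that by simp
    qed
    from this[of "sqrt 2"] have "sqrt (2 * a) * (2/3) * (4 - 2 * sqrt 2) = 8/5 * sqrt 2 - 8/5" unfolding sa by simp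
    also have "\<dots> \<le> 663/1000" using s2 by linarith
    finally have e: "sqrt (2 * a) * (2/3) * (4 - 2 * sqrt 2) \<le> 663/1000" .
    have e0: "0 \<le> sqrt (2 * a) * (2/3) * (4 - 2 * sqrt 2)"
    proof -
      have "0 \<le> 4 - 2 * sqrt (2::real)" using s2 by linarith
      then show ?thesis using a by (intro mult_nonneg_nonneg) auto
    qed
    have "K * h * (sqrt (2 * a) * (2/3) * (4 - 2 * sqrt 2)) \<le> K * h * (663/1000)"
      using K h e by (intro mult_left_mono) auto
    moreover have "0 \<le> K * h * (sqrt (2 * a) * (2/3) * (4 - 2 * sqrt 2))" by (rule mult_nonneg_nonneg[OF _ e0]) (use K h in auto)
    moreover have "0 \<le> 2 * K * h * sqrt h" using K h by simp
    moreover have "2 * h / a = 50/9 * h" by (simp add: a_def)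
    moreover have "h * (50/9 + 663/1000 * K + 2 * K * sqrt h) = 50/9 * h + K * h * (663/1000) + 2 * K * h * sqrt h"
      by (simp add: algebra_simps)
    ultimately have "2 * h / a + (2 * K * h * sqrt h + K * h * (sqrt (2 * a) * (2/3) * (4 - 2 * sqrt 2))) \<le> h * (50/9 + 663/1000 * K + 2 * K * sqrt h)"
      "0 \<le> 2 * K * h * sqrt h + K * h * (sqrt (2 * a) * (2/3) * (4 - 2 * sqrt 2))"
      by linarith+
    moreover have "ennreal A + ennreal B \<le> ennreal C" if "A + B \<le> C" "0 \<le> A" "0 \<le> B" for A B C
      using that by (simp add: ennreal_plus[symmetric] ennreal_leI del: ennreal_plus)
    moreover have "0 \<le> 2 * h / a" using h a by simp
    ultimately show ?thesis unfolding mult.assoc[of "K * h"] by (simp only: mult.assoc)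
  qed
  finally show ?thesis .
qed

text \<open>Cutting the interval into k + 1 equal pieces, applying \<open>conc_step\<close> to each
  and letting k tend to infinity removes the lower-order term with sqrt h.\<close>

lemma conc_improve:
  assumes l: "0 \<le> l"
  shows "emeasure \<mu> {x..x+l} \<le> ennreal ((50/9 + 663/1000 * K) * l)"
proof -
  have sub: "measure \<mu> {x..x + real k * d} \<le> real k * B"
    if d: "0 \<le> d" and B: "\<And>x. measure \<mu> {x..x+d} \<le> B" for k d B
  proof (induction k)
    case 0
    have "emeasure \<mu> {x..x+0} \<le> ennreal (K * 0)" by (rule conc) simp
    then show ?case by (simp add: measure_def)
  next
    case (Suc k)
    have "{x..x + real (Suc k) * d} \<subseteq> {x..x + real k * d} \<union> {x + real k * d..(x + real k * d) + d}"
      by (auto simp: algebra_simps)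
    then have "measure \<mu> {x..x + real (Suc k) * d} \<le> measure \<mu> ({x..x + real k * d} \<union> {x + real k * d..(x + real k * d) + d})"
      by (intro finite_measure_mono) auto
    also have "\<dots> \<le> measure \<mu> {x..x + real k * d} + measure \<mu> {x + real k * d..(x + real k * d) + d}"
      by (rule measure_Un_le) auto
    also have "\<dots> \<le> real k * B + B" by (intro add_mono Suc B)
    finally show ?case by (simp add: algebra_simps)
  qed
  let ?c = "\<lambda>k. l * (50/9 + 663/1000 * K + 2 * K * sqrt (l / real (Suc k)))"
  have b: "measure \<mu> {x..x+l} \<le> ?c k" for k
  proof -
    define d where "d = l / real (Suc k)"
    have d: "0 \<le> d" "real (Suc k) * d = l" using l by (simp_all add: d_def)
    have "measure \<mu> {y..y+d} \<le> d * (50/9 + 663/1000 * K + 2 * K * sqrt d)" for y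
    proof -
      have "0 \<le> d * (50/9 + 663/1000 * K + 2 * K * sqrt d)" using d K by (intro mult_nonneg_nonneg add_nonneg_nonneg) auto
      then show ?thesis using conc_step[OF d(1), of y] by (simp add: emeasure_eq_measure)
    qed
    from sub[OF d(1) this, of "Suc k"]
    have "measure \<mu> {x..x+l} \<le> real (Suc k) * (d * (50/9 + 663/1000 * K + 2 * K * sqrt d))" unfolding d(2) .
    also have "\<dots> = ?c k" unfolding mult.assoc[symmetric] d(2) by (simp add: d_def)
    finally show ?thesis .
  qed
  have sq: "(\<lambda>k. sqrt (l / real (Suc k))) \<longlonglongrightarrow> sqrt 0"
    by (intro tendsto_real_sqrt) (rule LIMSEQ_Suc[OF lim_const_over_n])
  have "?c \<longlonglongrightarrow> l * (50/9 + 663/1000 * K + 2 * K * sqrt 0)"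
    by (intro tendsto_mult tendsto_add tendsto_const sq)
  then have "measure \<mu> {x..x+l} \<le> l * (50/9 + 663/1000 * K + 2 * K * sqrt 0)"
    by (rule LIMSEQ_le_const) (use b in auto)
  then show ?thesis by (simp add: emeasure_eq_measure ennreal_leI mult.commute)
qed

end

text \<open>Iterating \<open>K \<mapsto> 50/9 + 0.663 K\<close> drives any finite bound down to its fixed point \<open>50000/3033 < 33/2\<close>.\<close>

lemma concentration:
  assumes K: "0 < K" and conc: "\<And>x h. 0 \<le> h \<Longrightarrow> emeasure \<mu> {x..x+h} \<le> ennreal (K * h)"
    and h: "0 \<le> h"
  shows "measure \<mu> {x..x+h} \<le> 33/2 * h"
proof -
  let ?K = "\<lambda>j. 50000/3033 + (663/1000)^j * K"
  have "emeasure \<mu> {x..x+h} \<le> ennreal (?K j * h)" if "0 \<le> h" for j x h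
    using that
  proof (induction j arbitrary: x h)
    case 0
    have "emeasure \<mu> {x..x+h} \<le> ennreal (K * h)" using 0 by (rule conc)
    also have "\<dots> \<le> ennreal (?K 0 * h)" using 0 by (intro ennreal_leI mult_right_mono) auto
    finally show ?case .
  next
    case (Suc j)
    have "0 < ?K j" using K by (simp add: add_pos_pos)
    from conc_improve[OF this Suc.IH Suc.prems, of x]
    have "emeasure \<mu> {x..x+h} \<le> ennreal ((50/9 + 663/1000 * ?K j) * h)" .
    also have "50/9 + 663/1000 * ?K j = ?K (Suc j)" by (simp add: distrib_left add_divide_distrib)
    finally show ?case .
  qed
  then have b: "measure \<mu> {x..x+h} \<le> ?K j * h" for j
    using h K by (simp add: emeasure_eq_measure)
  have "(\<lambda>j. ?K j * h) \<longlonglongrightarrow> (50000/3033 + 0 * K) * h"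
    by (intro tendsto_intros LIMSEQ_realpow_zero) auto
  then have "measure \<mu> {x..x+h} \<le> (50000/3033 + 0 * K) * h"
    by (rule LIMSEQ_le_const) (use b in auto)
  also have "\<dots> \<le> 33/2 * h" using h by (intro mult_right_mono) auto
  finally show ?thesis .
qed

end

section \<open>A random binary tree\<close>

text \<open>Nodes are addressed by words over \<open>bool\<close>, the root by \<open>[]\<close>. A
  subtree is then a mere reindexing of labels, and the space is a product of one label and two
  copies of itself.\<close>

definition tree_space :: "(bool list \<Rightarrow> real) measure" where
  "tree_space = PiM UNIV (\<lambda>_. unif)"

definition subtree :: "bool \<Rightarrow> (bool list \<Rightarrow> real) \<Rightarrow> bool list \<Rightarrow> real" where
  "subtree b \<omega> = (\<lambda>xs. \<omega> (b # xs))"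

definition graft :: "real \<Rightarrow> (bool list \<Rightarrow> real) \<Rightarrow> (bool list \<Rightarrow> real) \<Rightarrow> bool list \<Rightarrow> real" where
  "graft u l r = (\<lambda>xs. case xs of [] \<Rightarrow> u | b # ys \<Rightarrow> if b then l ys else r ys)"

lemma graft_simps [simp]: "graft u l r [] = u" "subtree True (graft u l r) = l" "subtree False (graft u l r) = r"
  by (auto simp: graft_def subtree_def)

interpretation tree: product_prob_space "\<lambda>_. unif" "UNIV :: bool list set"
  by unfold_locales

lemma prob_space_tree: "prob_space tree_space"
  unfolding tree_space_def by (rule tree.P.prob_space_axioms)

interpretation tree_space: prob_space tree_space by (rule prob_space_tree)

lemma space_tree [simp]: "space tree_space = UNIV"
  by (simp add: tree_space_def space_PiM)

lemma sets_tree [measurable_cong]: "sets tree_space = sets (PiM UNIV (\<lambda>_. borel))"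
  unfolding tree_space_def by (rule sets_PiM_cong) auto

lemma measurable_root [measurable]: "(\<lambda>\<omega>. \<omega> xs) \<in> borel_measurable tree_space"
proof -
  have "(\<lambda>\<omega>::bool list \<Rightarrow> real. \<omega> xs) \<in> measurable (PiM UNIV (\<lambda>_. borel)) borel"
    by (rule measurable_component_singleton) simp
  then show ?thesis by (simp cong: measurable_cong_sets add: sets_tree)
qed

lemma measurable_treeI:
  assumes "\<And>xs. (\<lambda>x. f x xs) \<in> borel_measurable M"
  shows "f \<in> measurable M tree_space"
proof -
  have "f \<in> measurable M (PiM UNIV (\<lambda>_. borel))"
    by (rule measurable_PiM_single') (use assms in auto)
  then show ?thesis using measurable_cong_sets[OF refl sets_tree] by blast
qed

lemma measurable_subtree [measurable]: "subtree b \<in> measurable tree_space tree_space"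
  by (rule measurable_treeI) (simp add: subtree_def)

lemma measurable_graft [measurable]:
  "(\<lambda>(u, l, r). graft u l r) \<in> measurable (unif \<Otimes>\<^sub>M (tree_space \<Otimes>\<^sub>M tree_space)) tree_space"
proof (rule measurable_treeI)
  fix xs :: "bool list"
  show "(\<lambda>x. (case x of (u, l, r) \<Rightarrow> graft u l r) xs)
    \<in> borel_measurable (unif \<Otimes>\<^sub>M (tree_space \<Otimes>\<^sub>M tree_space))"
  proof (cases xs)
    case Nil
    then show ?thesis by (simp add: split_beta graft_def)
  next
    case (Cons b ys)
    have 1: "(\<lambda>x. fst (snd x) ys) \<in> borel_measurable (unif \<Otimes>\<^sub>M (tree_space \<Otimes>\<^sub>M tree_space))"
     and 2: "(\<lambda>x. snd (snd x) ys) \<in> borel_measurable (unif \<Otimes>\<^sub>M (tree_space \<Otimes>\<^sub>M tree_space))"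
      by (rule measurable_compose[OF _ measurable_root], measurable)+
    from Cons 1 2 show ?thesis
      by (cases b) (simp_all add: split_beta graft_def)
  qed
qed

text \<open>Self-similarity of the tree: root label and subtrees are independent, and the subtrees
  are distributed as the whole. It suffices to check cylinders, where the finite index set
  \<open>J\<close> splits into the root and the words beginning with True and with False.\<close>

lemma distr_graft:
  "distr (unif \<Otimes>\<^sub>M (tree_space \<Otimes>\<^sub>M tree_space)) tree_space (\<lambda>(u, l, r). graft u l r) = tree_space"
  (is "?D = _")
proof -
  interpret TT: pair_prob_space tree_space tree_space by unfold_locales
  interpret UTT: pair_prob_space unif "tree_space \<Otimes>\<^sub>M tree_space" by unfold_locales
  have "tree_space = ?D"
    unfolding tree_space_def
  proof (rule measure_eqI_PiM_infinite[symmetric])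
    show "sets (distr (unif \<Otimes>\<^sub>M (PiM UNIV (\<lambda>_. unif) \<Otimes>\<^sub>M PiM UNIV (\<lambda>_. unif))) (PiM UNIV (\<lambda>_. unif))
            (\<lambda>(u, l, r). graft u l r)) = sets (PiM UNIV (\<lambda>_::bool list. unif))" by simp
    show "sets (PiM UNIV (\<lambda>_::bool list. unif)) = sets (PiM UNIV (\<lambda>_. unif))" ..
    fix A J assume J: "finite J" "J \<subseteq> (UNIV :: bool list set)"
      and A: "\<And>i. i \<in> J \<Longrightarrow> A i \<in> sets unif"
    \<comment> \<open>Padding with the whole line, which has mass 1, gives a factor for the root
      even if \<open>[]\<close> is not in \<open>J\<close>.\<close>
    define B where "B i = (if i \<in> J then A i else UNIV)" for i
    have B[measurable]: "B i \<in> sets borel" for i using A by (auto simp: B_def)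
    let ?E = "prod_emb UNIV (\<lambda>_. unif) J (Pi\<^sub>E J A)"
    have E: "?E = {\<omega>. \<forall>i\<in>J. \<omega> i \<in> A i}"
      by (auto simp: prod_emb_def PiE_def Pi_def restrict_def extensional_def)
    define JT where "JT b = {ys. b # ys \<in> J}" for b
    have fJT: "finite (JT b)" for b
      unfolding JT_def using finite_vimageI[OF J(1), of "Cons b"] by (simp add: vimage_def)
    define F where "F b = {\<omega> :: bool list \<Rightarrow> real. \<forall>i\<in>JT b. \<omega> i \<in> B (b # i)}" for b
    have Fe: "F b = prod_emb UNIV (\<lambda>_. unif) (JT b) (Pi\<^sub>E (JT b) (\<lambda>i. B (b # i)))" for b
      by (auto simp: F_def prod_emb_def PiE_def Pi_def restrict_def extensional_def)
    have emF: "emeasure tree_space (F b) = (\<Prod>i\<in>JT b. emeasure unif (B (b # i)))" for b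
      unfolding Fe tree_space_def by (rule tree.emeasure_PiM_emb) (use fJT in auto)
    have Fm[measurable]: "F b \<in> sets tree_space" for b
      unfolding Fe tree_space_def by (rule sets_PiM_I) (use fJT in auto) 
    have Em: "?E \<in> sets tree_space" 
      unfolding tree_space_def by (rule sets_PiM_I) (use J A in auto)
    have pre: "(\<lambda>(u, l, r). graft u l r) -` ?E \<inter> space (unif \<Otimes>\<^sub>M (tree_space \<Otimes>\<^sub>M tree_space))
       = B [] \<times> (F True \<times> F False)"
    proof -
      have "(\<forall>i\<in>J. graft u l r i \<in> A i) \<longleftrightarrow> u \<in> B [] \<and> l \<in> F True \<and> r \<in> F False" for u l r
      proof
        assume H: "\<forall>i\<in>J. graft u l r i \<in> A i"
        have "\<forall>i\<in>JT True. l i \<in> A (True # i)" "\<forall>i\<in>JT False. r i \<in> A (False # i)"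
          using H by (fastforce simp: JT_def graft_def)+
        moreover have "u \<in> B []" using H by (auto simp: B_def graft_def dest: bspec[of _ _ "[]"])
        ultimately show "u \<in> B [] \<and> l \<in> F True \<and> r \<in> F False" by (auto simp: F_def B_def)
      next
        assume H: "u \<in> B [] \<and> l \<in> F True \<and> r \<in> F False"
        show "\<forall>i\<in>J. graft u l r i \<in> A i"
        proof
          fix i assume i: "i \<in> J"
          show "graft u l r i \<in> A i"
          proof (cases i)
            case Nil then show ?thesis using H i by (auto simp: graft_def B_def)
          next
            case (Cons b ys) 
            then have "ys \<in> JT b" using i by (simp add: JT_def)
            then show ?thesis using H i Cons by (cases b) (auto simp: graft_def B_def F_def)
          qed
        qed
      qed
      then show ?thesis by (auto simp: E space_pair_measure)
    qed
    have "emeasure ?D ?E = emeasure (unif \<Otimes>\<^sub>M (tree_space \<Otimes>\<^sub>M tree_space)) (B [] \<times> (F True \<times> F False))"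
      by (subst emeasure_distr) (use Em pre in auto)
    also have "\<dots> = emeasure unif (B []) * (emeasure tree_space (F True) * emeasure tree_space (F False))"
      by (simp add: tree_space.emeasure_pair_measure_Times TT.P.emeasure_pair_measure_Times)
    also have "\<dots> = (\<Prod>i\<in>J. emeasure unif (B i))"
    proof -
      have Jeq: "(if [] \<in> J then {[]} else {}) \<union> (Cons True ` JT True \<union> Cons False ` JT False) = J"
      proof (intro equalityI subsetI)
        fix i assume "i \<in> J" then show "i \<in> (if [] \<in> J then {[]} else {}) \<union> (Cons True ` JT True \<union> Cons False ` JT False)"
        proof (cases i)
          case (Cons b ys)
          with \<open>i \<in> J\<close> show ?thesis by (cases b) (auto simp: JT_def)
        qed (use \<open>i \<in> J\<close> in auto)
      qed (auto simp: JT_def split: if_splits)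
      have e1: "emeasure unif (B []) = (\<Prod>i\<in>(if [] \<in> J then {[]} else {}). emeasure unif (B i))"
        using unif.emeasure_space_1 by (auto simp: B_def)
      have e2: "(\<Prod>i\<in>Cons b ` JT b. emeasure unif (B i)) = (\<Prod>i\<in>JT b. emeasure unif (B (b # i)))" for b
        by (subst prod.reindex) auto
      have "(\<Prod>i\<in>J. emeasure unif (B i)) = (\<Prod>i\<in>(if [] \<in> J then {[]} else {}) \<union> (Cons True ` JT True \<union> Cons False ` JT False). emeasure unif (B i))"
        by (simp only: Jeq)
      also have "\<dots> = (\<Prod>i\<in>(if [] \<in> J then {[]} else {}). emeasure unif (B i)) *
          ((\<Prod>i\<in>Cons True ` JT True. emeasure unif (B i)) * (\<Prod>i\<in>Cons False ` JT False. emeasure unif (B i)))"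
      proof -
        have "(\<Prod>i\<in>Cons True ` JT True \<union> Cons False ` JT False. emeasure unif (B i)) =
            (\<Prod>i\<in>Cons True ` JT True. emeasure unif (B i)) * (\<Prod>i\<in>Cons False ` JT False. emeasure unif (B i))"
          by (rule prod.union_disjoint) (use fJT in auto)
        moreover have "(\<Prod>i\<in>(if [] \<in> J then {[]} else {}) \<union> (Cons True ` JT True \<union> Cons False ` JT False). emeasure unif (B i)) =
          (\<Prod>i\<in>(if [] \<in> J then {[]} else {}). emeasure unif (B i)) *
          (\<Prod>i\<in>Cons True ` JT True \<union> Cons False ` JT False. emeasure unif (B i))"
          by (rule prod.union_disjoint) (use fJT in auto)
        ultimately show ?thesis by (simp only:)
      qed
      finally show ?thesis unfolding e1 emF e2 by simp
    qed
    also have "\<dots> = (\<Prod>i\<in>J. emeasure unif (A i))" by (rule prod.cong) (auto simp: B_def)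
    also have "\<dots> = emeasure (PiM UNIV (\<lambda>_. unif)) ?E"
      by (rule tree.emeasure_PiM_emb[symmetric]) (use J A in auto)
    finally show "emeasure (distr (unif \<Otimes>\<^sub>M (PiM UNIV (\<lambda>_. unif) \<Otimes>\<^sub>M PiM UNIV (\<lambda>_. unif))) (PiM UNIV (\<lambda>_. unif))
            (\<lambda>(u, l, r). graft u l r)) ?E = emeasure (PiM UNIV (\<lambda>_. unif)) ?E"
      unfolding tree_space_def .
  next
    show "finite_measure (distr (unif \<Otimes>\<^sub>M (PiM UNIV (\<lambda>_. unif) \<Otimes>\<^sub>M PiM UNIV (\<lambda>_. unif))) (PiM UNIV (\<lambda>_. unif))
            (\<lambda>(u, l, r). graft u l r))"
      using prob_space.prob_space_distr[OF UTT.prob_space_axioms measurable_graft]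
      unfolding tree_space_def by (simp add: prob_space_def)
  qed
  then show ?thesis by simp
qed

interpretation TT: pair_prob_space tree_space tree_space by unfold_locales
interpretation UTT: pair_prob_space unif "tree_space \<Otimes>\<^sub>M tree_space" by unfold_locales

lemma nn_integral_tree:
  assumes [measurable]: "f \<in> borel_measurable tree_space"
  shows "(\<integral>\<^sup>+\<omega>. f \<omega> \<partial>tree_space) = (\<integral>\<^sup>+u. \<integral>\<^sup>+l. \<integral>\<^sup>+r. f (graft u l r) \<partial>tree_space \<partial>tree_space \<partial>unif)"
proof -
  have m: "(\<lambda>(u, l, r). f (graft u l r)) \<in> borel_measurable (unif \<Otimes>\<^sub>M (tree_space \<Otimes>\<^sub>M tree_space))"
    using measurable_compose[OF measurable_graft assms] by (simp add: split_beta')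
  have "(\<integral>\<^sup>+\<omega>. f \<omega> \<partial>tree_space) = (\<integral>\<^sup>+x. f (case x of (u, l, r) \<Rightarrow> graft u l r) \<partial>(unif \<Otimes>\<^sub>M (tree_space \<Otimes>\<^sub>M tree_space)))"
    by (subst distr_graft[symmetric], subst nn_integral_distr) auto
  also have "\<dots> = (\<integral>\<^sup>+x. (case x of (u, l, r) \<Rightarrow> f (graft u l r)) \<partial>(unif \<Otimes>\<^sub>M (tree_space \<Otimes>\<^sub>M tree_space)))"
    by (auto intro!: nn_integral_cong)
  also have "\<dots> = (\<integral>\<^sup>+u. \<integral>\<^sup>+p. (case p of (l, r) \<Rightarrow> f (graft u l r)) \<partial>(tree_space \<Otimes>\<^sub>M tree_space) \<partial>unif)"
    by (subst TT.P.nn_integral_fst[symmetric, OF m]) simp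
  also have "\<dots> = (\<integral>\<^sup>+u. \<integral>\<^sup>+l. \<integral>\<^sup>+r. f (graft u l r) \<partial>tree_space \<partial>tree_space \<partial>unif)"
  proof (rule nn_integral_cong)
    fix u
    have "(\<lambda>p. (u, p)) \<in> measurable (tree_space \<Otimes>\<^sub>M tree_space) (unif \<Otimes>\<^sub>M (tree_space \<Otimes>\<^sub>M tree_space))"
      by simp
    from measurable_compose[OF this m]
    have "(\<lambda>(l, r). f (graft u l r)) \<in> borel_measurable (tree_space \<Otimes>\<^sub>M tree_space)"
      by (simp add: split_beta')
    from tree_space.nn_integral_fst[OF this, symmetric]
    show "(\<integral>\<^sup>+p. (case p of (l, r) \<Rightarrow> f (graft u l r)) \<partial>(tree_space \<Otimes>\<^sub>M tree_space))
      = (\<integral>\<^sup>+l. \<integral>\<^sup>+r. f (graft u l r) \<partial>tree_space \<partial>tree_space)" by simp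
  qed
  finally show ?thesis .
qed

lemma distr_subtree: "distr tree_space tree_space (subtree b) = tree_space"
proof (rule measure_eqI)
  fix A assume A[simp]: "A \<in> sets (distr tree_space tree_space (subtree b))"
  then have [measurable]: "A \<in> sets tree_space" by simp
  have "emeasure (distr tree_space tree_space (subtree b)) A = (\<integral>\<^sup>+\<omega>. indicator A (subtree b \<omega>) \<partial>tree_space)"
    by (subst nn_integral_indicator[symmetric], simp, subst nn_integral_distr) auto
  also have "\<dots> = emeasure tree_space A"
    by (subst nn_integral_tree, measurable, cases b) (auto simp: tree_space.emeasure_space_1[simplified] unif.emeasure_space_1[simplified])
  finally show "emeasure (distr tree_space tree_space (subtree b)) A = emeasure tree_space A" .
qed simp

lemma AE_subtree:
  assumes "AE \<omega> in tree_space. P \<omega>" shows "AE \<omega> in tree_space. P (subtree b \<omega>)"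
proof -
  have "AE \<omega> in distr tree_space tree_space (subtree b). P \<omega>" using assms by (simp only: distr_subtree)
  then show ?thesis by (rule AE_distrD[rotated]) simp
qed

section \<open>Centred square-integrable functionals of the tree\<close>

definition centred :: "((bool list \<Rightarrow> real) \<Rightarrow> real) \<Rightarrow> bool" where
  "centred F \<longleftrightarrow> F \<in> borel_measurable tree_space \<and> integrable tree_space (\<lambda>\<omega>. (F \<omega>)^2)
     \<and> (\<integral>\<omega>. F \<omega> \<partial>tree_space) = 0"

definition tnorm2 :: "((bool list \<Rightarrow> real) \<Rightarrow> real) \<Rightarrow> real" where
  "tnorm2 F = (\<integral>\<omega>. (F \<omega>)^2 \<partial>tree_space)"

lemma tnorm2_nonneg [simp]: "0 \<le> tnorm2 F"
  by (simp add: tnorm2_def)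

lemma centred_integrable: "centred F \<Longrightarrow> integrable tree_space F"
  unfolding centred_def using tree_space.square_integrable_imp_integrable by blast

lemma centred_shift:
  assumes "centred F"
  shows "integrable tree_space (\<lambda>\<omega>. (F \<omega> + c)^2)" "(\<integral>\<omega>. (F \<omega> + c)^2 \<partial>tree_space) = tnorm2 F + c^2"
proof -
  have I: "integrable tree_space F" "integrable tree_space (\<lambda>\<omega>. (F \<omega>)^2)" "(\<integral>\<omega>. F \<omega> \<partial>tree_space) = 0"
    using centred_integrable[OF assms] assms by (auto simp: centred_def)
  have e: "(\<lambda>\<omega>. (F \<omega> + c)^2) = (\<lambda>\<omega>. (F \<omega>)^2 + 2 * c * F \<omega> + c^2)"
    by (auto simp: power2_eq_square algebra_simps)
  show "integrable tree_space (\<lambda>\<omega>. (F \<omega> + c)^2)" unfolding e using I by simp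
  show "(\<integral>\<omega>. (F \<omega> + c)^2 \<partial>tree_space) = tnorm2 F + c^2"
    unfolding e tnorm2_def using I tree_space.prob_space by simp
qed

lemma nn_centred_pair:
  assumes "centred F" "centred G"
  shows "(\<integral>\<^sup>+l. \<integral>\<^sup>+r. ennreal ((F l + G r + c)^2) \<partial>tree_space \<partial>tree_space) = ennreal (tnorm2 F + tnorm2 G + c^2)"
proof -
  have "(\<integral>\<^sup>+r. ennreal ((F l + G r + c)^2) \<partial>tree_space) = ennreal ((F l + c)^2 + tnorm2 G)" for l
  proof -
    have "(\<integral>\<^sup>+r. ennreal ((F l + G r + c)^2) \<partial>tree_space) = (\<integral>\<^sup>+r. ennreal ((G r + (F l + c))^2) \<partial>tree_space)"
      by (simp add: add_ac)
    also have "\<dots> = ennreal (\<integral>r. (G r + (F l + c))^2 \<partial>tree_space)"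
      by (rule nn_integral_eq_integral[OF centred_shift(1)[OF assms(2)]]) simp
    finally show ?thesis by (simp only: centred_shift(2)[OF assms(2)] add.commute)
  qed
  then have "(\<integral>\<^sup>+l. \<integral>\<^sup>+r. ennreal ((F l + G r + c)^2) \<partial>tree_space \<partial>tree_space) = (\<integral>\<^sup>+l. ennreal ((F l + c)^2 + tnorm2 G) \<partial>tree_space)"
    by simp
  also have "\<dots> = ennreal (\<integral>l. ((F l + c)^2 + tnorm2 G) \<partial>tree_space)"
    by (rule nn_integral_eq_integral) (use centred_shift(1)[OF assms(1), of c] in auto)
  also have "(\<integral>l. ((F l + c)^2 + tnorm2 G) \<partial>tree_space) = tnorm2 F + tnorm2 G + c^2"
    using centred_shift[OF assms(1), of c] tree_space.prob_space by simp
  finally show ?thesis .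
qed

text \<open>Orthogonality of the two subtrees: the cross terms vanish because both are centred.\<close>

lemma tree_square:
  assumes H[measurable]: "H \<in> borel_measurable tree_space"
    and dec: "\<And>u l r. u \<in> {0..1} \<Longrightarrow> H (graft u l r) = F u l + G u r + g u"
    and F: "\<And>u. u \<in> {0..1} \<Longrightarrow> centred (F u)" and G: "\<And>u. u \<in> {0..1} \<Longrightarrow> centred (G u)"
  shows "(\<integral>\<^sup>+\<omega>. ennreal ((H \<omega>)^2) \<partial>tree_space) = (\<integral>\<^sup>+u. ennreal (tnorm2 (F u) + tnorm2 (G u) + (g u)^2) \<partial>unif)"
proof -
  have "(\<integral>\<^sup>+\<omega>. ennreal ((H \<omega>)^2) \<partial>tree_space)
      = (\<integral>\<^sup>+u. \<integral>\<^sup>+l. \<integral>\<^sup>+r. ennreal ((H (graft u l r))^2) \<partial>tree_space \<partial>tree_space \<partial>unif)"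
    by (rule nn_integral_tree) measurable
  also have "\<dots> = (\<integral>\<^sup>+u. ennreal (tnorm2 (F u) + tnorm2 (G u) + (g u)^2) \<partial>unif)"
  proof (rule nn_integral_cong_AE)
    show "AE u in unif. (\<integral>\<^sup>+l. \<integral>\<^sup>+r. ennreal ((H (graft u l r))^2) \<partial>tree_space \<partial>tree_space) =
             ennreal (tnorm2 (F u) + tnorm2 (G u) + (g u)^2)"
      using AE_unif_Icc by eventually_elim (use nn_centred_pair F G dec in auto)
  qed
  finally show ?thesis .
qed

text \<open>Second moments go through nonnegative integrals, but the mean is signed: integrability
  of \<open>H\<close> has to be known beforehand, and its sections in u are integrable only for
  almost every u.\<close>

lemma tree_mean:
  assumes H: "integrable tree_space H"
    and dec: "\<And>u l r. u \<in> {0..1} \<Longrightarrow> H (graft u l r) = F u l + G u r + g u"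
    and F: "\<And>u. u \<in> {0..1} \<Longrightarrow> centred (F u)" and G: "\<And>u. u \<in> {0..1} \<Longrightarrow> centred (G u)"
    and g[measurable]: "g \<in> borel_measurable borel"
  shows "(\<integral>\<omega>. H \<omega> \<partial>tree_space) = (\<integral>u. g u \<partial>unif)"
proof -
  have [measurable]: "H \<in> borel_measurable tree_space" using H by auto
  have I: "integrable (distr (unif \<Otimes>\<^sub>M (tree_space \<Otimes>\<^sub>M tree_space)) tree_space (\<lambda>(u, l, r). graft u l r)) H"
    using H by (simp only: distr_graft)
  have "integrable (unif \<Otimes>\<^sub>M (tree_space \<Otimes>\<^sub>M tree_space)) (\<lambda>x. H (case x of (u, l, r) \<Rightarrow> graft u l r))"
    by (rule integrable_distr[OF measurable_graft I])
  then have I2: "integrable (unif \<Otimes>\<^sub>M (tree_space \<Otimes>\<^sub>M tree_space)) (\<lambda>(u, p). H (graft u (fst p) (snd p)))"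
    by (simp add: split_beta')
  have "(\<integral>\<omega>. H \<omega> \<partial>tree_space) = (\<integral>x. H (case x of (u, l, r) \<Rightarrow> graft u l r) \<partial>(unif \<Otimes>\<^sub>M (tree_space \<Otimes>\<^sub>M tree_space)))"
    by (subst distr_graft[symmetric], subst integral_distr) auto
  also have "\<dots> = (\<integral>x. (case x of (u, p) \<Rightarrow> H (graft u (fst p) (snd p))) \<partial>(unif \<Otimes>\<^sub>M (tree_space \<Otimes>\<^sub>M tree_space)))"
    by (simp add: split_beta')
  also have "\<dots> = (\<integral>u. (\<integral>p. H (graft u (fst p) (snd p)) \<partial>(tree_space \<Otimes>\<^sub>M tree_space)) \<partial>unif)"
    using UTT.integral_fst'[OF I2] by simp
  also have "\<dots> = (\<integral>u. g u \<partial>unif)"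
  proof (rule integral_cong_AE)
    have "(\<lambda>u. \<integral>p. (case (u, p) of (u, p) \<Rightarrow> H (graft u (fst p) (snd p))) \<partial>(tree_space \<Otimes>\<^sub>M tree_space)) \<in> borel_measurable unif"
      using borel_measurable_integrable[OF UTT.integrable_fst'[OF I2]] by simp
    then show "(\<lambda>u. \<integral>p. H (graft u (fst p) (snd p)) \<partial>(tree_space \<Otimes>\<^sub>M tree_space)) \<in> borel_measurable unif" by simp
    show "g \<in> borel_measurable unif" by (subst measurable_cong_sets[OF sets_unif refl]) (rule g)
    show "AE u in unif. (\<integral>p. H (graft u (fst p) (snd p)) \<partial>(tree_space \<Otimes>\<^sub>M tree_space)) = g u"
      using AE_unif_Icc UTT.AE_integrable_fst'[OF I2]
    proof eventually_elim
      case (elim u)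
      have e: "(\<lambda>p. H (graft u (fst p) (snd p))) = (\<lambda>p. F u (fst p) + G u (snd p) + g u)"
        by (intro ext dec elim(1))
      have i: "integrable (tree_space \<Otimes>\<^sub>M tree_space) (\<lambda>p. F u (fst p) + G u (snd p) + g u)"
        using elim(2) unfolding prod.case e .
      have iF: "integrable tree_space (F u)" "integrable tree_space (G u)" "(\<integral>\<omega>. F u \<omega> \<partial>tree_space) = 0" "(\<integral>\<omega>. G u \<omega> \<partial>tree_space) = 0"
        using centred_integrable[OF F[OF elim(1)]] centred_integrable[OF G[OF elim(1)]] F[OF elim(1)] G[OF elim(1)]
        unfolding centred_def by blast+
      have "(\<integral>p. H (graft u (fst p) (snd p)) \<partial>(tree_space \<Otimes>\<^sub>M tree_space))
        = (\<integral>p. (F u (fst p) + G u (snd p) + g u) \<partial>(tree_space \<Otimes>\<^sub>M tree_space))"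
        unfolding e ..
      also have "\<dots> = (\<integral>l. \<integral>r. (F u l + G u r + g u) \<partial>tree_space \<partial>tree_space)"
        using TT.integral_fst'[OF i] by simp
      also have "\<dots> = g u" using iF tree_space.prob_space by simp
      finally show ?case .
    qed
  qed
  finally show ?thesis .
qed

lemma centred_scale:
  assumes "centred F"
  shows "centred (\<lambda>\<omega>. c * F \<omega>)" "tnorm2 (\<lambda>\<omega>. c * F \<omega>) = c^2 * tnorm2 F"
proof -
  show "centred (\<lambda>\<omega>. c * F \<omega>)"
    using assms unfolding centred_def by (auto simp: power_mult_distrib)
  show "tnorm2 (\<lambda>\<omega>. c * F \<omega>) = c^2 * tnorm2 F"
    unfolding tnorm2_def by (simp add: power_mult_distrib)
qed

definition toll2 :: real where "toll2 = (\<integral>u. (toll u)^2 \<partial>unif)"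

lemma continuous_on_toll_sq: "continuous_on {0..1} (\<lambda>u. (toll u)^2)"
  by (intro continuous_on_power continuous_on_toll)

lemma toll2_has_integral: "((\<lambda>u. (toll u)^2) has_integral toll2) {0..1}"
  using integral_unif_has_integral(2)[OF continuous_on_toll_sq _ integrable_integral[OF integrable_continuous_real[OF continuous_on_toll_sq]]]
    integrable_integral[OF integrable_continuous_real[OF continuous_on_toll_sq]]
  by (simp add: toll2_def)

lemma toll2_nonneg: "0 \<le> toll2" by (simp add: toll2_def)

text \<open>One application of the limiting recursion; 1/3 is the second moment of U and of 1 - U.
  The factor \<open>c\<close> serves two uses: 1 for the iterates themselves, 0 for differences,
  where the toll cancels.\<close>

lemma qs_step:
  assumes H[measurable]: "H \<in> borel_measurable tree_space"
    and dec: "\<And>u l r. H (graft u l r) = u * A l + (1 - u) * B r + c * toll u"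
    and A: "centred A" and B: "centred B"
  shows "centred H" "tnorm2 H = (tnorm2 A + tnorm2 B) / 3 + c^2 * toll2"
proof -
  let ?v = "(tnorm2 A + tnorm2 B) / 3 + c^2 * toll2"
  have i: "((\<lambda>u::real. u^2) has_integral 1/3) {0..1}" "((\<lambda>u::real. (1-u)^2) has_integral 1/3) {0..1}"
  proof -
    have "((\<lambda>u::real. u^2) has_integral (1^3/3 - 0^3/3)) {0..1}"
      by (rule fundamental_theorem_of_calculus)
        (auto intro!: derivative_eq_intros simp flip: has_real_derivative_iff_has_vector_derivative)
    then show "((\<lambda>u::real. u^2) has_integral 1/3) {0..1}" by simp
    have "((\<lambda>u::real. (1-u)^2) has_integral (- ((1 - 1)^3/3) - (- ((1 - 0)^3/3)))) {0..1}"
      by (rule fundamental_theorem_of_calculus)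
        (auto intro!: derivative_eq_intros simp flip: has_real_derivative_iff_has_vector_derivative)
    then show "((\<lambda>u::real. (1-u)^2) has_integral 1/3) {0..1}" by simp
  qed
  have "(\<integral>\<^sup>+\<omega>. ennreal ((H \<omega>)^2) \<partial>tree_space) =
     (\<integral>\<^sup>+u. ennreal (tnorm2 (\<lambda>\<omega>. u * A \<omega>) + tnorm2 (\<lambda>\<omega>. (1-u) * B \<omega>) + (c * toll u)^2) \<partial>unif)"
    by (rule tree_square) (use centred_scale(1) A B dec in auto)
  also have "\<dots> = (\<integral>\<^sup>+u. ennreal (tnorm2 A * u^2 + tnorm2 B * (1-u)^2 + c^2 * (toll u)^2) \<partial>unif)"
    unfolding centred_scale(2)[OF A] centred_scale(2)[OF B] power_mult_distrib by (simp only: mult.commute)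
  also have "\<dots> = ennreal (tnorm2 A * (1/3) + tnorm2 B * (1/3) + c^2 * toll2)"
  proof (rule nn_integral_unif_has_integral)
    show "((\<lambda>u. tnorm2 A * u^2 + tnorm2 B * (1-u)^2 + c^2 * (toll u)^2) has_integral
       (tnorm2 A * (1/3) + tnorm2 B * (1/3) + c^2 * toll2)) {0..1}"
      by (intro has_integral_add has_integral_mult_right i toll2_has_integral)
  qed auto
  finally have nn: "(\<integral>\<^sup>+\<omega>. ennreal ((H \<omega>)^2) \<partial>tree_space) = ennreal ?v" by (simp add: field_simps)
  then have int: "integrable tree_space (\<lambda>\<omega>. (H \<omega>)^2)"
    by (intro integrableI_nonneg) auto
  have "0 \<le> ?v" using toll2_nonneg by simp
  with nn show "tnorm2 H = ?v"
    unfolding tnorm2_def by (subst integral_eq_nn_integral) auto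
  have "integrable tree_space H" by (rule tree_space.square_integrable_imp_integrable[OF H int])
  then have "(\<integral>\<omega>. H \<omega> \<partial>tree_space) = (\<integral>u. c * toll u \<partial>unif)"
    by (rule tree_mean[of H "\<lambda>u \<omega>. u * A \<omega>" "\<lambda>u \<omega>. (1-u) * B \<omega>"])
       (use centred_scale(1) A B dec in auto)
  then show "centred H" using int integral_toll_unif by (simp add: centred_def)
qed

section \<open>The limit as a functional of the tree\<close>

text \<open>The k-th iterate of the fixed-point equation started from 0; it reads only the labels on
  the first k levels.\<close>

fun Yk :: "nat \<Rightarrow> (bool list \<Rightarrow> real) \<Rightarrow> real" where
  "Yk 0 \<omega> = 0"
| "Yk (Suc k) \<omega> = \<omega> [] * Yk k (subtree True \<omega>) + (1 - \<omega> []) * Yk k (subtree False \<omega>) + toll (\<omega> [])"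

declare Yk.simps(2) [simp del]

lemma Yk_graft: "Yk (Suc k) (graft u l r) = u * Yk k l + (1 - u) * Yk k r + toll u"
  by (simp add: Yk.simps)

lemma measurable_Yk [measurable]: "Yk k \<in> borel_measurable tree_space"
proof (induction k)
  case 0 have "Yk 0 = (\<lambda>_. 0)" by auto then show ?case by simp
next
  case (Suc k)
  note [measurable] = Suc
  have "Yk (Suc k) = (\<lambda>\<omega>. \<omega> [] * Yk k (subtree True \<omega>) + (1 - \<omega> []) * Yk k (subtree False \<omega>) + toll (\<omega> []))" by (auto simp: Yk.simps)
  then show ?case by simp
qed

lemma centred_Yk: "centred (Yk k)"
proof (induction k)
  case 0 have "Yk 0 = (\<lambda>_. 0)" by auto then show ?case by (simp add: centred_def)
next
  case (Suc k) show ?case by (rule qs_step(1)[OF measurable_Yk _ Suc Suc, where c=1]) (simp add: Yk_graft)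
qed

lemma tnorm2_Yk_le: "tnorm2 (Yk k) \<le> 3 * toll2"
proof (induction k)
  case 0 have "Yk 0 = (\<lambda>_. 0)" by auto then show ?case by (simp add: tnorm2_def toll2_nonneg)
next
  case (Suc k) 
  have "tnorm2 (Yk (Suc k)) = (tnorm2 (Yk k) + tnorm2 (Yk k)) / 3 + 1^2 * toll2"
    by (rule qs_step(2)[OF measurable_Yk _ centred_Yk centred_Yk]) (simp add: Yk_graft)
  with Suc show ?case by simp
qed

text \<open>Consecutive iterates use the same toll at the root, so their difference obeys the
  recursion without toll and its second moment shrinks by 2/3.\<close>

lemma Yk_diff:
  "centred (\<lambda>\<omega>. Yk (Suc k) \<omega> - Yk k \<omega>)" "tnorm2 (\<lambda>\<omega>. Yk (Suc k) \<omega> - Yk k \<omega>) = (2/3)^k * toll2"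
proof (induction k)
  case 0
  have e: "(\<lambda>\<omega>. Yk (Suc 0) \<omega> - Yk 0 \<omega>) = Yk (Suc 0)" by auto
  have z: "tnorm2 (Yk 0) = 0" by (simp add: tnorm2_def)
  { case 1 show ?case unfolding e by (rule centred_Yk)
  next case 2 
    have "tnorm2 (Yk (Suc 0)) = (tnorm2 (Yk 0) + tnorm2 (Yk 0)) / 3 + 1^2 * toll2"
      by (rule qs_step(2)[OF measurable_Yk _ centred_Yk centred_Yk]) (simp add: Yk_graft)
    then show ?case unfolding e z by simp }
next
  case (Suc k)
  let ?D = "\<lambda>\<omega>. Yk (Suc k) \<omega> - Yk k \<omega>"
  note s = qs_step[of "\<lambda>\<omega>. Yk (Suc (Suc k)) \<omega> - Yk (Suc k) \<omega>" ?D ?D 0, OF _ _ Suc(1) Suc(1)]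
  have d: "(\<lambda>\<omega>. Yk (Suc (Suc k)) \<omega> - Yk (Suc k) \<omega>) (graft u l r) = u * ?D l + (1 - u) * ?D r + 0 * toll u" for u l r
    by (cases k) (simp_all add: Yk_graft algebra_simps)
  { case 1 show ?case by (rule s(1)) (measurable, rule d)
  next case 2 
    have "tnorm2 (\<lambda>\<omega>. Yk (Suc (Suc k)) \<omega> - Yk (Suc k) \<omega>) = (tnorm2 ?D + tnorm2 ?D) / 3 + 0^2 * toll2"
      by (rule s(2)) (measurable, rule d)
    then show ?case using Suc(2) by simp }
qed

text \<open>Nonnegativity of the variance of |F|.\<close>

lemma integral_abs_le_tnorm2:
  assumes "centred F" shows "(\<integral>\<omega>. \<bar>F \<omega>\<bar> \<partial>tree_space) \<le> sqrt (tnorm2 F)"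
proof -
  have i: "integrable tree_space F" "integrable tree_space (\<lambda>\<omega>. (F \<omega>)^2)" using centred_integrable[OF assms] assms by (auto simp: centred_def)
  have "(\<integral>\<omega>. \<bar>F \<omega>\<bar> \<partial>tree_space)^2 \<le> (\<integral>\<omega>. \<bar>F \<omega>\<bar>^2 \<partial>tree_space)"
  proof -
    have "0 \<le> tree_space.variance (\<lambda>\<omega>. \<bar>F \<omega>\<bar>)" by simp
    also have "\<dots> = (\<integral>\<omega>. \<bar>F \<omega>\<bar>^2 \<partial>tree_space) - (\<integral>\<omega>. \<bar>F \<omega>\<bar> \<partial>tree_space)^2"
      by (rule tree_space.variance_eq) (use i in auto)
    finally show ?thesis by simp
  qed
  then show ?thesis unfolding tnorm2_def by (simp add: real_le_rsqrt)
qed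

text \<open>Written as a series so that summability of the L1 norms gives both convergence almost
  everywhere and termwise integration.\<close>

definition Ylim :: "(bool list \<Rightarrow> real) \<Rightarrow> real" where
  "Ylim \<omega> = (\<Sum>k. Yk (Suc k) \<omega> - Yk k \<omega>)"

lemma measurable_Ylim [measurable]: "Ylim \<in> borel_measurable tree_space"
  unfolding Ylim_def[abs_def] by measurable

lemma Yk_diff_L1:
  "summable (\<lambda>k. \<integral>\<omega>. norm (Yk (Suc k) \<omega> - Yk k \<omega>) \<partial>tree_space)"
proof (rule summable_comparison_test')
  show "summable (\<lambda>k. sqrt (2/3)^k * sqrt toll2)"
    by (intro summable_mult2 summable_geometric) (simp add: real_sqrt_lt_1_iff)
  fix k :: nat
  have "(\<integral>\<omega>. \<bar>Yk (Suc k) \<omega> - Yk k \<omega>\<bar> \<partial>tree_space) \<le> sqrt ((2/3)^k * toll2)"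
    using integral_abs_le_tnorm2[OF Yk_diff(1)[of k]] by (simp only: Yk_diff(2))
  then show "norm (\<integral>\<omega>. norm (Yk (Suc k) \<omega> - Yk k \<omega>) \<partial>tree_space) \<le> sqrt (2/3)^k * sqrt toll2"
    by (simp add: real_sqrt_mult real_sqrt_power)
qed

lemma Yk_diff_AE: "AE \<omega> in tree_space. summable (\<lambda>k. norm (Yk (Suc k) \<omega> - Yk k \<omega>))"
proof -
  have i: "integrable tree_space (\<lambda>\<omega>. Yk (Suc k) \<omega> - Yk k \<omega>)" for k
    using centred_integrable[OF Yk_diff(1)] .
  have "(\<integral>\<^sup>+\<omega>. (\<Sum>k. ennreal (norm (Yk (Suc k) \<omega> - Yk k \<omega>))) \<partial>tree_space)
      = (\<Sum>k. \<integral>\<^sup>+\<omega>. ennreal (norm (Yk (Suc k) \<omega> - Yk k \<omega>)) \<partial>tree_space)"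
    by (rule nn_integral_suminf) auto
  also have "\<dots> = (\<Sum>k. ennreal (\<integral>\<omega>. norm (Yk (Suc k) \<omega> - Yk k \<omega>) \<partial>tree_space))"
    by (intro arg_cong[where f=suminf] ext nn_integral_eq_integral integrable_norm i) auto
  also have "\<dots> \<noteq> \<infinity>"
    unfolding infinity_ennreal_def by (rule ennreal_suminf_neq_top[OF Yk_diff_L1]) (rule integral_nonneg_AE, simp)
  finally have "(\<integral>\<^sup>+\<omega>. (\<Sum>k. ennreal (norm (Yk (Suc k) \<omega> - Yk k \<omega>))) \<partial>tree_space) \<noteq> \<infinity>" .
  then have "AE \<omega> in tree_space. (\<Sum>k. ennreal (norm (Yk (Suc k) \<omega> - Yk k \<omega>))) \<noteq> \<infinity>"
    by (rule nn_integral_PInf_AE[rotated]) measurable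
  then show ?thesis
    by eventually_elim (rule summable_suminf_not_top, simp_all)
qed

lemma Yk_tendsto_AE: "AE \<omega> in tree_space. (\<lambda>k. Yk k \<omega>) \<longlonglongrightarrow> Ylim \<omega>"
  using Yk_diff_AE
proof eventually_elim
  case (elim \<omega>)
  then have "(\<lambda>n. \<Sum>k<n. Yk (Suc k) \<omega> - Yk k \<omega>) \<longlonglongrightarrow> Ylim \<omega>"
    unfolding Ylim_def by (intro summable_LIMSEQ summable_norm_cancel[OF elim])
  moreover have "(\<Sum>k<n. Yk (Suc k) \<omega> - Yk k \<omega>) = Yk n \<omega>" for n
    by (subst sum_lessThan_telescope) simp
  ultimately show ?case by simp
qed

lemma Ylim_fixpoint:
  "AE \<omega> in tree_space. Ylim \<omega> = \<omega> [] * Ylim (subtree True \<omega>) + (1 - \<omega> []) * Ylim (subtree False \<omega>) + toll (\<omega> [])"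
  using Yk_tendsto_AE AE_subtree[OF Yk_tendsto_AE, of True] AE_subtree[OF Yk_tendsto_AE, of False]
proof eventually_elim
  case (elim \<omega>)
  have "(\<lambda>k. Yk (Suc k) \<omega>) \<longlonglongrightarrow> \<omega> [] * Ylim (subtree True \<omega>) + (1 - \<omega> []) * Ylim (subtree False \<omega>) + toll (\<omega> [])"
    unfolding Yk.simps by (intro tendsto_intros elim)
  moreover have "(\<lambda>k. Yk (Suc k) \<omega>) \<longlonglongrightarrow> Ylim \<omega>" using elim(1) by (rule LIMSEQ_Suc)
  ultimately show ?case using LIMSEQ_unique by blast
qed

text \<open>The mean comes from termwise integration, the finite second moment from Fatou's lemma
  and the uniform bound \<open>tnorm2_Yk_le\<close>.\<close>

lemma centred_Ylim: "centred Ylim"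
proof -
  have i: "integrable tree_space (\<lambda>\<omega>. Yk (Suc k) \<omega> - Yk k \<omega>)" for k
    using centred_integrable[OF Yk_diff(1)] .
  have "(\<integral>\<omega>. Ylim \<omega> \<partial>tree_space) = (\<Sum>k. \<integral>\<omega>. Yk (Suc k) \<omega> - Yk k \<omega> \<partial>tree_space)"
    unfolding Ylim_def by (rule integral_suminf[OF i Yk_diff_AE Yk_diff_L1])
  also have "\<dots> = 0" using Yk_diff(1) by (simp add: centred_def)
  finally have mean: "(\<integral>\<omega>. Ylim \<omega> \<partial>tree_space) = 0" .
  have "(\<integral>\<^sup>+\<omega>. ennreal ((Ylim \<omega>)^2) \<partial>tree_space) = (\<integral>\<^sup>+\<omega>. liminf (\<lambda>k. ennreal ((Yk k \<omega>)^2)) \<partial>tree_space)"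
  proof (rule nn_integral_cong_AE, use Yk_tendsto_AE in eventually_elim)
    case (elim \<omega>)
    have "(\<lambda>k. ennreal ((Yk k \<omega>)^2)) \<longlonglongrightarrow> ennreal ((Ylim \<omega>)^2)"
      by (intro tendsto_intros elim)
    then show ?case by (intro lim_imp_Liminf[symmetric]) auto
  qed
  also have "\<dots> \<le> liminf (\<lambda>k. \<integral>\<^sup>+\<omega>. ennreal ((Yk k \<omega>)^2) \<partial>tree_space)"
    by (rule nn_integral_liminf) measurable
  also have "\<dots> \<le> liminf (\<lambda>k::nat. ennreal (3 * toll2))"
  proof (rule Liminf_mono, rule always_eventually, rule allI)
    fix k
    have "(\<integral>\<^sup>+\<omega>. ennreal ((Yk k \<omega>)^2) \<partial>tree_space) = ennreal (tnorm2 (Yk k))"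
      unfolding tnorm2_def by (rule nn_integral_eq_integral) (use centred_Yk[of k] in \<open>auto simp: centred_def\<close>)
    then show "(\<integral>\<^sup>+\<omega>. ennreal ((Yk k \<omega>)^2) \<partial>tree_space) \<le> ennreal (3 * toll2)"
      using tnorm2_Yk_le[of k] by (simp add: ennreal_leI)
  qed
  also have "\<dots> = ennreal (3 * toll2)" by (simp add: Liminf_const)
  finally have "(\<integral>\<^sup>+\<omega>. ennreal ((Ylim \<omega>)^2) \<partial>tree_space) \<le> ennreal (3 * toll2)" .
  then have "integrable tree_space (\<lambda>\<omega>. (Ylim \<omega>)^2)"
    by (intro integrableI_nonneg) (auto simp: order_le_less_trans)
  then show ?thesis using mean by (simp add: centred_def)
qed

text \<open>The recursion for \<^term>\<open>Ylim\<close> holds only almost everywhere; this version of it is exact.\<close>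

definition Yrec :: "(bool list \<Rightarrow> real) \<Rightarrow> real" where
  "Yrec \<omega> = \<omega> [] * Ylim (subtree True \<omega>) + (1 - \<omega> []) * Ylim (subtree False \<omega>) + toll (\<omega> [])"

lemma measurable_Yrec [measurable]: "Yrec \<in> borel_measurable tree_space"
  unfolding Yrec_def[abs_def] by measurable

lemma Ylim_eq_Yrec: "AE \<omega> in tree_space. Ylim \<omega> = Yrec \<omega>"
  using Ylim_fixpoint by (simp add: Yrec_def)

lemma Yrec_graft: "Yrec (graft u l r) = u * Ylim l + (1 - u) * Ylim r + toll u"
  by (simp add: Yrec_def)

text \<open>The variance v of the limit solves v = 2/3 v + \<open>toll2\<close>.\<close>

lemma tnorm2_Ylim: "tnorm2 Ylim = 3 * toll2"
proof -
  have "tnorm2 Yrec = (tnorm2 Ylim + tnorm2 Ylim) / 3 + 1^2 * toll2"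
    by (rule qs_step(2)[OF measurable_Yrec _ centred_Ylim centred_Ylim]) (simp add: Yrec_graft)
  moreover have "tnorm2 Ylim = tnorm2 Yrec"
    unfolding tnorm2_def by (rule integral_cong_AE) (use Ylim_eq_Yrec in auto)
  ultimately show ?thesis by simp
qed

text \<open>Existence of the fixed point: by independence, (u, Ylim l, Ylim r) has the product law
  of the fixed-point equation, and grafting turns the combination of the three into
  \<open>Yrec\<close>, which has the law of \<open>Ylim\<close>.\<close>

lemma fixpoint_law_Ylim: "qs_fixpoint_law (distr tree_space borel Ylim)"
proof -
  let ?\<mu> = "distr tree_space borel Ylim"
  have ps: "prob_space ?\<mu>" by (rule tree_space.prob_space_distr) simp
  interpret mu: prob_space ?\<mu> by fact
  interpret mumu: pair_prob_space ?\<mu> ?\<mu> by unfold_locales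
  have p: "?\<mu> \<Otimes>\<^sub>M ?\<mu> = distr (tree_space \<Otimes>\<^sub>M tree_space) (borel \<Otimes>\<^sub>M borel) (\<lambda>(l, r). (Ylim l, Ylim r))"
    by (rule pair_measure_distr) (use mu.sigma_finite_measure_axioms in auto)
  have du: "distr unif borel (\<lambda>x. x) = unif" by (rule distr_id2) simp
  have "unif \<Otimes>\<^sub>M (?\<mu> \<Otimes>\<^sub>M ?\<mu>) = distr unif borel (\<lambda>x. x) \<Otimes>\<^sub>M distr (tree_space \<Otimes>\<^sub>M tree_space) (borel \<Otimes>\<^sub>M borel) (\<lambda>(l, r). (Ylim l, Ylim r))"
    by (simp only: p du)
  also have "\<dots> = distr (unif \<Otimes>\<^sub>M (tree_space \<Otimes>\<^sub>M tree_space)) (borel \<Otimes>\<^sub>M (borel \<Otimes>\<^sub>M borel)) (\<lambda>(u, q). (u, (case q of (l, r) \<Rightarrow> (Ylim l, Ylim r))))"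
  proof (rule pair_measure_distr)
    show "(\<lambda>x. x) \<in> measurable unif borel" by (subst measurable_cong_sets[OF sets_unif refl]) simp
    show "sigma_finite_measure (distr (tree_space \<Otimes>\<^sub>M tree_space) (borel \<Otimes>\<^sub>M borel) (\<lambda>(l, r). (Ylim l, Ylim r)))"
      using mumu.P.sigma_finite_measure_axioms by (simp only: p)
  qed measurable
  finally have u: "unif \<Otimes>\<^sub>M (?\<mu> \<Otimes>\<^sub>M ?\<mu>) = distr (unif \<Otimes>\<^sub>M (tree_space \<Otimes>\<^sub>M tree_space)) (borel \<Otimes>\<^sub>M (borel \<Otimes>\<^sub>M borel)) (\<lambda>(u, q). (u, (case q of (l, r) \<Rightarrow> (Ylim l, Ylim r))))" .
  have "distr (unif \<Otimes>\<^sub>M (?\<mu> \<Otimes>\<^sub>M ?\<mu>)) borel (\<lambda>(u, y, z). u * y + (1 - u) * z + toll u)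
      = distr (unif \<Otimes>\<^sub>M (tree_space \<Otimes>\<^sub>M tree_space)) borel (\<lambda>x. Yrec (case x of (u, l, r) \<Rightarrow> graft u l r))"
    unfolding u by (subst distr_distr) (auto intro!: distr_cong simp: Yrec_graft)
  also have "\<dots> = distr (distr (unif \<Otimes>\<^sub>M (tree_space \<Otimes>\<^sub>M tree_space)) tree_space (\<lambda>(u, l, r). graft u l r)) borel Yrec"
    by (subst distr_distr) (auto simp: comp_def)
  also have "\<dots> = distr tree_space borel Yrec" by (simp only: distr_graft)
  also have "\<dots> = ?\<mu>"
    by (rule distr_cong_AE) (use Ylim_eq_Yrec in auto)
  finally have fp: "distr (unif \<Otimes>\<^sub>M (?\<mu> \<Otimes>\<^sub>M ?\<mu>)) borel (\<lambda>(u, y, z). u * y + (1 - u) * z + toll u) = ?\<mu>" .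
  show ?thesis
    unfolding qs_fixpoint_law_def
    using ps fp centred_Ylim centred_integrable[OF centred_Ylim]
    by (auto simp: integrable_distr_eq integral_distr centred_def)
qed

section \<open>Quicksort as a functional of the tree\<close>

text \<open>The rank of the pivot counted from 0, hence the size of the left part. The cap matters
  at u = 1, and with the truncation by \<open>nat\<close> it keeps the value in range for every real
  label.\<close>

definition pick :: "nat \<Rightarrow> real \<Rightarrow> nat" where
  "pick n u = min (n - 1) (nat \<lfloor>real n * u\<rfloor>)"

lemma pick_less: "0 < n \<Longrightarrow> pick n u < n"
  unfolding pick_def by (auto simp: min_def)

lemma pick_eq:
  assumes "j < n" "real j / real n \<le> u" "u < real (Suc j) / real n" shows "pick n u = j"
proof -
  have "real j \<le> real n * u" "real n * u < real j + 1" using assms by (auto simp: field_simps)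
  then have "\<lfloor>real n * u\<rfloor> = int j" by linarith
  then show ?thesis using assms by (simp add: pick_def)
qed

lemma measurable_pick [measurable]: "pick n \<in> measurable borel (count_space UNIV)"
  unfolding pick_def[abs_def] by measurable

text \<open>On the cell [j/n, (j+1)/n) the function \<open>pick n\<close> is the constant j; the
  right endpoint is a negligible exception.\<close>

lemma cells_has_integral:
  fixes F :: "nat \<Rightarrow> real \<Rightarrow> real"
  assumes n: "0 < n"
    and I: "\<And>j. j < n \<Longrightarrow> (F j has_integral I j) {real j / real n .. real (Suc j) / real n}"
  shows "((\<lambda>u. F (pick n u) u) has_integral (\<Sum>j<n. I j)) {0..1}"
proof -
  have "((\<lambda>u. F (pick n u) u) has_integral (\<Sum>j<k. I j)) {0..real k / real n}" if "k \<le> n" for k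
    using that
  proof (induction k)
    case 0
    have "((\<lambda>u. F (pick n u) u) has_integral 0) (cbox 0 0)" by (rule has_integral_null) simp
    then show ?case by simp
  next
    case (Suc k)
    have "((\<lambda>u. F (pick n u) u) has_integral I k) {real k / real n .. real (Suc k) / real n}"
    proof (rule has_integral_spike_finite[where S="{real (Suc k) / real n}" and f="F k"])
      show "(F k has_integral I k) {real k / real n .. real (Suc k) / real n}" using Suc.prems by (intro I) simp
      fix x assume "x \<in> {real k / real n .. real (Suc k) / real n} - {real (Suc k) / real n}"
      then have "pick n x = k" using Suc.prems by (intro pick_eq) auto
      then show "F (pick n x) x = F k x" by simp
    qed simp
    then have "((\<lambda>u. F (pick n u) u) has_integral ((\<Sum>j<k. I j) + I k)) {0..real (Suc k) / real n}"
      using Suc by (intro has_integral_combine[of 0 "real k / real n"]) (auto simp: divide_right_mono)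
    then show ?case by simp
  qed
  from this[of n] n show ?thesis by simp
qed

lemma nn_integral_pick:
  assumes n: "0 < n" and h: "\<And>j. j < n \<Longrightarrow> 0 \<le> h j"
  shows "(\<integral>\<^sup>+u. ennreal (h (pick n u)) \<partial>unif) = ennreal ((\<Sum>j<n. h j) / real n)"
proof (rule nn_integral_unif_has_integral)
  have "((\<lambda>u. h (pick n u)) has_integral (\<Sum>j<n. h j / real n)) {0..1}"
  proof (rule cells_has_integral[OF n, where F="\<lambda>j u. h j"])
    fix j
    show "((\<lambda>u. h j) has_integral h j / real n) {real j / real n..real (Suc j) / real n}"
      using has_integral_const_real[of "h j" "real j / real n" "real (Suc j) / real n"] n
      by (simp add: divide_right_mono diff_divide_distrib[symmetric])
  qed
  then show "((\<lambda>u. h (pick n u)) has_integral (\<Sum>j<n. h j) / real n) {0..1}" by (simp add: sum_divide_distrib)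
qed (use h pick_less[OF n] in auto)

lemma nn_integral_pick_ennreal:
  assumes n: "0 < n"
  shows "(\<integral>\<^sup>+u. h (pick n u) \<partial>unif) = (\<Sum>j<n. h j) / ennreal (real n)"
proof -
  have "h (pick n u) = (\<Sum>j<n. h j * ennreal (if pick n u = j then 1 else 0))" for u
    using pick_less[OF n, of u] by (subst sum.remove[of _ "pick n u"]) (auto intro!: sum.neutral)
  then have "(\<integral>\<^sup>+u. h (pick n u) \<partial>unif) = (\<Sum>j<n. \<integral>\<^sup>+u. h j * ennreal (if pick n u = j then 1 else 0) \<partial>unif)"
    by (simp only:) (rule nn_integral_sum, rule measurable_unif, measurable)
  also have "\<dots> = (\<Sum>j<n. h j * ennreal (1 / real n))"
  proof (rule sum.cong)
    fix j assume j: "j \<in> {..<n}"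
    have "(\<integral>\<^sup>+u. h j * ennreal (if pick n u = j then 1 else 0) \<partial>unif) = h j * (\<integral>\<^sup>+u. ennreal (if pick n u = j then 1 else 0) \<partial>unif)"
      by (rule nn_integral_cmult, rule measurable_unif) measurable
    also have "(\<integral>\<^sup>+u. ennreal (if pick n u = j then 1 else 0) \<partial>unif) = ennreal ((\<Sum>i<n. if i = j then 1 else 0) / real n)"
      by (rule nn_integral_pick[OF n]) simp
    finally show "(\<integral>\<^sup>+u. h j * ennreal (if pick n u = j then 1 else 0) \<partial>unif) = h j * ennreal (1 / real n)"
      using j by simp
  qed simp
  also have "\<dots> = (\<Sum>j<n. h j) / ennreal (real n)"
    using n by (simp add: sum_distrib_right[symmetric] divide_ennreal_def inverse_ennreal divide_inverse)
  finally show ?thesis .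
qed

text \<open>The \<open>min m\<close> is redundant (see \<open>Xtree_Suc\<close>); it only makes termination evident.\<close>

fun Xtree :: "nat \<Rightarrow> (bool list \<Rightarrow> real) \<Rightarrow> nat" where
  "Xtree 0 \<omega> = 0"
| "Xtree (Suc m) \<omega> = Xtree (min m (pick (Suc m) (\<omega> []))) (subtree True \<omega>)
     + Xtree (m - pick (Suc m) (\<omega> [])) (subtree False \<omega>) + m"

lemma min_pick: "min m (pick (Suc m) u) = pick (Suc m) u"
  using pick_less[of "Suc m" u] by simp

declare Xtree.simps(2) [simp del]

lemma Xtree_Suc: "Xtree (Suc m) \<omega> = Xtree (pick (Suc m) (\<omega> [])) (subtree True \<omega>)
     + Xtree (m - pick (Suc m) (\<omega> [])) (subtree False \<omega>) + m"
  by (simp add: Xtree.simps min_pick)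

lemma measurable_Xtree [measurable]: "Xtree n \<in> measurable tree_space (count_space UNIV)"
proof (induction n rule: less_induct)
  case (less n)
  show ?case
  proof (cases n)
    case 0
    then have "Xtree n = (\<lambda>_. 0)" by auto
    then show ?thesis by simp
  next
    case (Suc m)
    have p[measurable]: "(\<lambda>\<omega>. pick n (\<omega> [])) \<in> measurable tree_space (count_space UNIV)"
      by measurable
    have *: "(\<lambda>\<omega>. if j < n then Xtree j (subtree True \<omega>) + Xtree (m - j) (subtree False \<omega>) + m else 0)
        \<in> measurable tree_space (count_space UNIV)" for j
    proof (cases "j < n")
      case True
      have [measurable]: "Xtree j \<in> measurable tree_space (count_space UNIV)" "Xtree (m - j) \<in> measurable tree_space (count_space UNIV)"
        using True Suc by (auto intro!: less)
      show ?thesis using True by simp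
    qed simp
    have "(\<lambda>\<omega>. (\<lambda>j \<omega>. if j < n then Xtree j (subtree True \<omega>) + Xtree (m - j) (subtree False \<omega>) + m else 0) (pick n (\<omega> [])) \<omega>)
       \<in> measurable tree_space (count_space UNIV)"
      by (rule measurable_compose_countable[OF * p])
    also have "(\<lambda>\<omega>. (\<lambda>j \<omega>. if j < n then Xtree j (subtree True \<omega>) + Xtree (m - j) (subtree False \<omega>) + m else 0) (pick n (\<omega> [])) \<omega>) = Xtree n"
      using Suc pick_less[of n] by (auto simp: Xtree_Suc)
    finally show ?thesis .
  qed
qed

text \<open>Stated for all test functions because the induction hypothesis is applied to shifted
  ones: after conditioning on the root, one subtree is averaged while the count of the other is held
  fixed.\<close>

lemma nn_integral_Xtree:
  "(\<integral>\<^sup>+\<omega>. \<phi> (Xtree n \<omega>) \<partial>tree_space) = (\<integral>\<^sup>+k. \<phi> k \<partial>measure_pmf (qs_comparisons n))"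
proof (induction n arbitrary: \<phi> rule: less_induct)
  case (less n)
  show ?case
  proof (cases n)
    case 0
    then show ?thesis by (simp add: tree_space.emeasure_space_1[simplified])
  next
    case (Suc m)
    define J where "J j = (\<integral>\<^sup>+a. \<integral>\<^sup>+b. \<phi> (a + b + m) \<partial>measure_pmf (qs_comparisons (m - j)) \<partial>measure_pmf (qs_comparisons j))" for j
    have "(\<integral>\<^sup>+\<omega>. \<phi> (Xtree n \<omega>) \<partial>tree_space) = (\<integral>\<^sup>+u. \<integral>\<^sup>+l. \<integral>\<^sup>+r. \<phi> (Xtree n (graft u l r)) \<partial>tree_space \<partial>tree_space \<partial>unif)"
      by (rule nn_integral_tree) measurable
    also have "\<dots> = (\<integral>\<^sup>+u. J (pick n u) \<partial>unif)"
    proof (rule nn_integral_cong)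
      fix u
      let ?j = "pick n u"
      have j: "?j < n" "m - ?j < n" using Suc pick_less[of n u] by auto
      have "(\<integral>\<^sup>+l. \<integral>\<^sup>+r. \<phi> (Xtree n (graft u l r)) \<partial>tree_space \<partial>tree_space)
         = (\<integral>\<^sup>+l. \<integral>\<^sup>+r. \<phi> (Xtree ?j l + Xtree (m - ?j) r + m) \<partial>tree_space \<partial>tree_space)"
        by (simp add: Suc Xtree_Suc)
      also have "\<dots> = (\<integral>\<^sup>+l. \<integral>\<^sup>+b. \<phi> (Xtree ?j l + b + m) \<partial>measure_pmf (qs_comparisons (m - ?j)) \<partial>tree_space)"
        by (subst less[OF j(2)]) simp
      also have "\<dots> = J ?j"
        unfolding J_def by (rule less[OF j(1)])
      finally show "(\<integral>\<^sup>+l. \<integral>\<^sup>+r. \<phi> (Xtree n (graft u l r)) \<partial>tree_space \<partial>tree_space) = J ?j" .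
    qed
    also have "\<dots> = (\<Sum>j<n. J j) / ennreal (real n)" by (rule nn_integral_pick_ennreal) (simp add: Suc)
    also have "\<dots> = (\<integral>\<^sup>+k. \<phi> k \<partial>measure_pmf (qs_comparisons n))"
    proof -
      have "(\<integral>\<^sup>+k. \<phi> k \<partial>measure_pmf (qs_comparisons n)) = (\<integral>\<^sup>+u. J (u - 1) \<partial>measure_pmf (pmf_of_set {1..Suc m}))"
      proof -
        have "(\<integral>\<^sup>+k. \<phi> k \<partial>measure_pmf (qs_comparisons n)) =
          (\<integral>\<^sup>+u. \<integral>\<^sup>+a. \<integral>\<^sup>+b. \<phi> (a + b + m) \<partial>measure_pmf (qs_comparisons (Suc m - u)) \<partial>measure_pmf (qs_comparisons (u - 1)) \<partial>measure_pmf (pmf_of_set {1..Suc m}))"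
          by (simp add: Suc)
        also have "\<dots> = (\<integral>\<^sup>+u. J (u - 1) \<partial>measure_pmf (pmf_of_set {1..Suc m}))"
          by (rule nn_integral_cong_AE) (auto simp: AE_measure_pmf_iff set_pmf_of_set J_def Suc_diff_le)
        finally show ?thesis .
      qed
      also have "\<dots> = (\<Sum>u\<in>{1..Suc m}. J (u - 1)) / ennreal (real (Suc m))"
        by (subst nn_integral_pmf_of_set) (auto simp: ennreal_of_nat_eq_real_of_nat)
      also have "(\<Sum>u\<in>{1..Suc m}. J (u - 1)) = (\<Sum>j<n. J j)"
        by (rule sum.reindex_bij_witness[of _ "\<lambda>j. j + 1" "\<lambda>u. u - 1"]) (auto simp: Suc)
      finally show ?thesis by (simp add: Suc)
    qed
    finally show ?thesis .
  qed
qed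

definition Zn :: "nat \<Rightarrow> (bool list \<Rightarrow> real) \<Rightarrow> real" where
  "Zn n \<omega> = real (Xtree n \<omega>) - qs_mean n"

lemma measurable_Zn [measurable]: "Zn n \<in> borel_measurable tree_space"
  unfolding Zn_def[abs_def] by measurable

lemma Yn_law_eq: "Yn_law n = distr tree_space borel (\<lambda>\<omega>. Zn n \<omega> / real n)"
proof -
  have "distr tree_space (count_space UNIV) (Xtree n) = measure_pmf (qs_comparisons n)"
  proof (rule measure_eqI)
    fix A assume "A \<in> sets (distr tree_space (count_space UNIV) (Xtree n))"
    have "emeasure (distr tree_space (count_space UNIV) (Xtree n)) A = (\<integral>\<^sup>+\<omega>. indicator A (Xtree n \<omega>) \<partial>tree_space)"
      by (subst nn_integral_indicator[symmetric], simp, subst nn_integral_distr) auto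
    also have "\<dots> = emeasure (measure_pmf (qs_comparisons n)) A" by (simp add: nn_integral_Xtree)
    finally show "emeasure (distr tree_space (count_space UNIV) (Xtree n)) A = emeasure (measure_pmf (qs_comparisons n)) A" .
  qed simp
  then have "Yn_law n = distr (distr tree_space (count_space UNIV) (Xtree n)) borel (\<lambda>k. (real k - qs_mean n) / real n)"
    by (simp add: Yn_law_def)
  also have "\<dots> = distr tree_space borel (\<lambda>\<omega>. Zn n \<omega> / real n)"
    by (subst distr_distr) (auto simp: comp_def Zn_def)
  finally show ?thesis .
qed

text \<open>The discrete toll: the n - 1 comparisons with the pivot together with the change of the
  centring constants when j elements go left and n - 1 - j go right.\<close>

definition cn :: "nat \<Rightarrow> nat \<Rightarrow> real" where
  "cn n j = real n - 1 + qs_mean j + qs_mean (n - 1 - j) - qs_mean n"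

lemma qs_mean_harm: "qs_mean n = 2 * (real n + 1) * harm n - 4 * real n"
  by (simp add: qs_mean_def harm_def divide_inverse)

lemma cn_harm:
  assumes "j < n"
  shows "cn n j = real n + 3 + 2 * (real j + 1) * harm j + 2 * (real n - real j) * harm (n - 1 - j) - 2 * (real n + 1) * harm n"
proof -
  have "real (n - 1 - j) = real n - 1 - real j" using assms by linarith
  then show ?thesis by (simp add: cn_def qs_mean_harm algebra_simps)
qed

text \<open>The classical recurrence for the expected number of comparisons; it is what makes the
  discrete toll average to 0.\<close>

lemma sum_qs_mean: "2 * (\<Sum>j<n. qs_mean j) = real n * qs_mean n - real n * (real n - 1)"
proof (induction n)
  case (Suc n)
  have h: "harm (Suc n) = harm n + 1 / (real n + 1)" by (simp add: harm_Suc divide_inverse)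
  have "(real n + 2) * ((real n + 1) * harm (Suc n)) = (real n + 2) * ((real n + 1) * harm n + 1)" unfolding h by (simp add: field_simps)
  with Suc show ?case by (simp add: qs_mean_harm algebra_simps)
qed simp

lemma sum_reflect: "(\<Sum>j<n. f (n - 1 - j)) = (\<Sum>j<n::nat. f j :: real)"
  by (rule sum.reindex_bij_witness[of _ "\<lambda>j. n - 1 - j" "\<lambda>j. n - 1 - j"]) auto

lemma sum_cn: "0 < n \<Longrightarrow> (\<Sum>j<n. cn n j) = 0"
proof -
  assume n: "0 < n"
  have "(\<Sum>j<n. cn n j) = real n * (real n - 1) + (\<Sum>j<n. qs_mean j) + (\<Sum>j<n. qs_mean (n - 1 - j)) - real n * qs_mean n"
    unfolding cn_def by (simp add: sum.distrib sum_subtractf)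
  also have "\<dots> = 0" using sum_qs_mean[of n] sum_reflect[of qs_mean n] by simp
  finally show ?thesis .
qed

lemma Zn_0 [simp]: "Zn 0 \<omega> = 0" by (simp add: Zn_def qs_mean_def)

lemma Zn_graft:
  assumes "0 < n"
  shows "Zn n (graft u l r) = Zn (pick n u) l + Zn (n - 1 - pick n u) r + cn n (pick n u)"
proof -
  obtain m where m: "n = Suc m" using assms by (cases n) auto
  show ?thesis by (simp add: m Zn_def Xtree_Suc cn_def)
qed

text \<open>Both claims share one induction: the second-moment recursion at n needs the smaller
  functionals to be centred, and centredness at n needs the finite second moment.\<close>

lemma centred_Zn: "centred (Zn n)"
  and tnorm2_Zn: "0 < n \<Longrightarrow> tnorm2 (Zn n) = (2 * (\<Sum>j<n. tnorm2 (Zn j)) + (\<Sum>j<n. (cn n j)^2)) / real n"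
proof -
  have "centred (Zn n) \<and> (0 < n \<longrightarrow> tnorm2 (Zn n) = (2 * (\<Sum>j<n. tnorm2 (Zn j)) + (\<Sum>j<n. (cn n j)^2)) / real n)"
  proof (induction n rule: less_induct)
    case (less n)
    show ?case
    proof (cases "n = 0")
      case True
      have "Zn n = (\<lambda>_. 0)" using True by auto
      then show ?thesis using True by (simp add: centred_def)
    next
      case False
      then have n: "0 < n" by simp
      let ?v = "(2 * (\<Sum>j<n. tnorm2 (Zn j)) + (\<Sum>j<n. (cn n j)^2)) / real n"
      have c: "centred (Zn (pick n u))" "centred (Zn (n - 1 - pick n u))" for u
        using less[of "pick n u"] less[of "n - 1 - pick n u"] pick_less[OF n, of u] n by auto
      have "(\<integral>\<^sup>+\<omega>. ennreal ((Zn n \<omega>)^2) \<partial>tree_space) =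
        (\<integral>\<^sup>+u. ennreal (tnorm2 (Zn (pick n u)) + tnorm2 (Zn (n - 1 - pick n u)) + (cn n (pick n u))^2) \<partial>unif)"
        by (rule tree_square[OF measurable_Zn Zn_graft[OF n] c])
      also have "\<dots> = ennreal ((\<Sum>j<n. tnorm2 (Zn j) + tnorm2 (Zn (n - 1 - j)) + (cn n j)^2) / real n)"
        by (rule nn_integral_pick[OF n]) simp
      also have "(\<Sum>j<n. tnorm2 (Zn j) + tnorm2 (Zn (n - 1 - j)) + (cn n j)^2) / real n = ?v"
        by (simp add: sum.distrib sum_reflect[of "\<lambda>j. tnorm2 (Zn j)", simplified])
      finally have nn: "(\<integral>\<^sup>+\<omega>. ennreal ((Zn n \<omega>)^2) \<partial>tree_space) = ennreal ?v" .
      have int: "integrable tree_space (\<lambda>\<omega>. (Zn n \<omega>)^2)"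
        by (rule integrableI_nonneg) (simp_all add: nn)
      have "0 \<le> ?v" by (intro divide_nonneg_nonneg add_nonneg_nonneg mult_nonneg_nonneg sum_nonneg) auto
      with nn have t: "tnorm2 (Zn n) = ?v"
        unfolding tnorm2_def by (subst integral_eq_nn_integral) auto
      have i: "integrable tree_space (Zn n)" by (rule tree_space.square_integrable_imp_integrable[OF measurable_Zn int])
      have "(\<integral>\<omega>. Zn n \<omega> \<partial>tree_space) = (\<integral>u. cn n (pick n u) \<partial>unif)"
        by (rule tree_mean[OF i Zn_graft[OF n] c]) measurable
      also have "\<dots> = 0"
      proof -
        have "((\<lambda>u. cn n (pick n u)) has_integral (\<Sum>j<n. cn n j / real n)) {0..1}"
        proof (rule cells_has_integral[OF n, where F="\<lambda>j u. cn n j"])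
          fix j
          show "((\<lambda>u. cn n j) has_integral cn n j / real n) {real j / real n..real (Suc j) / real n}"
            using has_integral_const_real[of "cn n j" "real j / real n" "real (Suc j) / real n"] n
            by (simp add: divide_right_mono diff_divide_distrib[symmetric])
        qed
        then have h: "((\<lambda>u. cn n (pick n u)) has_integral 0) {0..1}"
          using sum_cn[OF n] by (simp add: sum_divide_distrib[symmetric])
        have iu: "integrable unif (\<lambda>u. cn n (pick n u))"
          by (rule unif.integrable_const_bound[where B="Max ((\<lambda>j. \<bar>cn n j\<bar>) ` {..<n})"])
             (use pick_less[OF n] in \<open>auto intro!: Max_ge measurable_unif\<close>)
        have m: "(\<lambda>u. cn n (pick n u)) \<in> borel_measurable borel" by measurable
        have "set_integrable lborel {0..1} (\<lambda>u. cn n (pick n u))"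
          using iu integrable_density[of "\<lambda>u. cn n (pick n u)" lborel "indicator {0..1}"] m
          unfolding unif_eq_density set_integrable_def by (simp add: ennreal_indicator)
        from set_borel_integral_eq_integral(2)[OF this] h
        show ?thesis by (simp add: integral_unif[OF m] set_lebesgue_integral_def integral_unique)
      qed
      finally have "(\<integral>\<omega>. Zn n \<omega> \<partial>tree_space) = 0" .
      then show ?thesis using int t by (simp add: centred_def)
    qed
  qed
  then show "centred (Zn n)" "0 < n \<Longrightarrow> tnorm2 (Zn n) = (2 * (\<Sum>j<n. tnorm2 (Zn j)) + (\<Sum>j<n. (cn n j)^2)) / real n"
    by auto
qed

section \<open>The variance of Quicksort\<close>

definition harm2 :: "nat \<Rightarrow> real" where "harm2 n = (\<Sum>k=1..n. 1 / (real k)^2)"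

lemma harm2_Suc: "harm2 (Suc n) = harm2 n + 1 / (real (Suc n))^2"
  by (simp add: harm2_def)

lemma harm2_0 [simp]: "harm2 0 = 0" by (simp add: harm2_def)

section \<open>Convolutions of harmonic numbers\<close>

definition conv :: "(nat \<Rightarrow> real) \<Rightarrow> (nat \<Rightarrow> real) \<Rightarrow> nat \<Rightarrow> real" where
  "conv x y n = (\<Sum>j\<le>n. x j * y (n - j))"

lemma conv_commute: "conv x y n = conv y x n"
  unfolding conv_def
  by (rule sum.reindex_bij_witness[of _ "\<lambda>j. n - j" "\<lambda>j. n - j"]) (auto simp: mult.commute)

text \<open>A discrete product rule: increasing n replaces one factor by its increments. This
  reduces \<open>wharm\<close> with itself, by way of \<open>dwharm\<close> and \<open>harm\<close>,
  to \<open>recip\<close> with itself; the zero values at 0 remove the boundary terms.\<close>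

lemma conv_Suc_diff:
  assumes "y 0 = 0" "z 0 = 0" and d: "\<And>i. y (Suc i) = y i + z (Suc i)"
  shows "conv x y (Suc n) = conv x y n + conv x z (Suc n)"
proof -
  have "x j * y (Suc n - j) = x j * y (n - j) + x j * z (Suc n - j)" if "j \<le> n" for j
    using d[of "n - j"] that by (simp add: Suc_diff_le algebra_simps)
  then have "(\<Sum>j\<le>n. x j * y (Suc n - j)) = (\<Sum>j\<le>n. x j * y (n - j)) + (\<Sum>j\<le>n. x j * z (Suc n - j))"
    by (simp add: sum.distrib[symmetric])
  then show ?thesis using assms(1,2) by (simp add: conv_def)
qed

definition recip :: "nat \<Rightarrow> real" where "recip n = 1 / real n"

lemma recip_0 [simp]: "recip 0 = 0" by (simp add: recip_def)

lemma harm_Suc_recip: "harm (Suc i) = harm i + recip (Suc i)"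
  by (simp add: harm_Suc recip_def divide_inverse)

lemma harm_0: "harm 0 = (0 :: real)"
  by (simp add: harm_def)

text \<open>Partial fractions for 1 / (j (n + 1 - j)). The convention 1 / 0 = 0 discards the two
  extreme summands.\<close>

lemma conv_recip_recip: "conv recip recip (Suc n) = 2 * harm n / real (Suc n)"
proof -
  have "conv recip recip (Suc n) = (\<Sum>j\<in>{1..n}. recip j * recip (Suc n - j))"
  proof -
    have "{..Suc n} = insert 0 (insert (Suc n) {1..n})" by auto
    then show ?thesis unfolding conv_def by simp
  qed
  also have "\<dots> = (\<Sum>j\<in>{1..n}. (1 / real j + 1 / real (Suc n - j)) / real (Suc n))"
  proof (rule sum.cong)
    fix j assume "j \<in> {1..n}"
    then have "real j > 0" "real (Suc n - j) > 0" "real (Suc n - j) = real (Suc n) - real j" by auto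
    then show "recip j * recip (Suc n - j) = (1 / real j + 1 / real (Suc n - j)) / real (Suc n)"
      unfolding recip_def by (simp add: divide_simps)
  qed simp
  also have "\<dots> = ((\<Sum>j\<in>{1..n}. 1 / real j) + (\<Sum>j\<in>{1..n}. 1 / real (Suc n - j))) / real (Suc n)"
    by (simp add: sum_divide_distrib[symmetric] sum.distrib)
  also have "(\<Sum>j\<in>{1..n}. 1 / real (Suc n - j)) = (\<Sum>j\<in>{1..n}. 1 / real j)"
    by (rule sum.reindex_bij_witness[of _ "\<lambda>j. Suc n - j" "\<lambda>j. Suc n - j"]) auto
  also have "(\<Sum>j\<in>{1..n}. 1 / real j) = harm n" by (simp add: harm_def divide_inverse)
  finally show ?thesis by simp
qed

lemma conv_recip_harm: "conv recip harm n = (harm n)^2 - harm2 n"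
proof (induction n)
  case 0 then show ?case by (simp add: conv_def harm_def)
next
  case (Suc n)
  have "conv recip harm (Suc n) = conv recip harm n + conv recip recip (Suc n)"
    by (rule conv_Suc_diff) (simp_all only: harm_Suc_recip recip_0 harm_0)
  moreover have "conv recip recip (Suc n) = 2 * harm n * recip (Suc n)"
    by (simp only: conv_recip_recip recip_def) simp
  moreover have "harm2 (Suc n) = harm2 n + (recip (Suc n))^2"
    by (simp add: harm2_Suc recip_def power_divide)
  ultimately show ?case using Suc harm_Suc_recip[of n] by algebra
qed

lemma conv_harm_harm: "conv harm harm n = (real n + 1) * ((harm n)^2 - harm2 n) - 2 * real n * harm n + 2 * real n"
proof (induction n)
  case 0 then show ?case by (simp add: conv_def harm_def)
next
  case (Suc n)
  have e: "conv harm harm (Suc n) = conv harm harm n + conv harm recip (Suc n)"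
    by (rule conv_Suc_diff) (simp_all only: harm_Suc_recip recip_0 harm_0)
  \<comment> \<open>With the reciprocal as a variable subject to r * (n + 1) = 1, the induction step
    becomes a polynomial identity. The closed forms below are all verified in this way.\<close>
  define r where "r = 1 / (real n + 1)"
  have r: "r * (real n + 1) = 1" by (simp add: r_def)
  have h: "harm (Suc n) = harm n + r" "harm2 (Suc n) = harm2 n + r^2"
    by (simp_all add: harm_Suc harm2_Suc r_def divide_inverse power_mult_distrib power_inverse add.commute)
  show ?case
    unfolding e Suc conv_commute[of harm recip] conv_recip_harm h of_nat_Suc
    using r by algebra
qed

text \<open>The shape in which harmonic numbers enter \<open>cn_harm\<close>. The next function is
  its increment, set to 0 at 0 as \<open>conv_Suc_diff\<close> demands.\<close>

definition wharm :: "nat \<Rightarrow> real" where "wharm j = (real j + 1) * harm j"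
definition dwharm :: "nat \<Rightarrow> real" where "dwharm j = (if j = 0 then 0 else harm j + 1)"

lemma wharm_Suc: "wharm (Suc i) = wharm i + dwharm (Suc i)"
  by (simp add: wharm_def dwharm_def harm_Suc field_simps)

lemma wharm_0 [simp]: "wharm 0 = 0" and dwharm_0 [simp]: "dwharm 0 = 0"
  by (simp_all add: wharm_def dwharm_def harm_def)

lemma sum_harm: "(\<Sum>j\<le>n. harm j) = (real n + 1) * harm n - real n"
proof (induction n)
  case (Suc n)
  define r where "r = 1 / (real n + 1)"
  have r: "r * (real n + 1) = 1" by (simp add: r_def)
  have h: "harm (Suc n) = harm n + r"
    by (simp add: harm_Suc r_def divide_inverse add.commute)
  show ?case unfolding sum.atMost_Suc Suc h of_nat_Suc using r by algebra
qed (simp add: harm_0)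

lemma conv_dwharm_dwharm: "conv dwharm dwharm (Suc n) = (real n + 2) * ((harm (Suc n))^2 - harm2 (Suc n)) + real n"
proof -
  have "conv dwharm dwharm (Suc n) = (\<Sum>j\<in>{1..n}. (harm j + 1) * (harm (Suc n - j) + 1))"
  proof -
    have "{..Suc n} = insert 0 (insert (Suc n) {1..n})" by auto
    then show ?thesis unfolding conv_def by (auto simp: dwharm_def intro!: sum.cong)
  qed
  also have "\<dots> = (\<Sum>j\<in>{1..n}. harm j * harm (Suc n - j)) + (\<Sum>j\<in>{1..n}. harm j) + (\<Sum>j\<in>{1..n}. harm (Suc n - j)) + real n"
    by (simp add: algebra_simps sum.distrib)
  also have "(\<Sum>j\<in>{1..n}. harm (Suc n - j)) = (\<Sum>j\<in>{1..n}. harm j :: real)"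
    by (rule sum.reindex_bij_witness[of _ "\<lambda>j. Suc n - j" "\<lambda>j. Suc n - j"]) auto
  also have "(\<Sum>j\<in>{1..n}. harm j) = (\<Sum>j\<le>n. harm j :: real)"
  proof -
    have "{..n} = insert 0 {1..n}" by auto
    then show ?thesis by (simp add: harm_def[of 0])
  qed
  also have "(\<Sum>j\<in>{1..n}. harm j * harm (Suc n - j)) = conv harm harm (Suc n)"
  proof -
    have "{..Suc n} = insert 0 (insert (Suc n) {1..n})" by auto
    then show ?thesis unfolding conv_def by (simp add: harm_def[of 0])
  qed
  finally have e: "conv dwharm dwharm (Suc n) = conv harm harm (Suc n) + 2 * (\<Sum>j\<le>n. harm j) + real n" by simp
  define r where "r = 1 / (real n + 1)"
  have r: "r * (real n + 1) = 1" by (simp add: r_def)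
  have h: "harm (Suc n) = harm n + r"
    by (simp add: harm_Suc r_def divide_inverse add.commute)
  show ?thesis unfolding e conv_harm_harm sum_harm h of_nat_Suc using r by algebra
qed

lemma conv_dwharm_wharm:
  "conv dwharm wharm n = 5/4 * real n + 3/4 * (real n)^2 - (3/2 * real n + 1/2 * (real n)^2) * harm n
     + (1 + 3/2 * real n + 1/2 * (real n)^2) * ((harm n)^2 - harm2 n)"
proof (induction n)
  case 0 then show ?case by (simp add: conv_def harm_def)
next
  case (Suc n)
  have e: "conv dwharm wharm (Suc n) = conv dwharm wharm n + conv dwharm dwharm (Suc n)"
    by (rule conv_Suc_diff) (auto simp: wharm_Suc)
  define r where "r = 1 / (real n + 1)"
  have r: "r * (real n + 1) = 1" by (simp add: r_def)
  have h: "harm (Suc n) = harm n + r" "harm2 (Suc n) = harm2 n + r^2"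
    by (simp_all add: harm_Suc harm2_Suc r_def divide_inverse power_mult_distrib power_inverse add.commute)
  show ?case
    unfolding e Suc conv_dwharm_dwharm h of_nat_Suc
    using r by algebra
qed

lemma conv_wharm_wharm:
  "conv wharm wharm n = (let m = real n + 1; h = harm (Suc n) in
     37/54 * m + 35/36 * m^2 + 37/108 * m^3 - (5/9 * m + 7/6 * m^2 + 5/18 * m^3) * h
     + (1/3 * m + 1/2 * m^2 + 1/6 * m^3) * (h^2 - harm2 (Suc n)))"
proof (induction n)
  case 0 then show ?case by (simp add: conv_def harm_def harm2_def)
next
  case (Suc n)
  have e: "conv wharm wharm (Suc n) = conv wharm wharm n + conv wharm dwharm (Suc n)"
    by (rule conv_Suc_diff) (auto simp: wharm_Suc)
  define r where "r = 1 / (real n + 2)"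
  have r: "r * (real n + 2) = 1" by (simp add: r_def)
  have h: "harm (Suc (Suc n)) = harm (Suc n) + r" "harm2 (Suc (Suc n)) = harm2 (Suc n) + r^2"
    by (simp_all add: harm_Suc[of "Suc n"] harm2_Suc[of "Suc n"] r_def divide_inverse power_mult_distrib power_inverse add.commute)
  show ?case
    unfolding e Suc conv_commute[of wharm dwharm] conv_dwharm_wharm Let_def h of_nat_Suc
    using r by algebra
qed

lemma sum_wharm: "(\<Sum>j<n. wharm j) = - 3/4 * real n - 1/4 * (real n)^2 + (1/2 * real n + 1/2 * (real n)^2) * harm n"
proof (induction n)
  case (Suc n)
  define r where "r = 1 / (real n + 1)"
  have r: "r * (real n + 1) = 1" by (simp add: r_def)
  have h: "harm (Suc n) = harm n + r"
    by (simp add: harm_Suc r_def divide_inverse add.commute)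
  show ?case unfolding sum.lessThan_Suc Suc wharm_def[of n] h of_nat_Suc using r by algebra
qed (simp add: harm_0)

lemma sum_wharm_sq:
  "(\<Sum>j<n. (wharm j)^2) = 79/108 * real n + 13/36 * (real n)^2 + 2/27 * (real n)^3
     - (1/6 + 17/18 * real n + 5/6 * (real n)^2 + 2/9 * (real n)^3) * harm n
     + (1/6 * real n + 1/2 * (real n)^2 + 1/3 * (real n)^3) * (harm n)^2"
proof (induction n)
  case 0 then show ?case by (simp add: harm_def)
next
  case (Suc n)
  define r where "r = 1 / (real n + 1)"
  have r: "r * (real n + 1) = 1" by (simp add: r_def)
  have h: "harm (Suc n) = harm n + r"
    by (simp add: harm_Suc r_def divide_inverse add.commute)
  show ?case unfolding sum.lessThan_Suc Suc wharm_def[of n] h of_nat_Suc using r by algebra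
qed

text \<open>The classical closed form of the variance of the number of Quicksort
  comparisons.\<close>

definition qs_var :: "nat \<Rightarrow> real" where
  "qs_var n = 7 * (real n)^2 - 4 * (real n + 1)^2 * harm2 n - 2 * (real n + 1) * harm n + 13 * real n"

lemma sum_qs_var:
  "(\<Sum>j<n. qs_var j) = - 7/6 * real n + 25/6 * (real n)^2 + 7/3 * (real n)^3
     + (2/3 - real n - (real n)^2) * harm n - (2/3 * real n + 2 * (real n)^2 + 4/3 * (real n)^3) * harm2 n"
proof (induction n)
  case (Suc n)
  define r where "r = 1 / (real n + 1)"
  have r: "r * (real n + 1) = 1" by (simp add: r_def)
  have h: "harm (Suc n) = harm n + r" "harm2 (Suc n) = harm2 n + r^2"
    by (simp_all add: harm_Suc harm2_Suc r_def divide_inverse power_mult_distrib power_inverse add.commute)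
  show ?case unfolding sum.lessThan_Suc Suc qs_var_def[of n] h of_nat_Suc using r by algebra
qed (simp add: harm_0)

text \<open>Rearranged, this says that \<open>qs_var\<close> satisfies the recursion
  \<open>tnorm2_Zn\<close> of the second moments.\<close>

lemma sum_cn_sq:
  assumes "0 < n"
  shows "(\<Sum>j<n. (cn n j)^2) = real n * qs_var n - 2 * (\<Sum>j<n. qs_var j)"
proof -
  obtain m where m: "n = Suc m" using assms by (cases n) auto
  define k where "k = real n + 3 - 2 * (real n + 1) * harm n"
  have c: "cn n j = k + 2 * wharm j + 2 * wharm (n - 1 - j)" if "j < n" for j
  proof -
    have "real (n - 1 - j) = real n - 1 - real j" using that by linarith
    then show ?thesis using that by (simp add: cn_harm k_def wharm_def algebra_simps)
  qed
  have "(\<Sum>j<n. (cn n j)^2) = (\<Sum>j<n. k^2 + 4 * k * wharm j + 4 * k * wharm (n - 1 - j)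
      + 4 * (wharm j)^2 + 4 * (wharm (n - 1 - j))^2 + 8 * (wharm j * wharm (n - 1 - j)))"
    by (rule sum.cong) (auto simp: c power2_eq_square algebra_simps)
  also have "\<dots> = real n * k^2 + 8 * k * (\<Sum>j<n. wharm j) + 8 * (\<Sum>j<n. (wharm j)^2)
      + 8 * (\<Sum>j<n. wharm j * wharm (n - 1 - j))"
    unfolding sum.distrib sum_distrib_left[symmetric]
      sum_reflect[of wharm n] sum_reflect[of "\<lambda>j. (wharm j)^2" n] by simp
  also have "(\<Sum>j<n. wharm j * wharm (n - 1 - j)) = conv wharm wharm m"
    unfolding conv_def m by (simp add: lessThan_Suc_atMost)
  finally have e: "(\<Sum>j<n. (cn n j)^2) = real n * k^2 + 8 * k * (\<Sum>j<n. wharm j) + 8 * (\<Sum>j<n. (wharm j)^2)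
      + 8 * conv wharm wharm m" .
  have rm: "real m + 1 = real n" by (simp add: m)
  show ?thesis
    unfolding e sum_wharm sum_wharm_sq conv_wharm_wharm Let_def rm m[symmetric] sum_qs_var qs_var_def[of n] k_def
    by algebra
qed

lemma tnorm2_Zn_eq: "tnorm2 (Zn n) = qs_var n"
proof (induction n rule: less_induct)
  case (less n)
  show ?case
  proof (cases "n = 0")
    case True
    then have "Zn n = (\<lambda>_. 0)" by auto
    then show ?thesis using True by (simp add: tnorm2_def qs_var_def harm_0)
  next
    case False
    then have n: "0 < n" by simp
    have "tnorm2 (Zn n) = (2 * (\<Sum>j<n. qs_var j) + (\<Sum>j<n. (cn n j)^2)) / real n"
      using tnorm2_Zn[OF n] less by simp
    then show ?thesis using n by (simp add: sum_cn_sq)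
  qed
qed

section \<open>Mean oscillation of the toll function on short intervals\<close>

text \<open>A substitute for the integral of the squared slope of the toll. The cross term ln u ln
  (1 - u) in that square leads to a dilogarithm; it is replaced by its lower bound u (1 - u), which
  keeps the antiderivative elementary.\<close>

definition toll_energy :: "real \<Rightarrow> real" where
  "toll_energy u = 4 * (u * (ln u)^2 - 2 * (u * ln u) + 2 * u
     - ((1 - u) * (ln (1 - u))^2 - 2 * ((1 - u) * ln (1 - u)) + 2 * (1 - u)) - (u^2 - 2/3 * u^3))"

lemma continuous_on_x_ln_sq: "continuous_on {0..1} (\<lambda>x::real. x * (ln x)^2)"
proof -
  have "continuous (at x within {0..1}) (\<lambda>x::real. x * (ln x)^2)" if "x \<in> {0..1}" for x
  proof (cases "x = 0")
    case True
    have "((\<lambda>x::real. x * (ln x)^2) \<longlongrightarrow> 0) (at_right 0)" by real_asymp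
    then have "((\<lambda>x::real. x * (ln x)^2) \<longlongrightarrow> 0) (at 0 within {0..1})"
      by (rule filterlim_mono[OF _ order_refl at_within_Icc_at_right[of 0 1, THEN eq_refl]]) simp
    then show ?thesis using True by (simp add: continuous_within)
  next
    case False
    then show ?thesis using that by (intro continuous_intros) auto
  qed
  then show ?thesis by (simp add: continuous_on_eq_continuous_within)
qed

lemma continuous_on_toll_energy: "continuous_on {0..1} toll_energy"
proof -
  have "continuous_on {0..1} (\<lambda>x::real. (1 - x) * (ln (1 - x))^2)"
    by (rule continuous_on_compose2[OF continuous_on_x_ln_sq, of _ "\<lambda>x. 1 - x"]) (auto intro!: continuous_intros)
  then show ?thesis
    unfolding toll_energy_def
    by (intro continuous_on_add continuous_on_diff continuous_on_const continuous_on_mult_left continuous_on_ln_1m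
      continuous_on_ln_01 continuous_on_x_ln_sq continuous_on_id continuous_on_power)
qed

lemma toll_energy_deriv:
  assumes "0 < u" "u < 1"
  shows "(toll_energy has_real_derivative 4 * ((ln u)^2 + (ln (1 - u))^2 - 2 * (u * (1 - u)))) (at u)"
  unfolding toll_energy_def
  by (rule derivative_eq_intros refl | use assms in force)+
     (use assms in \<open>simp add: field_simps power2_eq_square\<close>)

lemma toll_slope_le_energy:
  fixes u :: real assumes "0 < u" "u < 1"
  shows "(2 * (ln u - ln (1 - u)))^2 \<le> 4 * ((ln u)^2 + (ln (1 - u))^2 - 2 * (u * (1 - u)))"
proof -
  have "1 - u \<le> - ln u" "u \<le> - ln (1 - u)"
    using ln_le_minus_one[of u] ln_le_minus_one[of "1 - u"] assms by auto
  then have "u * (1 - u) \<le> (- ln (1 - u)) * (- ln u)" using assms by (intro mult_mono) auto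
  then show ?thesis by (simp add: power2_eq_square algebra_simps)
qed

text \<open>The Cauchy-Schwarz inequality for the increment of the toll, without integrals: with the
  mean slope l, the auxiliary function has a derivative of at least (slope - l)^2, hence
  increases.\<close>

lemma toll_increment_sq:
  assumes "0 \<le> s" "s \<le> t" "t \<le> 1"
  shows "(toll t - toll s)^2 \<le> (t - s) * (toll_energy t - toll_energy s)"
proof (cases "s = t")
  case False
  then have st: "s < t" using assms by simp
  define l where "l = (toll t - toll s) / (t - s)"
  define f where "f x = toll_energy x - 2 * l * toll x + l^2 * x" for x
  have "f s \<le> f t"
  proof (rule DERIV_nonneg_imp_increasing_open[of s t f])
    show "continuous_on {s..t} f"
    proof (rule continuous_on_subset[of "{0..1}"])
      show "continuous_on {0..1} f"
        unfolding f_def by (intro continuous_intros continuous_on_toll continuous_on_toll_energy)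
    qed (use assms in auto)
    fix x assume x: "s < x" "x < t"
    then have x01: "0 < x" "x < 1" using assms by auto
    let ?d = "4 * ((ln x)^2 + (ln (1 - x))^2 - 2 * (x * (1 - x)))" and ?e = "2 * (ln x - ln (1 - x))"
    have "(f has_real_derivative (?d - 2 * l * ?e + l^2 * 1)) (at x)"
      unfolding f_def by (intro DERIV_add DERIV_diff DERIV_cmult toll_energy_deriv toll_deriv x01 DERIV_ident)
    moreover have "0 \<le> (?e - l)^2" by simp
    then have "0 \<le> ?e^2 - 2 * l * ?e + l^2" by (simp add: power2_eq_square algebra_simps)
    then have "0 \<le> ?d - 2 * l * ?e + l^2 * 1" using toll_slope_le_energy[OF x01] by linarith
    ultimately show "\<exists>y. (f has_real_derivative y) (at x) \<and> 0 \<le> y" by blast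
  qed (use st in simp)
  then have "2 * l * (toll t - toll s) - l^2 * (t - s) \<le> toll_energy t - toll_energy s"
    by (simp add: f_def algebra_simps)
  moreover have "toll t - toll s = l * (t - s)" using st by (simp add: l_def)
  ultimately have "l^2 * (t - s) \<le> toll_energy t - toll_energy s" by (simp add: power2_eq_square algebra_simps)
  then have "(t - s) * (l^2 * (t - s)) \<le> (t - s) * (toll_energy t - toll_energy s)"
    using st by (intro mult_left_mono) auto
  moreover have "(toll t - toll s)^2 = (t - s) * (l^2 * (t - s))"
    unfolding \<open>toll t - toll s = l * (t - s)\<close> by (simp add: power2_eq_square algebra_simps)
  ultimately show ?thesis by simp
qed simp

lemma toll_energy_mono:
  assumes "0 \<le> s" "s \<le> t" "t \<le> 1" shows "toll_energy s \<le> toll_energy t"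
proof (cases "s = t")
  case False
  have "0 \<le> (t - s) * (toll_energy t - toll_energy s)"
    using toll_increment_sq[OF assms] by (meson order_trans zero_le_power2)
  then show ?thesis using False assms by (simp add: zero_le_mult_iff)
qed simp

text \<open>The left side is the integral of (toll - toll m)^2 with m the midpoint. Integrating |u -
  m| over either half gives (b - a)^2 / 8; an endpoint as reference would cost four times as
  much.\<close>

lemma toll_oscillation:
  assumes ab: "0 \<le> a" "a \<le> b" "b \<le> 1"
    and Q: "((\<lambda>u. (toll u)^2) has_integral Q) {a..b}" and T: "(toll has_integral T) {a..b}"
  shows "Q - 2 * toll ((a + b)/2) * T + (toll ((a+b)/2))^2 * (b - a) \<le> (b - a)^2 / 8 * (toll_energy b - toll_energy a)"
proof -
  define m where "m = (a + b) / 2"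
  have m: "a \<le> m" "m \<le> b" "b - m = (b - a)/2" "m - a = (b - a) / 2" using ab by (auto simp: m_def field_simps)
  define f where "f u = (toll u - toll m)^2" for u
  have c: "continuous_on {0..1} f" unfolding f_def by (intro continuous_intros continuous_on_toll)
  have fi: "f integrable_on {x..y}" if "0 \<le> x" "y \<le> 1" for x y
    by (rule integrable_continuous_real, rule continuous_on_subset[OF c]) (use that in auto)
  have r: "integral {m..b} f \<le> (b - m)^2/2 * (toll_energy b - toll_energy m)"
  proof (rule has_integral_le[OF integrable_integral[OF fi]])
    have "((\<lambda>u. (u - m) * (toll_energy b - toll_energy m)) has_integral
        ((b - m)^2/2 * (toll_energy b - toll_energy m) - (m - m)^2/2 * (toll_energy b - toll_energy m))) {m..b}"
      by (rule fundamental_theorem_of_calculus)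
        (use m in \<open>auto intro!: derivative_eq_intros simp flip: has_real_derivative_iff_has_vector_derivative\<close>)
    then show "((\<lambda>u. (u - m) * (toll_energy b - toll_energy m)) has_integral
        (b - m)^2/2 * (toll_energy b - toll_energy m)) {m..b}" by simp
    fix u assume u: "u \<in> {m..b}"
    have "f u \<le> (u - m) * (toll_energy u - toll_energy m)"
      unfolding f_def by (rule toll_increment_sq) (use u m ab in auto)
    also have "\<dots> \<le> (u - m) * (toll_energy b - toll_energy m)"
      using toll_energy_mono[of u b] u m ab by (intro mult_left_mono) auto
    finally show "f u \<le> (u - m) * (toll_energy b - toll_energy m)" .
  qed (use m ab in auto)
  have l: "integral {a..m} f \<le> (m - a)^2/2 * (toll_energy m - toll_energy a)"
  proof (rule has_integral_le[OF integrable_integral[OF fi]])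
    have "((\<lambda>u. (m - u) * (toll_energy m - toll_energy a)) has_integral
        (- ((m - m)^2/2) * (toll_energy m - toll_energy a) - (- ((m - a)^2/2)) * (toll_energy m - toll_energy a))) {a..m}"
      by (rule fundamental_theorem_of_calculus)
        (use m in \<open>auto intro!: derivative_eq_intros simp: field_simps simp flip: has_real_derivative_iff_has_vector_derivative\<close>)
    then show "((\<lambda>u. (m - u) * (toll_energy m - toll_energy a)) has_integral
        (m - a)^2/2 * (toll_energy m - toll_energy a)) {a..m}" by simp
    fix u assume u: "u \<in> {a..m}"
    have "(toll m - toll u)^2 \<le> (m - u) * (toll_energy m - toll_energy u)"
      by (rule toll_increment_sq) (use u m ab in auto)
    also have "\<dots> \<le> (m - u) * (toll_energy m - toll_energy a)"
      using toll_energy_mono[of a u] u m ab by (intro mult_left_mono) auto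
    finally show "f u \<le> (m - u) * (toll_energy m - toll_energy a)" by (simp add: f_def power2_commute)
  qed (use m ab in auto)
  have "integral {a..b} f = integral {a..m} f + integral {m..b} f"
    using Henstock_Kurzweil_Integration.integral_combine[OF m(1,2) fi] ab by simp
  also have "\<dots> \<le> ((b-a)/2)^2/2 * (toll_energy m - toll_energy a) + ((b-a)/2)^2/2 * (toll_energy b - toll_energy m)"
    using r l m(3,4) by simp
  also have "\<dots> = (b - a)^2 / 8 * (toll_energy b - toll_energy a)" by (simp add: power2_eq_square field_simps)
  finally have "integral {a..b} f \<le> (b - a)^2 / 8 * (toll_energy b - toll_energy a)" .
  moreover have "(f has_integral (Q - (2 * toll m) * T + (toll m)^2 * (b - a))) {a..b}"
  proof -
    have "((\<lambda>u. (toll u)^2 - (2 * toll m) * toll u + (toll m)^2) has_integral (Q - (2 * toll m) * T + (b - a) *\<^sub>R (toll m)^2)) {a..b}"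
      using has_integral_const_real[of "(toll m)^2" a b] ab
      by (intro has_integral_add has_integral_diff has_integral_mult_right Q T) simp
    then show ?thesis unfolding f_def by (simp add: power2_eq_square algebra_simps)
  qed
  ultimately show ?thesis by (simp add: integral_unique m_def)
qed

section \<open>The discrete toll and the cell means of the limiting toll\<close>

text \<open>The factor \<open>real n\<close> is the inverse cell length, so the subtracted term is n
  + 1 times the mean of the limiting toll over cell j.\<close>

definition toll_gap :: "nat \<Rightarrow> nat \<Rightarrow> real" where
  "toll_gap n j = cn n j - (real n + 1) * real n * (toll_primitive (real (Suc j) / real n) - toll_primitive (real j / real n))"

text \<open>Splitting into squared bias and variance on one cell: the bias is the gap to the cell
  mean, the variance is at most the oscillation about the midpoint value.\<close>

lemma cell_gap:
  assumes n: "0 < n" and j: "j < n"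
  obtains I where "((\<lambda>u. (cn n j - (real n + 1) * toll u)^2) has_integral I) {real j / real n..real (Suc j) / real n}"
    "I \<le> (toll_gap n j)^2 / real n
       + (real n + 1)^2 / (8 * (real n)^2) * (toll_energy (real (Suc j) / real n) - toll_energy (real j / real n))"
proof -
  let ?a = "real j / real n" and ?b = "real (Suc j) / real n"
  have ab: "0 \<le> ?a" "?a \<le> ?b" "?b \<le> 1" using n j by (auto simp: divide_right_mono)
  have len: "?b - ?a = 1 / real n" using n by (simp add: diff_divide_distrib[symmetric])
  define T where "T = toll_primitive ?b - toll_primitive ?a"
  have T: "(toll has_integral T) {?a..?b}" unfolding T_def by (rule toll_has_integral[OF ab])
  have "(\<lambda>u. (toll u)^2) integrable_on {?a..?b}"
    by (rule integrable_continuous_real, rule continuous_on_subset[OF continuous_on_toll_sq]) (use ab in auto)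
  then obtain Q where Q: "((\<lambda>u. (toll u)^2) has_integral Q) {?a..?b}" by blast
  define k where "k = toll ((?a + ?b)/2)"
  define V where "V = (1 / real n)^2 / 8 * (toll_energy ?b - toll_energy ?a)"
  have "Q - 2 * k * T + k^2 * (1 / real n) \<le> V"
    using toll_oscillation[OF ab Q T] unfolding len k_def V_def by simp
  \<comment> \<open>The mean minimises the quadratic deviation, so the reference value
    \<open>k\<close> may be replaced by it.\<close>
  moreover have "2 * k * T - k^2 * (1 / real n) \<le> real n * T^2"
  proof -
    have "0 \<le> (1 / real n) * (real n * T - k)^2" by simp
    also have "\<dots> = real n * T^2 - 2 * k * T + k^2 * (1 / real n)"
      using n by (simp add: power2_eq_square field_simps)
    finally show ?thesis by simp
  qed
  ultimately have QV: "Q \<le> V + real n * T^2" by linarith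
  let ?c = "cn n j" and ?N = "real n + 1"
  define I where "I = ?c^2 * (1 / real n) - (2 * ?c * ?N) * T + ?N^2 * Q"
  have "((\<lambda>u. ?c^2 - (2 * ?c * ?N) * toll u + ?N^2 * (toll u)^2) has_integral I) {?a..?b}"
  proof -
    have "((\<lambda>u. ?c^2) has_integral (?c^2 * (1 / real n))) {?a..?b}"
      using has_integral_const_real[of "?c^2" ?a ?b] ab len by (simp add: mult.commute)
    then show ?thesis unfolding I_def
      by (intro has_integral_add has_integral_diff has_integral_mult_right Q T)
  qed
  then have "((\<lambda>u. (?c - ?N * toll u)^2) has_integral I) {?a..?b}"
    by (simp add: power2_eq_square algebra_simps)
  moreover have "I \<le> (toll_gap n j)^2 / real n + ?N^2 / (8 * (real n)^2) * (toll_energy ?b - toll_energy ?a)"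
  proof -
    have "?N^2 * Q \<le> ?N^2 * (V + real n * T^2)" using QV by (intro mult_left_mono) auto
    then have "I \<le> ?c^2 * (1 / real n) - (2 * ?c * ?N) * T + ?N^2 * (real n * T^2) + ?N^2 * V"
      unfolding I_def by (simp add: algebra_simps)
    also have "?c^2 * (1 / real n) - (2 * ?c * ?N) * T + ?N^2 * (real n * T^2) = (?c - ?N * real n * T)^2 / real n"
      using n by (simp add: power2_eq_square field_simps)
    also have "?c - ?N * real n * T = toll_gap n j" by (simp add: toll_gap_def T_def)
    also have "?N^2 * V = ?N^2 / (8 * (real n)^2) * (toll_energy ?b - toll_energy ?a)"
      by (simp add: V_def power_divide)
    finally show ?thesis .
  qed
  ultimately show ?thesis by (rule that)
qed

definition toll_dist2 :: "nat \<Rightarrow> real" where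
  "toll_dist2 n = integral {0..1} (\<lambda>u. (cn n (pick n u) - (real n + 1) * toll u)^2)"

text \<open>The energies telescope over the cells to \<open>toll_energy 1 - toll_energy 0\<close>,
  which is 44/3; divided by 8 this is 11/6.\<close>

lemma toll_dist2_has_integral:
  assumes n: "0 < n"
  shows "((\<lambda>u. (cn n (pick n u) - (real n + 1) * toll u)^2) has_integral toll_dist2 n) {0..1}"
    and "toll_dist2 n \<le> (\<Sum>j<n. (toll_gap n j)^2) / real n + 11/6 * (1 + 1 / real n)^2"
proof -
  define B where "B j = (toll_gap n j)^2 / real n
       + (real n + 1)^2 / (8 * (real n)^2) * (toll_energy (real (Suc j) / real n) - toll_energy (real j / real n))" for j
  have "\<forall>j. \<exists>I. j < n \<longrightarrow> ((\<lambda>u. (cn n j - (real n + 1) * toll u)^2) has_integral I) {real j / real n..real (Suc j) / real n} \<and> I \<le> B j"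
    unfolding B_def using cell_gap[OF n] by metis
  then obtain I where I: "\<And>j. j < n \<Longrightarrow> ((\<lambda>u. (cn n j - (real n + 1) * toll u)^2) has_integral I j) {real j / real n..real (Suc j) / real n}"
    and IB: "\<And>j. j < n \<Longrightarrow> I j \<le> B j" by metis
  have h: "((\<lambda>u. (cn n (pick n u) - (real n + 1) * toll u)^2) has_integral (\<Sum>j<n. I j)) {0..1}"
    by (rule cells_has_integral[OF n, where F="\<lambda>j u. (cn n j - (real n + 1) * toll u)^2"]) (rule I)
  then have e: "toll_dist2 n = (\<Sum>j<n. I j)" unfolding toll_dist2_def by (rule integral_unique)
  then show "((\<lambda>u. (cn n (pick n u) - (real n + 1) * toll u)^2) has_integral toll_dist2 n) {0..1}" using h by simp
  have "toll_dist2 n \<le> (\<Sum>j<n. B j)" unfolding e by (rule sum_mono) (use IB in auto)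
  also have "\<dots> = (\<Sum>j<n. (toll_gap n j)^2) / real n
     + (real n + 1)^2 / (8 * (real n)^2) * (\<Sum>j<n. toll_energy (real (Suc j) / real n) - toll_energy (real j / real n))"
    unfolding B_def by (simp add: sum.distrib sum_divide_distrib sum_distrib_left)
  also have "(\<Sum>j<n. toll_energy (real (Suc j) / real n) - toll_energy (real j / real n)) = 44/3"
    unfolding sum_lessThan_telescope[of "\<lambda>j. toll_energy (real j / real n)"] using n by (simp add: toll_energy_def)
  also have "(real n + 1)^2 / (8 * (real n)^2) * (44/3) = 11/6 * (1 + 1 / real n)^2"
    using n by (simp add: power2_eq_square field_simps)
  finally show "toll_dist2 n \<le> (\<Sum>j<n. (toll_gap n j)^2) / real n + 11/6 * (1 + 1 / real n)^2" .
qed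

section \<open>Inequalities for logarithms and harmonic numbers\<close>

lemma nonneg_if_deriv2_nonneg:
  fixes f :: "real \<Rightarrow> real"
  assumes "0 \<le> y" "y \<le> b" and f: "\<And>x. \<lbrakk>0 \<le> x; x \<le> b\<rbrakk> \<Longrightarrow> (f has_real_derivative f' x) (at x)"
    and f': "\<And>x. \<lbrakk>0 \<le> x; x \<le> b\<rbrakk> \<Longrightarrow> (f' has_real_derivative f'' x) (at x)"
    and "\<And>x. \<lbrakk>0 \<le> x; x \<le> b\<rbrakk> \<Longrightarrow> 0 \<le> f'' x" and "f 0 = 0" "f' 0 = 0"
  shows "0 \<le> f y"
proof -
  have "0 \<le> f' x" if "0 \<le> x" "x \<le> b" for x
    using deriv_nonneg_imp_mono[of 0 x f' f''] f' assms(5,7) that by auto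
  then show ?thesis
    using deriv_nonneg_imp_mono[of 0 y f f'] f assms(1,2,6) by auto
qed

text \<open>Taylor estimates at 0 by two differentiations. The second derivatives are governed by ln
  (1 - y^2), which for y <= 1/2 lies between -4/3 y^2 and 0; the quartic contributes 3 y^2, enough
  against 8/3 y^2.\<close>

lemma ln_symmetric_bounds:
  fixes y :: real assumes "0 \<le> y" "y \<le> 1/2"
  shows "(1 + y)^2 * ln (1 + y) + (1 - y)^2 * ln (1 - y) \<le> 3 * y^2"
    and "3 * y^2 - y^4 / 4 \<le> (1 + y)^2 * ln (1 + y) + (1 - y)^2 * ln (1 - y)"
proof -
  have d1: "((\<lambda>y. (1 + y)^2 * ln (1 + y)) has_real_derivative 2 * (1 + x) * ln (1 + x) + (1 + x)) (at x)" if x: "0 \<le> x" "x \<le> 1/2" for x :: real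
  proof -
    have "((\<lambda>y. (1 + y)^2 * ln (1 + y)) has_real_derivative ( 2 * (1 + x)) * ln (1 + x) + ( (1 / (1 + x))) * (1 + x)^2) (at x)"
      using x by (auto intro!: derivative_eq_intros simp: field_simps)
    moreover have "( 2 * (1 + x)) * ln (1 + x) + ( (1 / (1 + x))) * (1 + x)^2 = 2 * (1 + x) * ln (1 + x) + (1 + x)"
      using x by (auto simp: divide_simps power2_eq_square; simp add: algebra_simps)
    ultimately show ?thesis by simp
  qed
  have d2: "((\<lambda>y. (1 - y)^2 * ln (1 - y)) has_real_derivative - (2 * (1 - x) * ln (1 - x) + (1 - x))) (at x)" if x: "0 \<le> x" "x \<le> 1/2" for x :: real
  proof -
    have "((\<lambda>y. (1 - y)^2 * ln (1 - y)) has_real_derivative (- 2 * (1 - x)) * ln (1 - x) + (- (1 / (1 - x))) * (1 - x)^2) (at x)"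
      using x by (auto intro!: derivative_eq_intros simp: field_simps)
    moreover have "(- 2 * (1 - x)) * ln (1 - x) + (- (1 / (1 - x))) * (1 - x)^2 = - (2 * (1 - x) * ln (1 - x) + (1 - x))"
      using x by (auto simp: divide_simps power2_eq_square; simp add: algebra_simps)
    ultimately show ?thesis by simp
  qed
  have d3: "((\<lambda>y. (1 + y) * ln (1 + y)) has_real_derivative ln (1 + x) + 1) (at x)" if x: "0 \<le> x" "x \<le> 1/2" for x :: real
  proof -
    have "((\<lambda>y. (1 + y) * ln (1 + y)) has_real_derivative ( 1) * ln (1 + x) + ( (1 / (1 + x))) * (1 + x)) (at x)"
      using x by (auto intro!: derivative_eq_intros simp: field_simps)
    moreover have "( 1) * ln (1 + x) + ( (1 / (1 + x))) * (1 + x) = ln (1 + x) + 1"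
      using x by (auto simp: divide_simps power2_eq_square; simp add: algebra_simps)
    ultimately show ?thesis by simp
  qed
  have d4: "((\<lambda>y. (1 - y) * ln (1 - y)) has_real_derivative - (ln (1 - x) + 1)) (at x)" if x: "0 \<le> x" "x \<le> 1/2" for x :: real
  proof -
    have "((\<lambda>y. (1 - y) * ln (1 - y)) has_real_derivative (- 1) * ln (1 - x) + (- (1 / (1 - x))) * (1 - x)) (at x)"
      using x by (auto intro!: derivative_eq_intros simp: field_simps)
    moreover have "(- 1) * ln (1 - x) + (- (1 / (1 - x))) * (1 - x) = - (ln (1 - x) + 1)"
      using x by (auto simp: divide_simps power2_eq_square; simp add: algebra_simps)
    ultimately show ?thesis by simp
  qed
  have s: "- (4/3 * x^2) \<le> ln (1 + x) + ln (1 - x)" "ln (1 + x) + ln (1 - x) \<le> 0" if "0 \<le> x" "x \<le> 1/2" for x :: real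
  proof -
    have x2: "x^2 \<le> 1/4" using that power_mono[of x "1/2" 2] by (simp add: power2_eq_square)
    have e: "ln (1 + x) + ln (1 - x) = ln (1 - x^2)"
      using that ln_mult[of "1 + x" "1 - x"] by (simp add: power2_eq_square algebra_simps)
    show "ln (1 + x) + ln (1 - x) \<le> 0" unfolding e using x2 by (simp add: ln_le_zero_iff)
    have "- ln (1 - x^2) = ln (1 / (1 - x^2))" using x2 by (simp add: ln_div)
    also have "\<dots> \<le> 1 / (1 - x^2) - 1" using x2 by (intro ln_le_minus_one) simp
    also have "\<dots> = x^2 / (1 - x^2)" using x2 by (simp add: field_simps)
    also have "\<dots> \<le> x^2 / (3/4)" using x2 by (intro divide_left_mono) auto
    finally show "- (4/3 * x^2) \<le> ln (1 + x) + ln (1 - x)" unfolding e by simp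
  qed
  have "0 \<le> (\<lambda>y. 3 * y^2 - ((1 + y)^2 * ln (1 + y) + (1 - y)^2 * ln (1 - y))) y"
  proof (rule nonneg_if_deriv2_nonneg[where b="1/2" and y=y and f="\<lambda>y. 3 * y^2 - ((1 + y)^2 * ln (1 + y) + (1 - y)^2 * ln (1 - y))" and f'="\<lambda>y. 4 * y - 2 * ((1 + y) * ln (1 + y) - (1 - y) * ln (1 - y))"
      and f''="\<lambda>y. - 2 * (ln (1 + y) + ln (1 - y))"])
    fix x :: real assume x: "0 \<le> x" "x \<le> 1/2"
    show "((\<lambda>y. 3 * y^2 - ((1 + y)^2 * ln (1 + y) + (1 - y)^2 * ln (1 - y))) has_real_derivative
        4 * x - 2 * ((1 + x) * ln (1 + x) - (1 - x) * ln (1 - x))) (at x)"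
      by (rule DERIV_cong[OF DERIV_diff[OF DERIV_cmult[OF DERIV_power[OF DERIV_ident]] DERIV_add[OF d1 d2]]]) (use x in \<open>auto simp: algebra_simps\<close>)
    show "((\<lambda>y. 4 * y - 2 * ((1 + y) * ln (1 + y) - (1 - y) * ln (1 - y))) has_real_derivative
        - 2 * (ln (1 + x) + ln (1 - x))) (at x)"
      by (rule DERIV_cong[OF DERIV_diff[OF DERIV_cmult[OF DERIV_ident] DERIV_cmult[OF DERIV_diff[OF d3 d4]]]]) (use x in \<open>auto simp: algebra_simps\<close>)
    show "0 \<le> - 2 * (ln (1 + x) + ln (1 - x))" using s(2)[OF x] by simp
  qed (use assms in auto)
  then show "(1 + y)^2 * ln (1 + y) + (1 - y)^2 * ln (1 - y) \<le> 3 * y^2" by simp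
  have "0 \<le> (\<lambda>y. (1 + y)^2 * ln (1 + y) + (1 - y)^2 * ln (1 - y) - 3 * y^2 + y^4/4) y"
  proof (rule nonneg_if_deriv2_nonneg[where b="1/2" and y=y and f="\<lambda>y. (1 + y)^2 * ln (1 + y) + (1 - y)^2 * ln (1 - y) - 3 * y^2 + y^4/4" and f'="\<lambda>y. 2 * ((1 + y) * ln (1 + y) - (1 - y) * ln (1 - y)) - 4 * y + y^3"
      and f''="\<lambda>y. 2 * (ln (1 + y) + ln (1 - y)) + 3 * y^2"])
    fix x :: real assume x: "0 \<le> x" "x \<le> 1/2"
    show "((\<lambda>y. (1 + y)^2 * ln (1 + y) + (1 - y)^2 * ln (1 - y) - 3 * y^2 + y^4/4) has_real_derivative
        2 * ((1 + x) * ln (1 + x) - (1 - x) * ln (1 - x)) - 4 * x + x^3) (at x)"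
      by (rule DERIV_cong[OF DERIV_add[OF DERIV_diff[OF DERIV_add[OF d1 d2] DERIV_cmult[OF DERIV_power[OF DERIV_ident]]] DERIV_cdivide[OF DERIV_power[OF DERIV_ident]]]]) (use x in \<open>auto simp: algebra_simps\<close>)
    show "((\<lambda>y. 2 * ((1 + y) * ln (1 + y) - (1 - y) * ln (1 - y)) - 4 * y + y^3) has_real_derivative
        2 * (ln (1 + x) + ln (1 - x)) + 3 * x^2) (at x)"
      by (rule DERIV_cong[OF DERIV_add[OF DERIV_diff[OF DERIV_cmult[OF DERIV_diff[OF d3 d4]] DERIV_cmult[OF DERIV_ident]] DERIV_power[OF DERIV_ident]]]) (use x in \<open>auto simp: algebra_simps\<close>)
    show "0 \<le> 2 * (ln (1 + x) + ln (1 - x)) + 3 * x^2" 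
    proof -
      have "0 \<le> 2 * L + 3 * q" if "- (4/3 * q) \<le> L" "0 \<le> q" for L q :: real using that by linarith
      from this[OF s(1)[OF x]] show ?thesis by simp
    qed
  qed (use assms in auto)
  then show "3 * y^2 - y^4 / 4 \<le> (1 + y)^2 * ln (1 + y) + (1 - y)^2 * ln (1 - y)" by simp
qed

text \<open>The average of $\ln$ against the triangular density on $[j-1,j+1]$.\<close>

definition tent_ln :: "nat \<Rightarrow> real" where
  "tent_ln j = ((real j + 1)^2 * ln (real j + 1) - 2 * (real j)^2 * ln (real j) + (real j - 1)^2 * ln (real j - 1)) / 2 - 3/2"

lemma tent_ln_bounds:
  assumes "1 \<le> j" shows "tent_ln j \<le> ln (real j)" "ln (real j) - 1 / (8 * (real j)^2) \<le> tent_ln j"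
proof -
  have "tent_ln j \<le> ln (real j) \<and> ln (real j) - 1 / (8 * (real j)^2) \<le> tent_ln j"
  proof (cases "j = 1")
    case True
    \<comment> \<open>Here 1 / j = 1 is outside the range of \<open>ln_symmetric_bounds\<close>; the
      two claims amount to 11/16 <= ln 2 <= 3/4.\<close>
    have "0.6875 \<le> ln (2::real)" "ln (2::real) \<le> 0.75" using ln2_ge_two_thirds ln_2_less_1 
      using ln2_le_25_over_36 ln_approx_bounds[of 2 2, simplified, simplified eval_nat_numeral, simplified] by simp_all
    then show ?thesis using True by (simp add: tent_ln_def)
  next
    case False
    then have j: "2 \<le> real j" using assms by linarith
    define y where "y = 1 / real j"
    have y: "0 < y" "y \<le> 1/2" using j by (auto simp: y_def field_simps)
    have jy: "real j = 1 / y" using j by (simp add: y_def)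
    have l: "ln (real j + 1) = ln (1 + y) - ln y" "ln (real j - 1) = ln (1 - y) - ln y" "ln (real j) = - ln y"
    proof -
      have "real j + 1 = (1 + y) / y" "real j - 1 = (1 - y) / y" using y by (auto simp: jy field_simps)
      then show "ln (real j + 1) = ln (1 + y) - ln y" "ln (real j - 1) = ln (1 - y) - ln y" "ln (real j) = - ln y"
        using y by (auto simp: ln_div jy)
    qed
    have "tent_ln j = ((1 + y)^2 * ln (1 + y) + (1 - y)^2 * ln (1 - y)) / (2 * y^2) - ln y - 3/2"
    proof -
      have "(1 / y + 1)^2 = (1 + y)^2 / y^2" "(1 / y - 1)^2 = (1 - y)^2 / y^2" "(1 / y)^2 = 1 / y^2"
        using y by (simp_all add: field_simps power2_eq_square)
      moreover have "((1 + y)^2 / y^2 * (L1 - L) - 2 * (1 / y^2) * (- L) + (1 - y)^2 / y^2 * (L2 - L)) / 2 - 3/2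
         = ((1 + y)^2 * L1 + (1 - y)^2 * L2) / (2 * y^2) - L - 3/2" for L1 L2 L
        using y by (simp add: divide_simps) algebra
      ultimately show ?thesis unfolding tent_ln_def l unfolding jy by simp
    qed
    moreover have "((1 + y)^2 * ln (1 + y) + (1 - y)^2 * ln (1 - y)) / (2 * y^2) \<le> 3 * y^2 / (2 * y^2)"
      using ln_symmetric_bounds(1)[of y] y by (intro divide_right_mono) auto
    moreover have "3 * y^2 / (2 * y^2) = 3/2" using y by simp
    moreover have "(3 * y^2 - y^4/4) / (2 * y^2) \<le> ((1 + y)^2 * ln (1 + y) + (1 - y)^2 * ln (1 - y)) / (2 * y^2)"
      using ln_symmetric_bounds(2)[of y] y by (intro divide_right_mono) auto
    moreover have "(3 * y^2 - y^4/4) / (2 * y^2) = 3/2 - y^2/8" using y by (simp add: field_simps power2_eq_square power4_eq_xxxx)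
    moreover have "1 / (8 * (real j)^2) = y^2/8" by (simp add: y_def power_divide)
    ultimately show ?thesis unfolding l by linarith
  qed
  then show "tent_ln j \<le> ln (real j)" "ln (real j) - 1 / (8 * (real j)^2) \<le> tent_ln j" by auto
qed

text \<open>The trapezoidal rule overestimates the integral of the convex function 1 / (1 +
  x).\<close>

lemma ln_le_trapezoid:
  fixes x :: real assumes "0 \<le> x" shows "ln (1 + x) \<le> (x + x / (1 + x)) / 2"
proof -
  have "(\<lambda>x. (x + x / (1 + x)) / 2 - ln (1 + x)) 0 \<le> (\<lambda>x. (x + x / (1 + x)) / 2 - ln (1 + x)) x"
  proof (rule deriv_nonneg_imp_mono[where a=0 and b=x and g="\<lambda>x. (x + x / (1 + x)) / 2 - ln (1 + x)" and g'="\<lambda>x. x^2 / (2 * (1 + x)^2)"])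
    fix z assume z: "z \<in> {0..x}"
    have "((\<lambda>x. (x + x / (1 + x)) / 2 - ln (1 + x)) has_real_derivative (1 + (1 * (1 + z) - z * 1) / ((1 + z) * (1 + z))) / 2 - 1 / (1 + z)) (at z)"
      using z by (auto intro!: derivative_eq_intros)
    moreover have "(1 + (1 * (1 + z) - z * 1) / ((1 + z) * (1 + z))) / 2 - 1 / (1 + z) = z^2 / (2 * (1 + z)^2)"
    proof -
      have "(1 + (1 * (1 + (w - 1)) - (w - 1) * 1) / (w * w)) / 2 - 1 / w = (w - 1)^2 / (2 * w^2)" if "w > 0" for w :: real
        using that by (simp add: field_simps power2_eq_square)
      from this[of "1 + z"] show ?thesis using z by simp
    qed
    ultimately show "((\<lambda>x. (x + x / (1 + x)) / 2 - ln (1 + x)) has_real_derivative z^2 / (2 * (1 + z)^2)) (at z)" by simp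
  qed (use assms in auto)
  then show ?thesis by simp
qed

text \<open>The integral of 1/x over [j, k] lies between the right Riemann sum and the trapezoidal
  sum.\<close>

lemma harm_diff_bounds:
  assumes "1 \<le> j" "j \<le> k"
  shows "harm k - harm j \<le> ln (real k) - ln (real j)"
    and "ln (real k) - ln (real j) - (1 / real j - 1 / real k) / 2 \<le> harm k - harm j"
proof -
  have "harm k - harm j \<le> ln (real k) - ln (real j) \<and>
    ln (real k) - ln (real j) - (1 / real j - 1 / real k) / 2 \<le> harm k - harm j"
    using \<open>j \<le> k\<close>
  proof (induction k rule: dec_induct)
    case base then show ?case by simp
  next
    case (step k)
    then have k: "1 \<le> real k" using assms by linarith
    define x where "x = 1 / real k"
    have x: "0 < x" "1 + x = (real k + 1) / real k" using k by (auto simp: x_def field_simps)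
    have l: "ln (real (Suc k)) - ln (real k) = ln (1 + x)" using k by (simp add: x ln_div add.commute)
    have "x / (1 + x) = 1 / real (Suc k)" using k by (simp add: x_def field_simps)
    moreover have "x / (1 + x) \<le> ln (1 + x)"
    proof -
      have "- ln (1 + x) = ln (1 / (1 + x))" using x by (simp add: ln_div)
      also have "\<dots> \<le> 1 / (1 + x) - 1" using x(1) by (intro ln_le_minus_one) auto
      also have "\<dots> = - (x / (1 + x))" using x(1) by (simp add: field_simps)
      finally show ?thesis by simp
    qed
    moreover have "ln (1 + x) \<le> (x + x / (1 + x)) / 2" using x(1) by (intro ln_le_trapezoid) auto
    moreover have "harm (Suc k) = harm k + 1 / real (Suc k)" by (simp add: harm_Suc divide_inverse)
    moreover have "hS - hj \<le> lS - lj \<and> lS - lj - (j1 - s) / 2 \<le> hS - hj"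
      if "w = s" "w \<le> d" "d \<le> (x + w) / 2" "hS = hk + s" "hk - hj \<le> lk - lj \<and> lk - lj - (j1 - x) / 2 \<le> hk - hj" "lS - lk = d"
      for w s d hS hk hj lk lj lS j1 x :: real using that by argo
    ultimately show ?case using step.IH l unfolding x_def by blast
  qed
  then show "harm k - harm j \<le> ln (real k) - ln (real j)"
    "ln (real k) - ln (real j) - (1 / real j - 1 / real k) / 2 \<le> harm k - harm j" by auto
qed

section \<open>Variation of the gap across the cells\<close>

lemma toll_gap_eq:
  assumes "j < n"
  defines "kap \<equiv> \<lambda>j. (real j + 1)^2 * ln (real j + 1) - (real j)^2 * ln (real j)"
  shows "toll_gap n j = cn n j - (real n + 1) * ((kap j + kap (n - 1 - j)) / real n - 2 * ln (real n))"
proof -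
  let ?a = "real j / real n" and ?b = "real (Suc j) / real n"
  define i where "i = n - 1 - j"
  have ri: "real i = real n - 1 - real j" using assms(1) unfolding i_def by linarith
  have n: "0 < real n" using assms by simp
  define r where "r = 1 / real n"
  have r: "r * real n = 1" "0 < r" using n by (auto simp: r_def)
  \<comment> \<open>The logarithm of a quotient splits only for positive x; for x = 0 both sides
    vanish because of the square.\<close>
  have sq: "(x * r) * ((x * r) * ln (x * r)) = r^2 * (x^2 * ln x - x^2 * ln (real n))" if "0 \<le> x" for x
  proof (cases "x = 0")
    case False
    then have "ln (x * r) = ln x - ln (real n)" using that n by (simp add: r_def ln_div)
    then show ?thesis by algebra
  qed simp
  have c: "1 - ?a = (real i + 1) * r" "1 - ?b = real i * r" "?b = (real j + 1) * r" "?a = real j * r"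
    using n by (auto simp: ri r_def field_simps)
  have p: "toll_primitive ?b = r^2 * ((real j + 1)^2 * ln (real j + 1) - (real j + 1)^2 * ln (real n)) - ((real j + 1) * r)^2 / 2
      - r^2 * ((real i)^2 * ln (real i) - (real i)^2 * ln (real n)) + (real i * r)^2 / 2 + (real j + 1) * r"
    "toll_primitive ?a = r^2 * ((real j)^2 * ln (real j) - (real j)^2 * ln (real n)) - (real j * r)^2 / 2
      - r^2 * ((real i + 1)^2 * ln (real i + 1) - (real i + 1)^2 * ln (real n)) + ((real i + 1) * r)^2 / 2 + real j * r"
    unfolding toll_primitive_def c(1,2) unfolding c(3,4) by (simp_all only: sq of_nat_0_le_iff add_nonneg_nonneg zero_le_one)
  have "real n * (toll_primitive ?b - toll_primitive ?a) = (kap j + kap i) * r - 2 * ln (real n)"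
  proof -
    define q where "q = (real j + 1)^2 - (real j)^2 + (real i + 1)^2 - (real i)^2"
    have q: "q = 2 * real n" by (simp add: q_def ri power2_eq_square algebra_simps)
    have split: "(R * (A1 * L1 - A1 * N) - A1 * R / 2 - R * (A4 * L4 - A4 * N) + A4 * R / 2 + (J + 1) * r)
        - (R * (A2 * L2 - A2 * N) - A2 * R / 2 - R * (A3 * L3 - A3 * N) + A3 * R / 2 + J * r)
        = R * ((A1 * L1 - A2 * L2) + (A3 * L3 - A4 * L4)) - R * (A1 - A2 + A3 - A4) * N - R * (A1 - A2 + A3 - A4) / 2 + r"
      for R A1 A2 A3 A4 L1 L2 L3 L4 N J :: real
      by (simp add: algebra_simps add_divide_distrib diff_divide_distrib)
    have "toll_primitive ?b - toll_primitive ?a = r^2 * (kap j + kap i) - r^2 * q * ln (real n) - r^2 * q / 2 + r"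
      unfolding p kap_def q_def power_mult_distrib by (rule split)
    moreover have "real n * (r^2 * K - r^2 * (2 * real n) * N - r^2 * (2 * real n) / 2 + r) = K * r - 2 * N" for K N
      using r(1) by algebra
    ultimately show ?thesis unfolding q by simp
  qed
  then show ?thesis unfolding toll_gap_def i_def[symmetric] mult.assoc by (simp add: r_def)
qed

lemma toll_gap_reflect: "j < n \<Longrightarrow> toll_gap n (n - 1 - j) = toll_gap n j"
  by (simp add: toll_gap_eq cn_def add_ac)

text \<open>Differencing in j cancels all terms that depend on n alone. What remains compares H_k -
  H_j with 1 + 1/n times a smoothed ln k - ln j, where k = n - j.\<close>

lemma toll_gap_diff:
  assumes "1 \<le> j" "j < n"
  shows "toll_gap n j - toll_gap n (j - 1) =
    2 * ((1 + 1 / real n) * (tent_ln (n - j) - tent_ln j) - (harm (n - j) - harm j))"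
proof -
  obtain i where i: "j = Suc i" using assms by (cases j) auto
  define k where "k = n - j"
  have k: "n - 1 - (j - 1) = k" "n - 1 - j = k - 1" "real (k - 1) = real k - 1" "1 \<le> k" "real n = real k + real j"
    using assms unfolding k_def by auto
  obtain l where l: "k = Suc l" using k(4) by (cases k) auto
  have ji: "j - 1 = i" "n - 1 - j = l" "n - 1 - i = k" "i < n" using k l i assms by auto
  have rn: "real n - real j = real l + 1" "real n - real i = real k + 1" using k(5) l i by auto
  have w: "cn n j - cn n (j - 1) = 2 * (harm j - harm k)"
  proof -
    have "cn n j = real n + 3 + 2 * wharm j + 2 * wharm l - 2 * (real n + 1) * harm n"
      unfolding cn_harm[OF assms(2)] ji(2) rn(1) wharm_def by (simp add: algebra_simps)
    moreover have "cn n i = real n + 3 + 2 * wharm i + 2 * wharm k - 2 * (real n + 1) * harm n"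
      unfolding cn_harm[OF ji(4)] ji(3) rn(2) wharm_def by (simp add: algebra_simps)
    moreover have "wharm j = wharm i + harm j + 1" "wharm k = wharm l + harm k + 1"
      using wharm_Suc[of i] wharm_Suc[of l] by (simp_all add: i l dwharm_def)
    ultimately show ?thesis by (simp add: i)
  qed
  let ?kap = "\<lambda>j. (real j + 1)^2 * ln (real j + 1) - (real j)^2 * ln (real j)"
  have lin: "(x - N * ((a + b) / m - c)) - (y - N * ((d + e) / m - c)) = (x - y) - N * ((a + b - d - e) / m)"
    for x y N a b c d e m :: real by (simp add: add_divide_distrib diff_divide_distrib algebra_simps)
  have "toll_gap n j - toll_gap n (j - 1) = (cn n j - cn n (j - 1)) - (real n + 1) * ((?kap j + ?kap l - ?kap i - ?kap k) / real n)"
    unfolding ji(1) toll_gap_eq[OF assms(2)] toll_gap_eq[OF ji(4)] ji(2,3) lin ..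
  also have "?kap j + ?kap l - ?kap i - ?kap k = 2 * (tent_ln j - tent_ln k)"
  proof -
    have e: "real j - 1 = real i" "real k - 1 = real l" "real i + 1 = real j" "real l + 1 = real k" using i l by auto
    show ?thesis unfolding tent_ln_def e by (simp add: field_simps)
  qed
  also have "(real n + 1) * (2 * (tent_ln j - tent_ln k) / real n) = 2 * (1 + 1 / real n) * (tent_ln j - tent_ln k)"
    using assms by (simp add: field_simps)
  finally have "toll_gap n j - toll_gap n (j - 1) = 2 * (harm j - harm k) - 2 * (1 + 1 / real n) * (tent_ln j - tent_ln k)"
    unfolding w .
  moreover have "2 * (a - b) - 2 * N * (c - d) = 2 * (N * (d - c) - (b - a))" for a b c d N :: real
    by (simp add: algebra_simps)
  ultimately show ?thesis unfolding k_def by (simp only:)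
qed

text \<open>Arises in \<open>toll_gap_diff_bound\<close> with s^2 = j / (n - j). The constant
  173/100 is a little below sqrt 3, so that its square can be replaced by 3 later.\<close>

lemma quartic_bound:
  fixes s :: real assumes "0 \<le> s"
  shows "(1 - s^2) * (1 + s)^2 + (1 + 2 * s^2) / 4 \<le> 173/100 * (1 + s^2)"
proof -
  have "173/100 * (1 + s^2) - ((1 - s^2) * (1 + s)^2 + (1 + 2 * s^2) / 4) = (s^2 + s - 1/2)^2 + 1.23 * (s - 1/2.46)^2 + (0.23 - 1/4.92)"
    by (simp add: power2_eq_square algebra_simps)
  also have "\<dots> \<ge> 0" by (intro add_nonneg_nonneg mult_nonneg_nonneg) auto
  finally show ?thesis by simp
qed

text \<open>A bound that is exact at 1 and grows only like sqrt x. With x = 1 / s^2 it makes the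
  logarithm a rational function of s.\<close>

lemma ln_le_sqrt:
  fixes x :: real assumes "1 \<le> x" shows "ln x \<le> (x - 1) / sqrt x"
proof -
  define z where "z = sqrt x"
  have z: "1 \<le> z" "x = z^2" using assms by (auto simp: z_def)
  have "(\<lambda>z. z - 1/z - 2 * ln z) 1 \<le> (\<lambda>z. z - 1/z - 2 * ln z) z"
  proof (rule deriv_nonneg_imp_mono[where a=1 and b=z and g="\<lambda>z. z - 1/z - 2 * ln z" and g'="\<lambda>z. (1 - 1/z)^2"])
    fix y assume y: "y \<in> {1..z}"
    have "((\<lambda>z. z - 1/z - 2 * ln z) has_real_derivative (1 - (0 * y - 1 * 1) / (y * y) - 2 * (1 / y))) (at y)"
      using y by (auto intro!: derivative_eq_intros)
    moreover have "1 - (0 * y - 1 * 1) / (y * y) - 2 * (1 / y) = (1 - 1/y)^2"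
      using y by (simp add: field_simps power2_eq_square)
    ultimately show "((\<lambda>z. z - 1/z - 2 * ln z) has_real_derivative (1 - 1/y)^2) (at y)" by simp
  qed (use z in auto)
  then have "2 * ln z \<le> z - 1/z" by simp
  moreover have "ln x = 2 * ln z" using z by (simp add: ln_realpow)
  moreover have "(x - 1) / sqrt x = z - 1/z" using z by (simp add: z_def[symmetric] power2_eq_square field_simps)
  ultimately show ?thesis by simp
qed

text \<open>On the left half k = n - j is at least j. The increment is at most (2/n) ln (k/j), from
  the factor 1 + 1/n, plus 1/j - 1/k, from comparing sums with logarithms, plus the small error of
  \<open>tent_ln\<close>; times j, each is bounded in terms of j / k.\<close>

lemma toll_gap_diff_bound:
  assumes j: "1 \<le> j" "2 * j \<le> n"
  shows "\<bar>toll_gap n j - toll_gap n (j - 1)\<bar> \<le> 173/100 / real j"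
proof -
  define k where "k = n - j"
  have k: "j \<le> k" "real n = real j + real k" using j unfolding k_def by auto
  define t where "t = real j / real k"
  define s where "s = sqrt t"
  have jk: "1 \<le> real j" "real j \<le> real k" "0 < real n" using j k by auto
  have t: "0 < t" "t \<le> 1" using jk by (auto simp: t_def)
  have s: "0 < s" "s \<le> 1" "t = s^2" using t by (auto simp: s_def)
  let ?N = "1 + 1 / real n"
  have tl: "tent_ln k \<le> ln (real k)" "ln (real k) - 1 / (8 * (real k)^2) \<le> tent_ln k"
    "tent_ln j \<le> ln (real j)" "ln (real j) - 1 / (8 * (real j)^2) \<le> tent_ln j"
    using tent_ln_bounds[of k] tent_ln_bounds[of j] j k by auto
  note hb = harm_diff_bounds[OF j(1) k(1)]
  let ?L = "ln (real k) - ln (real j)"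
  define I where "I = toll_gap n j - toll_gap n (j - 1)"
  have I: "I = 2 * (?N * (tent_ln k - tent_ln j) - (harm k - harm j))"
    unfolding I_def k_def by (rule toll_gap_diff) (use j in auto)
  have L: "?L \<le> (1 - t) / s"
  proof -
    have "?L = ln (real k / real j)" using jk by (simp add: ln_div)
    also have "\<dots> \<le> (real k / real j - 1) / sqrt (real k / real j)" using jk by (intro ln_le_sqrt) simp
    also have "real k / real j = 1 / t" by (simp add: t_def)
    also have "(1 / t - 1) / sqrt (1 / t) = (1 - t) / s"
      using s by (simp add: real_sqrt_divide power2_eq_square field_simps)
    finally show ?thesis .
  qed
  have jn: "real j / real n = t / (1 + t)" using jk k by (simp add: t_def field_simps)
  have Nj: "1 / real n \<le> t / (1 + t)" unfolding jn[symmetric] using jk by (intro divide_right_mono) auto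
  have up: "I * real j \<le> 173/100"
  proof -
    have "?N * (tent_ln k - tent_ln j) \<le> ?N * (?L + 1 / (8 * (real j)^2))"
      using tl by (intro mult_left_mono) auto
    then have "I \<le> 2 * (?N * (?L + 1 / (8 * (real j)^2)) - (?L - (1 / real j - 1 / real k) / 2))"
      unfolding I using hb(2) by (intro mult_left_mono) auto
    also have "\<dots> = 2 / real n * ?L + ?N / (4 * (real j)^2) + (1 / real j - 1 / real k)"
    proof -
      have e: "2 * ((1 + p) * (L + q) - (L - d / 2)) = 2 * p * L + 2 * (1 + p) * q + d" for p L q d :: real
        by (simp add: algebra_simps)
      have "2 * (1 / real n) = 2 / real n" by simp
      moreover have "2 * N * (1 / (8 * x)) = N / (4 * x)" for N x :: real by (cases "x = 0") (auto simp: field_simps)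
      ultimately show ?thesis unfolding e by (simp only:)
    qed
    finally have "I * real j \<le> (2 / real n * ?L + ?N / (4 * (real j)^2) + (1 / real j - 1 / real k)) * real j"
      by (intro mult_right_mono) auto
    also have "\<dots> = 2 * (real j / real n) * ?L + ?N / (4 * real j) + (1 - t)"
    proof -
      have e: "(a * L + x / (4 * y^2) + (1 / y - d)) * y = a * y * L + x / (4 * y) + (1 - d * y)" if "y > 0" for a L x y d :: real
        using that by (simp add: field_simps power2_eq_square)
      have "2 / real n * real j = 2 * (real j / real n)" "1 / real k * real j = t" by (simp_all add: t_def)
      then show ?thesis using e[of "real j" "2 / real n" ?L ?N "1 / real k"] jk by simp
    qed
    also have "\<dots> \<le> 2 * (t / (1 + t)) * ((1 - t) / s) + (1 + t / (1 + t)) / 4 + (1 - t)"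
    proof (intro add_mono mult_mono order_refl)
      show "?L \<le> (1 - t) / s" by (rule L)
      show "0 \<le> ?L" using jk by simp
      have "?N / (4 * real j) \<le> ?N / 4" using jk by (intro divide_left_mono) auto
      also have "\<dots> \<le> (1 + t / (1 + t)) / 4" using Nj by (intro divide_right_mono add_left_mono) auto
      finally show "?N / (4 * real j) \<le> (1 + t / (1 + t)) / 4" .
    qed (use jn t in auto)
    also have "\<dots> = ((1 - s^2) * (1 + s)^2 + (1 + 2 * s^2) / 4) / (1 + s^2)"
    proof -
      have "1 + s^2 > 0" by (simp add: add_pos_nonneg)
      then have "1 + s^2 \<noteq> 0" by simp
      moreover have "2 * (s^2 / (1 + s^2)) * ((1 - s^2) / s) = 2 * s * (1 - s^2) / (1 + s^2)"
        using s by (simp add: power2_eq_square)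
      moreover have "(1 + s^2 / (1 + s^2)) / 4 = (1 + 2 * s^2) / 4 / (1 + s^2)"
        using \<open>1 + s^2 \<noteq> 0\<close> by (simp add: field_simps)
      moreover have "1 - s^2 = (1 - s^2) * (1 + s^2) / (1 + s^2)" using \<open>1 + s^2 \<noteq> 0\<close> by simp
      ultimately have "2 * (t / (1 + t)) * ((1 - t) / s) + (1 + t / (1 + t)) / 4 + (1 - t)
        = 2 * s * (1 - s^2) / (1 + s^2) + (1 + 2 * s^2) / 4 / (1 + s^2) + (1 - s^2) * (1 + s^2) / (1 + s^2)"
        unfolding s(3) by (simp only:)
      also have "\<dots> = (2 * s * (1 - s^2) + (1 + 2 * s^2) / 4 + (1 - s^2) * (1 + s^2)) / (1 + s^2)"
        by (simp only: add_divide_distrib)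
      also have "2 * s * (1 - s^2) + (1 + 2 * s^2) / 4 + (1 - s^2) * (1 + s^2) = (1 - s^2) * (1 + s)^2 + (1 + 2 * s^2) / 4"
        by (simp add: power2_eq_square algebra_simps)
      finally show ?thesis .
    qed
    also have "\<dots> \<le> 173/100"
      using quartic_bound[of s] s by (subst pos_divide_le_eq) (auto simp: add_pos_nonneg)
    finally show ?thesis .
  qed
  have low: "- (173/100) \<le> I * real j"
  proof -
    have "?N * (?L - 1 / (8 * (real k)^2)) \<le> ?N * (tent_ln k - tent_ln j)"
      using tl by (intro mult_left_mono) auto
    then have "2 * (?N * (?L - 1 / (8 * (real k)^2)) - ?L) \<le> I" unfolding I using hb(1) by simp
    moreover have "2 * (?N * (?L - 1 / (8 * (real k)^2)) - ?L) = 2 / real n * ?L - ?N / (4 * (real k)^2)"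
    proof -
      have e: "2 * ((1 + p) * (L - q) - L) = 2 * p * L - 2 * (1 + p) * q" for p L q :: real
        by (simp add: algebra_simps)
      have "2 * (1 / real n) = 2 / real n" by simp
      moreover have "2 * N * (1 / (8 * x)) = N / (4 * x)" for N x :: real by (cases "x = 0") (auto simp: field_simps)
      ultimately show ?thesis unfolding e by (simp only:)
    qed
    moreover have "0 \<le> 2 / real n * ?L" using jk by simp
    moreover have "?N / (4 * (real k)^2) \<le> 2 / (4 * real k)"
    proof -
      have "?N \<le> 2" using jk by simp
      moreover have "4 * real k \<le> 4 * (real k)^2" using jk by (simp add: power2_eq_square)
      ultimately show ?thesis using jk by (intro frac_le) auto
    qed
    ultimately have "- (2 / (4 * real k)) \<le> I" by linarith
    then have "- (2 / (4 * real k)) * real j \<le> I * real j" by (intro mult_right_mono) auto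
    moreover have "2 / (4 * real k) * real j \<le> 1/2" using jk by (simp add: field_simps)
    moreover have "- (173/100) \<le> x" if "- a * y \<le> x" "a * y \<le> 1/2" for a x y :: real
      using that unfolding mult_minus_left by linarith
    ultimately show ?thesis by blast
  qed
  have "\<bar>I\<bar> * real j \<le> 173/100" using up low by (auto simp: abs_if)
  then show ?thesis unfolding I_def[symmetric] using jk by (simp add: field_simps)
qed

lemma toll_gap_dist:
  assumes "i \<le> j" "2 * j \<le> n"
  shows "\<bar>toll_gap n j - toll_gap n i\<bar> \<le> 173/100 * (harm j - harm i)"
  using assms
proof (induction j rule: dec_induct)
  case base then show ?case by simp
next
  case (step j)
  have "\<bar>toll_gap n (Suc j) - toll_gap n j\<bar> \<le> 173/100 / real (Suc j)"
    using toll_gap_diff_bound[of "Suc j" n] step.prems by simp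
  moreover have "\<bar>toll_gap n j - toll_gap n i\<bar> \<le> 173/100 * (harm j - harm i)" using step by simp
  moreover have "173/100 * (harm (Suc j) - harm i) = 173/100 * (harm j - harm i) + 173/100 / real (Suc j)"
  proof -
    have h: "harm (Suc j) = harm j + 1 / real (Suc j)" by (simp add: harm_Suc divide_inverse)
    have "c * ((x + 1 / y) - z) = c * (x - z) + c / y" for c x y z :: real by (simp add: algebra_simps)
    then show ?thesis unfolding h .
  qed
  moreover have "\<bar>c - a\<bar> \<le> z" if "\<bar>c - b\<bar> \<le> x" "\<bar>b - a\<bar> \<le> y" "z = y + x" for a b c x y z :: real
    using that by linarith
  ultimately show ?case by blast
qed

text \<open>For a family of sum 0, 2 n times the sum of squares is the sum of all squared
  differences, and these are compared pairwise. For \<open>g\<close> the mean enters with the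
  favourable sign, so any centring is allowed.\<close>

lemma sum_sq_le_of_contraction:
  fixes f g :: "nat \<Rightarrow> real"
  assumes c: "\<And>i j. \<lbrakk>i < n; j < n\<rbrakk> \<Longrightarrow> \<bar>f i - f j\<bar> \<le> c * \<bar>g i - g j\<bar>" and z: "(\<Sum>i<n. f i) = 0"
  shows "(\<Sum>i<n. (f i)^2) \<le> c^2 * (\<Sum>i<n. (g i)^2)"
proof (cases "n = 0")
  case False
  have id: "(\<Sum>i<n. \<Sum>j<n. (h i - h j)^2) = 2 * real n * (\<Sum>i<n. (h i)^2) - 2 * (\<Sum>i<n. h i)^2" for h :: "nat \<Rightarrow> real"
  proof -
    have "(\<Sum>i<n. \<Sum>j<n. (h i - h j)^2) = (\<Sum>i<n. \<Sum>j<n. (h i)^2 + (h j)^2 - 2 * (h i * h j))"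
      by (simp add: power2_diff mult.assoc)
    also have "\<dots> = 2 * real n * (\<Sum>i<n. (h i)^2) - 2 * (\<Sum>i<n. \<Sum>j<n. h i * h j)"
      by (simp add: sum.distrib sum_subtractf sum_distrib_left mult.assoc)
    also have "(\<Sum>i<n. \<Sum>j<n. h i * h j) = (\<Sum>i<n. h i)^2" by (simp add: power2_eq_square sum_product)
    finally show ?thesis .
  qed
  have "2 * real n * (\<Sum>i<n. (f i)^2) = (\<Sum>i<n. \<Sum>j<n. (f i - f j)^2)" using id[of f] z by simp
  also have "\<dots> \<le> (\<Sum>i<n. \<Sum>j<n. c^2 * (g i - g j)^2)"
  proof (intro sum_mono)
    fix i j assume "i \<in> {..<n}" "j \<in> {..<n}"
    then have "\<bar>f i - f j\<bar>^2 \<le> (c * \<bar>g i - g j\<bar>)^2" using c by (intro power_mono) auto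
    then show "(f i - f j)^2 \<le> c^2 * (g i - g j)^2" by (simp add: power_mult_distrib)
  qed
  also have "\<dots> = c^2 * (2 * real n * (\<Sum>i<n. (g i)^2) - 2 * (\<Sum>i<n. g i)^2)"
    unfolding id[symmetric] by (simp add: sum_distrib_left)
  also have "\<dots> \<le> c^2 * (2 * real n * (\<Sum>i<n. (g i)^2))" by (intro mult_left_mono) auto
  finally have "2 * real n * (\<Sum>i<n. (f i)^2) \<le> 2 * real n * (c^2 * (\<Sum>i<n. (g i)^2))" by (simp add: algebra_simps)
  then show ?thesis using False by simp
qed simp

lemma sum_fold:
  fixes f :: "nat \<Rightarrow> real"
  shows "(\<Sum>j<n. f (min j (n - 1 - j))) = 2 * (\<Sum>j<n div 2. f j) + (if odd n then f (n div 2) else 0)"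
proof -
  define m where "m = n div 2"
  define M where "M = n - m"
  have M: "m \<le> M" "M \<le> n" "M = (if odd n then Suc m else m)" by (auto simp: m_def M_def) presburger+
  have "{..<n} = {..<M} \<union> {M..<n}" using M by auto
  then have "(\<Sum>j<n. f (min j (n - 1 - j))) = (\<Sum>j<M. f (min j (n - 1 - j))) + (\<Sum>j\<in>{M..<n}. f (min j (n - 1 - j)))"
    by (simp add: sum.union_disjoint ivl_disj_int)
  also have "(\<Sum>j<M. f (min j (n - 1 - j))) = (\<Sum>j<M. f j)"
  proof (rule sum.cong)
    fix j assume "j \<in> {..<M}"
    then have "j \<le> n - 1 - j" unfolding M_def m_def by auto
    then show "f (min j (n - 1 - j)) = f j" by (simp add: min_def)
  qed simp
  also have "(\<Sum>j\<in>{M..<n}. f (min j (n - 1 - j))) = (\<Sum>j<m. f j)"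
  proof (rule sum.reindex_bij_witness[of _ "\<lambda>j. n - 1 - j" "\<lambda>j. n - 1 - j"])
    fix j assume "j \<in> {M..<n}"
    then show "f (n - 1 - j) = f (min j (n - 1 - j))" "n - 1 - j \<in> {..<m}" using M by (auto simp: min_def M_def split: if_splits)
  next
    fix j assume "j \<in> {..<m}"
    then have "j < n div 2" by (simp add: m_def)
    then have "0 < n" by (cases n) auto
    with \<open>j \<in> {..<m}\<close> show "n - 1 - j \<in> {M..<n}" by (auto simp: M_def)
  qed (use M in \<open>auto simp: m_def\<close>)
  also have "(\<Sum>j<M. f j) = (\<Sum>j<m. f j) + (if odd n then f m else 0)" unfolding M(3) by simp
  finally show ?thesis by (simp add: m_def)
qed

lemma sum_harm_less: "(\<Sum>j<m. harm j) = real m * harm m - real m"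
proof (induction m)
  case (Suc m)
  define r where "r = 1 / (real m + 1)"
  have r: "r * (real m + 1) = 1" by (simp add: r_def)
  have h: "harm (Suc m) = harm m + r"
    by (simp add: harm_Suc r_def divide_inverse add.commute)
  show ?case unfolding sum.lessThan_Suc Suc h of_nat_Suc using r by algebra
qed simp

lemma sum_harm_sq_less: "(\<Sum>j<m. (harm j)^2) = real m * (harm m)^2 - (2 * real m + 1) * harm m + 2 * real m"
proof (induction m)
  case (Suc m)
  define r where "r = 1 / (real m + 1)"
  have r: "r * (real m + 1) = 1" by (simp add: r_def)
  have h: "harm (Suc m) = harm m + r"
    by (simp add: harm_Suc r_def divide_inverse add.commute)
  show ?case unfolding sum.lessThan_Suc Suc h of_nat_Suc using r by algebra
qed (simp add: harm_0)

lemma sum_toll_gap: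
  assumes "0 < n" shows "(\<Sum>j<n. toll_gap n j) = 0"
proof -
  have "(\<Sum>j<n. toll_gap n j) = (\<Sum>j<n. cn n j) - (real n + 1) * real n *
      (\<Sum>j<n. toll_primitive (real (Suc j) / real n) - toll_primitive (real j / real n))"
    unfolding toll_gap_def by (subst sum_subtractf) (simp only: sum_distrib_left)
  also have "(\<Sum>j<n. toll_primitive (real (Suc j) / real n) - toll_primitive (real j / real n)) = 0"
    unfolding sum_lessThan_telescope[of "\<lambda>j. toll_primitive (real j / real n)"] using assms by (simp add: toll_primitive_def)
  finally show ?thesis using sum_cn[OF assms] by simp
qed

lemma sum_toll_gap_sq:
  assumes n: "0 < n"
  shows "(\<Sum>j<n. (toll_gap n j)^2) \<le> 3 * (real n - 2 * harm (n div 2))"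
proof -
  define m where "m = n div 2"
  \<comment> \<open>By \<open>sum_harm_less\<close>, \<open>harm m - 1\<close> is the mean of the
    harmonic numbers below m. This centring makes each half contribute m - H_m, and the middle cell
    of an odd n contributes exactly 1.\<close>
  define g :: "nat \<Rightarrow> real" where "g j = harm j - (harm m - 1)" for j
  have "(\<Sum>j<n. (toll_gap n j)^2) \<le> (173/100::real)^2 * (\<Sum>j<n. (g (min j (n - 1 - j)))^2)"
  proof (rule sum_sq_le_of_contraction)
    fix i j assume ij: "i < n" "j < n"
    let ?f = "\<lambda>j. min j (n - 1 - j)"
    have e: "toll_gap n j = toll_gap n (?f j)" if "j < n" for j
      using toll_gap_reflect[OF that] by (simp add: min_def)
    have h: "\<bar>toll_gap n a - toll_gap n b\<bar> \<le> 173/100 * \<bar>g a - g b\<bar>" if "a \<le> b" "2 * b \<le> n" for a b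
    proof -
      have "\<bar>toll_gap n b - toll_gap n a\<bar> \<le> 173/100 * (harm b - harm a)" using toll_gap_dist[OF that] .
      also have "harm b - harm a \<le> \<bar>g a - g b\<bar>" unfolding g_def by linarith
      then have "173/100 * (harm b - harm a) \<le> 173/100 * \<bar>g a - g b\<bar>" by (intro mult_left_mono) auto
      finally show ?thesis by (simp add: abs_minus_commute)
    qed
    have f: "2 * ?f i \<le> n" "2 * ?f j \<le> n" by (auto simp: min_def)
    show "\<bar>toll_gap n i - toll_gap n j\<bar> \<le> 173/100 * \<bar>g (?f i) - g (?f j)\<bar>"
    proof (cases "?f i \<le> ?f j")
      case True
      then show ?thesis using h[OF True f(2)] e[OF ij(1)] e[OF ij(2)] by simp
    next
      case False
      then have "?f j \<le> ?f i" using linear[of "?f i" "?f j"] by blast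
      from h[OF this f(1)] show ?thesis using e[OF ij(1)] e[OF ij(2)] by (simp add: abs_minus_commute)
    qed
  qed (rule sum_toll_gap[OF n])
  also have "(\<Sum>j<n. (g (min j (n - 1 - j)))^2) = real n - 2 * harm m"
  proof -
    have "(\<Sum>j<m. (g j)^2) = (\<Sum>j<m. (harm j)^2 - 2 * (harm m - 1) * harm j + (harm m - 1)^2)"
      by (rule sum.cong) (auto simp: g_def power2_eq_square algebra_simps)
    also have "\<dots> = (\<Sum>j<m. (harm j)^2) - 2 * (harm m - 1) * (\<Sum>j<m. harm j) + real m * (harm m - 1)^2"
      by (simp add: sum.distrib sum_subtractf sum_distrib_left)
    also have "\<dots> = real m - harm m"
      unfolding sum_harm_less sum_harm_sq_less by algebra
    finally have "(\<Sum>j<m. (g j)^2) = real m - harm m" .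
    moreover have "real n = 2 * real m + (if odd n then 1 else 0)"
      unfolding m_def by (auto elim!: oddE evenE)
    ultimately show ?thesis
      unfolding sum_fold[of "\<lambda>j. (g j)^2"] m_def[symmetric] by (simp add: g_def)
  qed
  also have "(173/100::real)^2 * (real n - 2 * harm m) \<le> 3 * (real n - 2 * harm m)"
  proof (rule mult_right_mono)
    have "0 \<le> (\<Sum>j<n. (g (min j (n - 1 - j)))^2)" by (simp add: sum_nonneg)
    then show "0 \<le> real n - 2 * harm m" using \<open>(\<Sum>j<n. (g (min j (n - 1 - j)))^2) = real n - 2 * harm m\<close> by simp
  qed (simp add: power2_eq_square)
  finally show ?thesis by (simp add: m_def)
qed

lemma toll_dist2_le:
  assumes n: "0 < n"
  shows "toll_dist2 n \<le> 3 * (1 - 2 * harm (n div 2) / real n) + 11/6 * (1 + 1 / real n)^2"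
proof -
  have "(\<Sum>j<n. (toll_gap n j)^2) / real n \<le> 3 * (real n - 2 * harm (n div 2)) / real n"
    using sum_toll_gap_sq[OF n] by (intro divide_right_mono) auto
  also have "\<dots> = 3 * (1 - 2 * harm (n div 2) / real n)" using n by (simp add: field_simps)
  finally show ?thesis using toll_dist2_has_integral(2)[OF n] by simp
qed

section \<open>A recursion for the distance to the limit\<close>

abbreviation Yvar :: real where "Yvar \<equiv> tnorm2 Ylim"

definition tcov :: "nat \<Rightarrow> real" where "tcov n = (\<integral>\<omega>. Zn n \<omega> * Ylim \<omega> \<partial>tree_space)"

lemma centred_diff:
  assumes F: "centred F" and G: "centred G"
  shows "centred (\<lambda>\<omega>. F \<omega> - c * G \<omega>)"
    "tnorm2 (\<lambda>\<omega>. F \<omega> - c * G \<omega>) = tnorm2 F - 2 * c * (\<integral>\<omega>. F \<omega> * G \<omega> \<partial>tree_space) + c^2 * tnorm2 G"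
proof -
  have I: "integrable tree_space F" "integrable tree_space (\<lambda>\<omega>. (F \<omega>)^2)" "(\<integral>\<omega>. F \<omega> \<partial>tree_space) = 0"
     "integrable tree_space G" "integrable tree_space (\<lambda>\<omega>. (G \<omega>)^2)" "(\<integral>\<omega>. G \<omega> \<partial>tree_space) = 0"
    using centred_integrable[OF F] centred_integrable[OF G] F G unfolding centred_def by blast+
  have [measurable]: "F \<in> borel_measurable tree_space" "G \<in> borel_measurable tree_space" using I by auto
  have FG: "integrable tree_space (\<lambda>\<omega>. F \<omega> * G \<omega>)"
  proof (rule Bochner_Integration.integrable_bound)
    show "integrable tree_space (\<lambda>\<omega>. (F \<omega>)^2 + (G \<omega>)^2)" using I by simp
    have "\<bar>x * y\<bar> \<le> x^2 + y^2" for x y :: real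
    proof -
      have "0 \<le> (\<bar>x\<bar> - \<bar>y\<bar>)^2" by simp
      then have "2 * (\<bar>x\<bar> * \<bar>y\<bar>) \<le> x^2 + y^2" by (simp add: power2_diff)
      moreover have "0 \<le> \<bar>x\<bar> * \<bar>y\<bar>" by simp
      ultimately show ?thesis unfolding abs_mult by linarith
    qed
    then show "AE \<omega> in tree_space. norm (F \<omega> * G \<omega>) \<le> norm ((F \<omega>)^2 + (G \<omega>)^2)" by simp
  qed simp
  have e: "(\<lambda>\<omega>. (F \<omega> - c * G \<omega>)^2) = (\<lambda>\<omega>. (F \<omega>)^2 - 2 * c * (F \<omega> * G \<omega>) + c^2 * (G \<omega>)^2)"
    by (auto simp: power2_eq_square algebra_simps)
  have "integrable tree_space (\<lambda>\<omega>. (F \<omega> - c * G \<omega>)^2)" unfolding e using I FG by simp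
  then show "centred (\<lambda>\<omega>. F \<omega> - c * G \<omega>)" using I by (simp add: centred_def)
  show "tnorm2 (\<lambda>\<omega>. F \<omega> - c * G \<omega>) = tnorm2 F - 2 * c * (\<integral>\<omega>. F \<omega> * G \<omega> \<partial>tree_space) + c^2 * tnorm2 G"
    unfolding tnorm2_def e using I FG by simp
qed

lemma tnorm2_Zn_Ylim: "tnorm2 (\<lambda>\<omega>. Zn n \<omega> - c * Ylim \<omega>) = qs_var n - 2 * c * tcov n + c^2 * Yvar"
  using centred_diff(2)[OF centred_Zn centred_Ylim] by (simp add: tcov_def tnorm2_Zn_eq)

text \<open>The scaling \<open>n + 1\<close> makes the drift of the split point, \<open>(n+1) u - (j+1)\<close>, average out over the cells.\<close>

definition Dn :: "nat \<Rightarrow> real" where "Dn n = tnorm2 (\<lambda>\<omega>. Zn n \<omega> - (real n + 1) * Ylim \<omega>)"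

lemma Dn_nonneg: "0 \<le> Dn n" by (simp add: Dn_def)

lemma Dn_tcov: "Dn n = qs_var n - 2 * (real n + 1) * tcov n + (real n + 1)^2 * Yvar"
  unfolding Dn_def by (rule tnorm2_Zn_Ylim)

lemma cell_linear:
  assumes n: "0 < n" and j: "j < n"
  shows "((\<lambda>u. a - b * (u * x + (1 - u) * y)) has_integral
     (a / real n - b * (x * (2 * real j + 1) + y * (2 * real (n - 1 - j) + 1)) / (2 * (real n)^2))) {real j / real n..real (Suc j) / real n}"
proof -
  let ?F = "\<lambda>u. a * u - b * (u^2 / 2 * x + (u - u^2 / 2) * y)"
  have "((\<lambda>u. a - b * (u * x + (1 - u) * y)) has_integral (?F (real (Suc j) / real n) - ?F (real j / real n))) {real j / real n..real (Suc j) / real n}"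
  proof (rule fundamental_theorem_of_calculus)
    fix u
    have "(?F has_real_derivative (a - b * (u * x + (1 - u) * y))) (at u)"
      by (auto intro!: derivative_eq_intros)
    then have "(?F has_real_derivative (a - b * (u * x + (1 - u) * y))) (at u within {real j / real n..real (Suc j) / real n})"
      by (rule has_field_derivative_at_within)
    then show "(?F has_vector_derivative (a - b * (u * x + (1 - u) * y))) (at u within {real j / real n..real (Suc j) / real n})"
      by (simp only: has_real_derivative_iff_has_vector_derivative)
  qed (use n in \<open>auto simp: divide_right_mono\<close>)
  moreover have "?F (real (Suc j) / real n) - ?F (real j / real n) =
     a / real n - b * (x * (2 * real j + 1) + y * (2 * real (n - 1 - j) + 1)) / (2 * (real n)^2)"
  proof -
    have rj: "real (n - 1 - j) = real n - 1 - real j" using j by linarith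
    define r where "r = 1 / real n"
    have r: "r * real n = 1" using n by (simp add: r_def)
    have e: "real (Suc j) / real n = (real j + 1) * r" "real j / real n = real j * r" "a / real n = a * r"
      "w / (2 * (real n)^2) = w * r^2 / 2" for w
      by (simp_all add: r_def power_divide add.commute)
    show ?thesis unfolding e rj using r by algebra
  qed
  ultimately show ?thesis by simp
qed

text \<open>With \<open>Yrec\<close> in place of \<open>Ylim\<close>, the left subtree contributes
  \<open>Zn j\<close> minus (n + 1) u times \<open>Ylim\<close>, a multiple that differs from j + 1.
  Hence the covariances appear with coefficients linear in u, which are integrated cell by
  cell.\<close>

lemma Dn_rec_tcov:
  assumes n: "0 < n"
  shows "Dn n = 2 * (\<Sum>j<n. qs_var j) / real n - (real n + 1) / (real n)^2 * 2 * (\<Sum>j<n. (2 * real j + 1) * tcov j)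
     + 2/3 * (real n + 1)^2 * Yvar + toll_dist2 n"
proof -
  let ?N = "real n + 1"
  let ?j' = "\<lambda>j. n - 1 - j"
  let ?H = "\<lambda>\<omega>. Zn n \<omega> - ?N * Yrec \<omega>"
  let ?F = "\<lambda>u l. Zn (pick n u) l - (?N * u) * Ylim l" and ?G = "\<lambda>u r. Zn (?j' (pick n u)) r - (?N * (1 - u)) * Ylim r"
  let ?g = "\<lambda>u. cn n (pick n u) - ?N * toll u"
  have c: "centred (\<lambda>\<omega>. Zn j \<omega> - d * Ylim \<omega>)" for j d by (rule centred_diff(1)[OF centred_Zn centred_Ylim])
  have nn: "(\<integral>\<^sup>+\<omega>. ennreal ((?H \<omega>)^2) \<partial>tree_space) = (\<integral>\<^sup>+u. ennreal (tnorm2 (?F u) + tnorm2 (?G u) + (?g u)^2) \<partial>unif)"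
  proof (rule tree_square)
    show "?H (graft u l r) = ?F u l + ?G u r + ?g u" for u l r
      by (simp add: Zn_graft[OF n] Yrec_graft algebra_simps)
  qed (auto intro: c)
  define P where "P j u = (qs_var j + qs_var (?j' j)) - (2 * ?N) * (u * tcov j + (1 - u) * tcov (?j' j))" for j u
  let ?v = "\<lambda>u. P (pick n u) u + ?N^2 * Yvar * (u^2 + (1 - u)^2) + (?g u)^2"
  have v: "tnorm2 (?F u) + tnorm2 (?G u) + (?g u)^2 = ?v u" for u
    unfolding tnorm2_Zn_Ylim P_def power_mult_distrib by (simp add: algebra_simps)
  define I where "I j = (qs_var j + qs_var (?j' j)) / real n
      - (2 * ?N) * (tcov j * (2 * real j + 1) + tcov (?j' j) * (2 * real (?j' j) + 1)) / (2 * (real n)^2)" for j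
  have hP: "((\<lambda>u. P (pick n u) u) has_integral (\<Sum>j<n. I j)) {0..1}"
    by (rule cells_has_integral[OF n]) (unfold P_def I_def, rule cell_linear[OF n])
  have hq: "((\<lambda>u::real. u^2 + (1-u)^2) has_integral 2/3) {0..1}"
  proof -
    have "((\<lambda>u::real. u^2 + (1-u)^2) has_integral ((1^3/3 - (1-1)^3/3) - (0^3/3 - (1-0)^3/3))) {0..1}"
      by (rule fundamental_theorem_of_calculus)
        (auto intro!: derivative_eq_intros simp flip: has_real_derivative_iff_has_vector_derivative)
    then show ?thesis by simp
  qed
  let ?t = "(\<Sum>j<n. I j) + ?N^2 * Yvar * (2/3) + toll_dist2 n"
  have "(\<integral>\<^sup>+u. ennreal (?v u) \<partial>unif) = ennreal ?t"
  proof (rule nn_integral_unif_has_integral)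
    show "?v \<in> borel_measurable borel" unfolding P_def by measurable
    show "(?v has_integral ?t) {0..1}"
      by (intro has_integral_add has_integral_mult_right hP hq toll_dist2_has_integral(1)[OF n])
    show "0 \<le> ?v u" for u unfolding v[symmetric] by simp
  qed
  then have nn2: "(\<integral>\<^sup>+\<omega>. ennreal ((?H \<omega>)^2) \<partial>tree_space) = ennreal ?t" unfolding nn v .
  have t0: "0 \<le> ?t"
  proof -
    have "(?v has_integral ?t) {0..1}"
      by (intro has_integral_add has_integral_mult_right hP hq toll_dist2_has_integral(1)[OF n])
    then show ?thesis by (rule has_integral_nonneg) (unfold v[symmetric], simp)
  qed
  have "Dn n = tnorm2 ?H"
    unfolding Dn_def tnorm2_def by (rule integral_cong_AE) (use Ylim_eq_Yrec in \<open>auto simp: eventually_mono\<close>)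
  also have "\<dots> = ?t"
  proof -
    have "(\<integral>\<omega>. (?H \<omega>)^2 \<partial>tree_space) = enn2real (\<integral>\<^sup>+\<omega>. ennreal ((?H \<omega>)^2) \<partial>tree_space)"
      by (rule integral_eq_nn_integral) auto
    also have "\<dots> = ?t" unfolding nn2 using t0 by (rule enn2real_ennreal)
    finally show ?thesis unfolding tnorm2_def[of ?H] .
  qed
  also have "(\<Sum>j<n. I j) = 2 * (\<Sum>j<n. qs_var j) / real n - ?N / (real n)^2 * 2 * (\<Sum>j<n. (2 * real j + 1) * tcov j)"
  proof -
    let ?h = "\<lambda>j. (2 * real j + 1) * tcov j"
    have "I j = (1 / real n) * qs_var j + (1 / real n) * qs_var (?j' j) - (?N / (real n)^2) * ?h j - (?N / (real n)^2) * ?h (?j' j)" for j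
      unfolding I_def using n by (simp add: field_simps)
    then have "(\<Sum>j<n. I j) = (1 / real n) * (\<Sum>j<n. qs_var j) + (1 / real n) * (\<Sum>j<n. qs_var (?j' j))
        - (?N / (real n)^2) * (\<Sum>j<n. ?h j) - (?N / (real n)^2) * (\<Sum>j<n. ?h (?j' j))"
      by (simp only: sum.distrib sum_subtractf sum_distrib_left)
    also have "(\<Sum>j<n. qs_var (?j' j)) = (\<Sum>j<n. qs_var j)" by (rule sum_reflect)
    also have "(\<Sum>j<n. ?h (?j' j)) = (\<Sum>j<n. ?h j)" by (rule sum_reflect[of ?h])
    finally show ?thesis by (simp add: algebra_simps)
  qed
  finally show ?thesis by (simp add: mult_ac)
qed

text \<open>Eliminating \<open>tcov\<close> from the recursion leaves the products \<open>drift n j * defect j\<close>, in which the drift sums to zero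
  and the increments of the defect are \<open>O(1/j)\<close>.\<close>

definition drift :: "nat \<Rightarrow> nat \<Rightarrow> real" where "drift n j = (2 * real j + 1 - real n) / (2 * real n)"
definition defect :: "nat \<Rightarrow> real" where "defect j = (real j + 1) * Yvar - qs_var j / (real j + 1)"
definition weight :: "nat \<Rightarrow> nat \<Rightarrow> real" where "weight n j = (real n + 1) * (2 * real j + 1) / ((real n)^2 * (real j + 1))"

text \<open>\<open>drift n j\<close> is the mean of (n+1) u - (j+1) over cell j. The substitution is
  2 (j+1) tcov j = qs_var j + (j+1)^2 Yvar - Dn j; the leftover multiples of \<open>Yvar\<close> sum
  to -2/3 (n+1)^2 + (n+1) / (3 n), which cancels the quadratic term.\<close>

lemma Dn_rec:
  assumes n: "0 < n"
  shows "Dn n = (\<Sum>j<n. weight n j * Dn j) + 2 / real n * (\<Sum>j<n. drift n j * defect j)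
     + Yvar * (real n + 1) / (3 * real n) + toll_dist2 n"
proof -
  define E where "E j = - (2 / real n) * (real j + 1)^2 - (4 / real n) * (drift n j * (real j + 1))" for j
  have termwise: "2 / real n * qs_var j - (real n + 1) / (real n)^2 * (2 * ((2 * real j + 1) * tcov j))
      = weight n j * Dn j + 2 / real n * (drift n j * defect j) + Yvar * E j" for j
  proof -
    define p where "p = 1 / (real j + 1)"
    have p: "p * (real j + 1) = 1" by (simp add: p_def)
    define r where "r = 1 / real n"
    have r: "r * real n = 1" using n by (simp add: r_def)
    have w: "weight n j = (real n + 1) * (2 * real j + 1) * r^2 * p"
      by (simp add: weight_def r_def p_def power_divide)
    have d: "drift n j = (2 * real j + 1 - real n) * r / 2" by (simp add: drift_def r_def)
    have f: "defect j = (real j + 1) * Yvar - qs_var j * p" by (simp add: defect_def p_def)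
    have c: "2 / real n = 2 * r" "4 / real n = 4 * r" "(real n + 1) / (real n)^2 = (real n + 1) * r^2"
      by (simp_all add: r_def power_divide)
    show ?thesis unfolding E_def w d f c Dn_tcov using p r by algebra
  qed
  have "Dn n = (\<Sum>j<n. 2 / real n * qs_var j - (real n + 1) / (real n)^2 * (2 * ((2 * real j + 1) * tcov j)))
     + 2/3 * (real n + 1)^2 * Yvar + toll_dist2 n"
  proof -
    have "(\<Sum>j<n. 2 / real n * qs_var j - (real n + 1) / (real n)^2 * (2 * ((2 * real j + 1) * tcov j)))
      = 2 / real n * (\<Sum>j<n. qs_var j) - (real n + 1) / (real n)^2 * (2 * (\<Sum>j<n. (2 * real j + 1) * tcov j))"
      by (simp only: sum_subtractf sum_distrib_left)
    then show ?thesis unfolding Dn_rec_tcov[OF n] by simp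
  qed
  also have "\<dots> = (\<Sum>j<n. weight n j * Dn j) + 2 / real n * (\<Sum>j<n. drift n j * defect j) + Yvar * (\<Sum>j<n. E j)
     + 2/3 * (real n + 1)^2 * Yvar + toll_dist2 n"
    unfolding termwise by (simp only: sum.distrib sum_distrib_left)
  also have "(\<Sum>j<n. E j) = - (2/3) * (real n + 1)^2 + (real n + 1) / (3 * real n)"
  proof -
    define r where "r = 1 / real n"
    have r: "r * real n = 1" using n by (simp add: r_def)
    have e: "E j = - (2 * r) * (real j + 1)^2 - 2 * r^2 * (2 * real j + 1 - real n) * (real j + 1)" for j
      unfolding E_def drift_def r_def by (simp add: power_divide power2_eq_square)
    have "(\<Sum>j<k. E j) = - (2 * r) * (real k * (real k + 1) * (2 * real k + 1) / 6)
      - 2 * r^2 * (2/3 * (real k)^3 + 1/2 * (real k)^2 - 1/6 * real k - real n * (real k * (real k + 1) / 2))" for k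
    proof (induction k)
      case (Suc k)
      show ?case unfolding sum.lessThan_Suc Suc e[of k] of_nat_Suc by algebra
    qed simp
    from this[of n] have "(\<Sum>j<n. E j) = - (2/3) * (real n + 1)^2 + (real n + 1) * r / 3" using r by algebra
    then show ?thesis by (simp add: r_def)
  qed
  finally show ?thesis by (simp add: algebra_simps)
qed

section \<open>Solving the recursion\<close>

lemma young_sq:
  fixes x y e :: real assumes "0 < e"
  shows "x^2 \<le> (1 + e) * y^2 + (1 + 1 / e) * (x - y)^2"
proof -
  have "0 \<le> (e * y - (x - y))^2 / e" using assms by simp
  also have "\<dots> = (1 + e) * y^2 + (1 + 1 / e) * (x - y)^2 - x^2"
    using assms by (simp add: field_simps power2_eq_square)
  finally show ?thesis by simp
qed

text \<open>With e = 1 / (n + 1) both errors, e times the main term and (1 + 1/e) times the bounded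
  \<open>toll_dist2 n\<close>, are of order n, negligible against (n + 1)^2.\<close>

lemma discrete_toll_sq:
  assumes n: "0 < n"
  defines "T \<equiv> (\<Sum>j<n. (cn n j)^2) / real n" and "e \<equiv> 1 / (real n + 1)"
  shows "(real n + 1)^2 * toll2 \<le> (1 + e) * T + (1 + 1 / e) * toll_dist2 n"
    and "T \<le> (1 + e) * ((real n + 1)^2 * toll2) + (1 + 1 / e) * toll_dist2 n"
proof -
  let ?N = "real n + 1"
  have e: "0 < e" by (simp add: e_def)
  have "((\<lambda>u. (cn n (pick n u))^2) has_integral (\<Sum>j<n. (cn n j)^2 / real n)) {0..1}"
  proof (rule cells_has_integral[OF n, where F="\<lambda>j u. (cn n j)^2"])
    fix j
    show "((\<lambda>u. (cn n j)^2) has_integral (cn n j)^2 / real n) {real j / real n..real (Suc j) / real n}"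
      using has_integral_const_real[of "(cn n j)^2" "real j / real n" "real (Suc j) / real n"] n
      by (simp add: divide_right_mono diff_divide_distrib[symmetric])
  qed
  then have T: "((\<lambda>u. (cn n (pick n u))^2) has_integral T) {0..1}" by (simp add: T_def sum_divide_distrib)
  have G: "((\<lambda>u. (?N * toll u)^2) has_integral ?N^2 * toll2) {0..1}"
    unfolding power_mult_distrib by (rule has_integral_mult_right[OF toll2_has_integral])
  have D: "((\<lambda>u. (cn n (pick n u) - ?N * toll u)^2) has_integral toll_dist2 n) {0..1}"
    by (rule toll_dist2_has_integral(1)[OF n])
  show "?N^2 * toll2 \<le> (1 + e) * T + (1 + 1 / e) * toll_dist2 n"
    by (rule has_integral_le[OF G has_integral_add[OF has_integral_mult_right[OF T] has_integral_mult_right[OF D]]])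
       (use young_sq[OF e, of "?N * toll u" "cn n (pick n u)" for u] in \<open>simp add: power2_commute\<close>)
  show "T \<le> (1 + e) * (?N^2 * toll2) + (1 + 1 / e) * toll_dist2 n"
    by (rule has_integral_le[OF T has_integral_add[OF has_integral_mult_right[OF G] has_integral_mult_right[OF D]]])
       (rule young_sq[OF e])
qed

lemma toll_dist2_le_11: "0 < n \<Longrightarrow> toll_dist2 n \<le> 11"
proof -
  assume n: "0 < n"
  have "(1 + 1 / real n)^2 \<le> 2^2" using n by (intro power_mono) auto
  moreover have "0 \<le> 2 * harm (n div 2) / real n" by (simp add: harm_nonneg)
  moreover have "t \<le> 11" if "t \<le> 3 * (1 - a) + 11/6 * q" "q \<le> 2^2" "0 \<le> a" for t a q :: real
    using that by simp
  ultimately show "toll_dist2 n \<le> 11" using toll_dist2_le[OF n] by blast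
qed

lemma harm_le: "harm n \<le> real n"
proof (induction n)
  case (Suc n)
  have "inverse (real (Suc n)) \<le> 1" by (simp add: inverse_le_1_iff)
  then have "harm n + inverse (real (Suc n)) \<le> real n + 1" using Suc by (rule add_mono[rotated])
  then show ?case by (simp add: harm_Suc)
qed (simp add: harm_0)

text \<open>1 / (y+1)^2 lies between the telescoping differences 1/(y+1) - 1/(y+2) and 1/y -
  1/(y+1).\<close>

lemma harm2_diff:
  assumes "1 \<le> i" "i \<le> n"
  shows "harm2 n \<le> harm2 i + 1 / real i - 1 / real n" "harm2 i + 1 / (real i + 1) - 1 / (real n + 1) \<le> harm2 n"
proof -
  have "harm2 n \<le> harm2 i + 1 / real i - 1 / real n \<and> harm2 i + 1 / (real i + 1) - 1 / (real n + 1) \<le> harm2 n"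
    using assms(2)
  proof (induction n rule: dec_induct)
    case base then show ?case by simp
  next
    case (step n)
    have x: "1 \<le> real n" using step assms by simp
    have p: "1 / (y + 1)^2 \<le> 1 / y - 1 / (y + 1)" "1 / (y + 1) - 1 / (y + 1 + 1) \<le> 1 / (y + 1)^2" if "1 \<le> y" for y :: real
    proof -
      have "1 / y - 1 / (y + 1) = 1 / (y * (y + 1))" "1 / (y + 1) - 1 / (y + 1 + 1) = 1 / ((y + 1) * (y + 1 + 1))"
        using that by (simp_all add: divide_simps)
      moreover have "1 / (y + 1)^2 \<le> 1 / (y * (y + 1))" "1 / ((y + 1) * (y + 1 + 1)) \<le> 1 / (y + 1)^2"
        using that by (intro frac_le; simp add: power2_eq_square)+
      ultimately show "1 / (y + 1)^2 \<le> 1 / y - 1 / (y + 1)" "1 / (y + 1) - 1 / (y + 1 + 1) \<le> 1 / (y + 1)^2" by simp_all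
    qed
    have h: "harm2 (Suc n) = harm2 n + 1 / (real n + 1)^2" by (simp add: harm2_Suc add.commute)
    have s: "real (Suc n) = real n + 1" by simp
    have G: "hS \<le> hi + a - b \<and> hi + c - d \<le> hS"
      if "p \<le> e - b" "f - d \<le> p" "hS = hn + p" "hn \<le> hi + a - e \<and> hi + c - f \<le> hn" for hS hi a b c d e f p hn :: real
      using that by argo
    show ?case unfolding s by (rule G[OF p[OF x] h step.IH])
  qed
  then show "harm2 n \<le> harm2 i + 1 / real i - 1 / real n" "harm2 i + 1 / (real i + 1) - 1 / (real n + 1) \<le> harm2 n" by auto
qed

lemma harm2_nonneg: "0 \<le> harm2 n"
  unfolding harm2_def by (intro sum_nonneg) auto

lemma harm2_le: "harm2 n \<le> 2"
proof (cases "n = 0")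
  case False
  have "harm2 n \<le> 2 - 1 / real n" using harm2_diff(1)[of 1 n] False by (simp add: harm2_def)
  moreover have "0 \<le> 1 / real n" by simp
  ultimately show ?thesis by linarith
qed simp

lemma le_of_error_tendsto_0:
  fixes x y c :: real
  assumes "\<And>n. m \<le> n \<Longrightarrow> x \<le> y + c / (real n + 1)" shows "x \<le> y"
proof (rule LIMSEQ_le_const)
  have "(\<lambda>n. c / (real n + 1)) \<longlonglongrightarrow> 0" by real_asymp
  then show "(\<lambda>n. y + c / (real n + 1)) \<longlonglongrightarrow> y" using tendsto_add[OF tendsto_const[of y], of "\<lambda>n. c / (real n + 1)" 0] by simp
  show "\<exists>N. \<forall>n\<ge>N. x \<le> y + c / (real n + 1)" using assms by blast
qed

lemma discrete_toll_sq_eq: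
  assumes n: "0 < n"
  shows "(\<Sum>j<n. (cn n j)^2) / real n = 7/3 * (real n + 1)^2 - 4/3 * (harm n / real n) - 4/3 * (real n + 1) * (real n + 2) * harm2 n"
proof -
  have "(\<Sum>j<n. (cn n j)^2) = real n * (7/3 * (real n + 1)^2 - 4/3 * (real n + 1) * (real n + 2) * harm2 n) - 4/3 * harm n"
    unfolding sum_cn_sq[OF n] sum_qs_var qs_var_def[of n] by algebra
  then show ?thesis using n by (simp add: diff_divide_distrib)
qed

text \<open>The variance of \<open>Y\<close> is compared with the limit of \<open>qs_var n / n\<^sup>2\<close> by comparing the two tolls in quadratic mean.\<close>

lemma Yvar_le_step:
  assumes n: "1 \<le> n" shows "Yvar \<le> 7 - 4 * harm2 n + 73 / (real n + 1)"
proof -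
  define N where "N = real n + 1"
  have N: "2 \<le> N" using n by (simp add: N_def)
  define T where "T = (\<Sum>j<n. (cn n j)^2) / real n"
  have h: "0 \<le> harm n / real n" by (simp add: harm_nonneg)
  have T: "T \<le> N^2 * (7 - 4 * harm2 n) / 3"
  proof -
    have "T = 7/3 * N^2 - 4/3 * (harm n / real n) - 4/3 * N * (N + 1) * harm2 n"
      unfolding T_def using discrete_toll_sq_eq[of n] n by (simp add: N_def add.assoc)
    moreover have "N^2 * harm2 n \<le> N * (N + 1) * harm2 n"
      using N harm2_nonneg[of n] by (intro mult_right_mono) (auto simp: power2_eq_square)
    moreover have "N^2 * (7 - 4 * harm2 n) / 3 = 7/3 * N^2 - 4/3 * (N^2 * harm2 n)"
      by (simp add: right_diff_distrib diff_divide_distrib)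
    moreover have "4/3 * N * (N + 1) * harm2 n = 4/3 * (N * (N + 1) * harm2 n)" by simp
    ultimately show ?thesis using h by linarith
  qed
  have "N^2 * toll2 \<le> (1 + 1 / N) * T + (1 + N) * toll_dist2 n"
    using discrete_toll_sq(1)[of n] n unfolding N_def T_def by simp
  also have "\<dots> \<le> (1 + 1 / N) * (N^2 * (7 - 4 * harm2 n) / 3) + (1 + N) * 11"
    using T N toll_dist2_le_11[of n] n by (intro add_mono mult_left_mono) auto
  finally have "N^2 * toll2 \<le> (1 + 1 / N) * (N^2 * (7 - 4 * harm2 n) / 3) + (1 + N) * 11" .
  then have "3 * (N^2 * toll2) \<le> 3 * ((1 + 1 / N) * (N^2 * (7 - 4 * harm2 n) / 3) + (1 + N) * 11)"
    by (rule mult_left_mono) simp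
  also have "\<dots> = N^2 * ((1 + 1 / N) * (7 - 4 * harm2 n) + 33 * (1 + N) / N^2)"
  proof -
    have "3 * (P * (N^2 * k / 3) + q * 11) = N^2 * (P * k + 33 * q / N^2)" for P k q
      using N by (simp add: distrib_left)
    then show ?thesis .
  qed
  finally have "N^2 * Yvar \<le> N^2 * ((1 + 1 / N) * (7 - 4 * harm2 n) + 33 * (1 + N) / N^2)"
    by (simp add: tnorm2_Ylim mult_ac)
  then have "Yvar \<le> (1 + 1 / N) * (7 - 4 * harm2 n) + 33 * (1 + N) / N^2" using N by simp
  also have "(1 + 1 / N) * (7 - 4 * harm2 n) = 7 - 4 * harm2 n + (7 - 4 * harm2 n) / N" by (simp add: distrib_right)
  also have "(7 - 4 * harm2 n) / N \<le> 7 / N" using harm2_nonneg[of n] N by (intro divide_right_mono) auto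
  also have "33 * (1 + N) / N^2 \<le> 66 / N"
  proof -
    have "33 * (1 + N) / N^2 \<le> 66 * N / N^2" using N by (intro divide_right_mono) auto
    then show ?thesis using N by (simp add: power2_eq_square)
  qed
  finally have "Yvar \<le> 7 - 4 * harm2 n + 7 / N + 66 / N" by simp
  then show ?thesis by (simp add: N_def add_divide_distrib[symmetric])
qed

text \<open>\<open>Yvar_le_step\<close> is used at n tending to infinity, with the part of
  \<open>harm2 n\<close> beyond i bounded by telescoping. The generous constants of that step vanish
  in the limit.\<close>

lemma Yvar_upper: "Yvar \<le> 7 - 4 * harm2 i - 4 / (real i + 1)"
proof -
  have u: "Yvar \<le> 7 - 4 * harm2 i - 4 / (real i + 1)" if i: "1 \<le> i" for i
  proof (rule le_of_error_tendsto_0[where m=i and c=77])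
    fix n assume n: "i \<le> n"
    have "Yvar \<le> 7 - 4 * harm2 n + 73 / (real n + 1)" using n i by (intro Yvar_le_step) simp
    moreover have "harm2 i + 1 / (real i + 1) - 1 / (real n + 1) \<le> harm2 n" using harm2_diff(2)[OF i n] .
    moreover have "4 * (1 / (real i + 1)) = 4 / (real i + 1)" "73 / (real n + 1) = 73 * (1 / (real n + 1))" "77 / (real n + 1) = 77 * (1 / (real n + 1))" by simp_all
    ultimately show "Yvar \<le> 7 - 4 * harm2 i - 4 / (real i + 1) + 77 / (real n + 1)" by argo
  qed
  show ?thesis
  proof (cases "i = 0")
    case True
    have "Yvar \<le> 7 - 4 * harm2 1 - 4 / (real 1 + 1)" by (rule u) simp
    then show ?thesis using True by (simp add: harm2_def)
  qed (use u[of i] in simp)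
qed

lemma Yvar_ge_step:
  assumes n: "1 \<le> n" shows "7 - 4 * harm2 n \<le> Yvar + 81 / (real n + 1)"
proof -
  define N where "N = real n + 1"
  have N: "2 \<le> N" using n by (simp add: N_def)
  define T where "T = (\<Sum>j<n. (cn n j)^2) / real n"
  have h: "harm n / real n \<le> 1" using harm_le[of n] n by (simp add: divide_le_eq)
  have Y3: "Yvar \<le> 3" using Yvar_upper[of 0] by simp
  have T: "N^2 * (7 - 4 * harm2 n) / 3 \<le> T + 8/3 * N + 4/3"
  proof -
    have "T = 7/3 * N^2 - 4/3 * (harm n / real n) - 4/3 * N * (N + 1) * harm2 n"
      unfolding T_def using discrete_toll_sq_eq[of n] n by (simp add: N_def add.assoc)
    moreover have "N * harm2 n \<le> N * 2" using N harm2_le[of n] by (intro mult_left_mono) auto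
    moreover have "N * (N + 1) * harm2 n = N^2 * harm2 n + N * harm2 n" by (simp add: power2_eq_square algebra_simps)
    moreover have "N^2 * (7 - 4 * harm2 n) / 3 = 7/3 * N^2 - 4/3 * (N^2 * harm2 n)"
      by (simp add: right_diff_distrib diff_divide_distrib)
    moreover have "4/3 * N * (N + 1) * harm2 n = 4/3 * (N * (N + 1) * harm2 n)" by simp
    ultimately show ?thesis using h by linarith
  qed
  have "T \<le> (1 + 1 / N) * (N^2 * toll2) + (1 + N) * toll_dist2 n"
    using discrete_toll_sq(2)[of n] n unfolding N_def T_def by simp
  also have "\<dots> \<le> (1 + 1 / N) * (N^2 * toll2) + (1 + N) * 11"
    using N toll_dist2_le_11[of n] n by (intro add_mono mult_left_mono) auto
  finally have "N^2 * (7 - 4 * harm2 n) / 3 \<le> (1 + 1 / N) * (N^2 * toll2) + (1 + N) * 11 + 8/3 * N + 4/3"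
    using T by linarith
  then have "N^2 * (7 - 4 * harm2 n) \<le> N^2 * (Yvar + Yvar / N) + (33 + 41 * N + 4)"
    using N by (simp add: tnorm2_Ylim field_simps power2_eq_square)
  also have "\<dots> \<le> N^2 * (Yvar + 3 / N) + 78 * N"
    using N Y3 by (intro add_mono mult_left_mono divide_right_mono) auto
  also have "\<dots> = N^2 * (Yvar + 81 / N)" using N by (simp add: field_simps power2_eq_square)
  finally show ?thesis using N by (simp add: N_def)
qed

lemma Yvar_lower: "1 \<le> i \<Longrightarrow> 7 - 4 * harm2 i - 4 / real i \<le> Yvar"
proof (rule le_of_error_tendsto_0[where m=i and c=81])
  fix n assume i: "1 \<le> i" and n: "i \<le> n"
  have "7 - 4 * harm2 n \<le> Yvar + 81 / (real n + 1)" using n i by (intro Yvar_ge_step) simp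
  moreover have "harm2 n \<le> harm2 i + 1 / real i - 1 / real n" using harm2_diff(1)[OF i n] .
  moreover have "0 \<le> 1 / real n" by simp
  moreover have "4 * (1 / real i) = 4 / real i" by simp
  ultimately show "7 - 4 * harm2 i - 4 / real i \<le> Yvar + 81 / (real n + 1)" by argo
qed

lemma Yvar_le_7_16: "Yvar \<le> 7/16"
proof -
  \<comment> \<open>The variance is 7 - 2 pi^2 / 3, about 0.4203. Ten terms give 0.4373, just below
    7/16; nine terms would not suffice.\<close>
  have "harm2 10 = 1968329/1270080"
    by (simp add: harm2_def eval_nat_numeral)
  then show ?thesis using Yvar_upper[of 10] by simp
qed

text \<open>Needed to return from the scaling n + 1 to n. The term -2 (n+1) H_n of
  \<open>qs_var\<close> absorbs the loss in \<open>Yvar_lower\<close>.\<close>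

lemma qs_var_le:
  assumes n: "2 \<le> n" shows "qs_var n \<le> (real n + 1)^2 * Yvar"
proof -
  define x where "x = real n"
  have x: "2 \<le> x" using n by (simp add: x_def)
  have "harm 2 \<le> (harm n :: real)" using n by (rule harm_mono)
  then have h: "3/2 \<le> (harm n :: real)" by (simp add: harm_def eval_nat_numeral)
  have "(x + 1)^2 * (7 - 4 * harm2 n - 4 / x) \<le> (x + 1)^2 * Yvar"
    using Yvar_lower[of n] n by (intro mult_left_mono) (auto simp: x_def)
  moreover have "(x + 1)^2 * (7 - 4 * harm2 n - 4 / x) = (x + 1)^2 * (7 - 4 * harm2 n) - 4 * x - 8 - 4 / x"
    using x by (simp add: field_simps power2_eq_square)
  moreover have "qs_var n = (x + 1)^2 * (7 - 4 * harm2 n) - x - 7 - 2 * ((x + 1) * harm n)"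
    unfolding qs_var_def x_def by (simp add: power2_eq_square algebra_simps)
  moreover have "3/2 * x + 3/2 \<le> (x + 1) * harm n"
  proof -
    have "(x + 1) * (3/2) \<le> (x + 1) * harm n" using x h by (intro mult_left_mono) auto
    then show ?thesis by (simp add: distrib_right)
  qed
  moreover have "4 / x \<le> 2" using x by (simp add: field_simps)
  moreover have "q \<le> Y" if "W \<le> Y" "W = P - 4 * x - 8 - z" "q = P - x - 7 - 2 * w" "3/2 * x + 3/2 \<le> w" "z \<le> 2"
    for q Y W P z w :: real using that by linarith
  ultimately show ?thesis unfolding x_def[symmetric] by blast
qed

text \<open>In the exact increment the harmonic numbers cancel; only \<open>harm2\<close> remains,
  and \<open>Yvar_upper\<close> bounds its distance to the limit.\<close>

lemma defect_diff: "defect (Suc i) - defect i \<le> 2 / (real i + 2)"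
proof -
  define x where "x = real i + 1"
  have x: "1 \<le> x" by (simp add: x_def)
  have qd: "qs_var n / y = 7 * y - 1 - 6 / y - 4 * y * harm2 n - 2 * harm n" if "y = real n + 1" for n y
  proof -
    have "qs_var n = y * (7 * y - 1 - 4 * y * harm2 n - 2 * harm n) - 6"
      unfolding qs_var_def that by algebra
    moreover have "0 < y" using that by simp
    ultimately show ?thesis by (simp add: diff_divide_distrib)
  qed
  have q: "qs_var i / x = 7 * x - 1 - 6 / x - 4 * x * harm2 i - 2 * harm i"
    by (rule qd) (simp add: x_def)
  have qS: "qs_var (Suc i) / (x + 1) = 7 * (x + 1) - 1 - 6 / (x + 1) - 4 * (x + 1) * harm2 (Suc i) - 2 * harm (Suc i)"
    by (rule qd) (simp add: x_def)
  have h: "harm2 i = harm2 (Suc i) - 1 / x^2" "harm i = harm (Suc i) - 1 / x"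
    by (simp_all add: harm2_Suc harm_Suc x_def add.commute divide_inverse)
  have "defect (Suc i) - defect i = Yvar - (qs_var (Suc i) / (x + 1) - qs_var i / x)"
    unfolding defect_def by (simp add: x_def algebra_simps)
  also have "qs_var (Suc i) / (x + 1) - qs_var i / x = 7 - 6 / (x + 1) - 4 * harm2 (Suc i)"
  proof -
    have e: "4 * x * (z - 1 / x^2) = 4 * x * z - 4 / x" "4 * (x + 1) * z = 4 * x * z + 4 * z" for z
      using x by (simp_all add: right_diff_distrib distrib_right distrib_left power2_eq_square)
    have "6 / x = 4 / x + 2 * (1 / x)" by (simp add: add_divide_distrib[symmetric])
    moreover have "2 * (harm (Suc i) - 1 / x) = 2 * harm (Suc i) - 2 * (1 / x)" by simp
    ultimately show ?thesis unfolding q qS h e by argo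
  qed
  finally have "defect (Suc i) - defect i = Yvar - (7 - 6 / (x + 1) - 4 * harm2 (Suc i))" .
  moreover have "6 / (x + 1) = 4 / (x + 1) + 2 / (x + 1)" by (simp add: add_divide_distrib[symmetric])
  ultimately have "defect (Suc i) - defect i = Yvar - (7 - 4 * harm2 (Suc i) - 4 / (x + 1)) + 2 / (x + 1)" by argo
  then show ?thesis using Yvar_upper[of "Suc i"] by (simp add: x_def add.commute)
qed

section \<open>The contribution of the drift\<close>

lemma sum_drift: "(\<Sum>j<k. drift n j) = real k * (real k - real n) / (2 * real n)"
proof (induction k)
  case (Suc k)
  have num: "real k * (real k - real n) + (2 * real k + 1 - real n) = (real k + 1) * (real k + 1 - real n)" by algebra
  have S: "real (Suc k) = real k + 1" by simp
  show ?case unfolding sum.lessThan_Suc Suc drift_def[of n k] S add_divide_distrib[symmetric] num ..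
qed simp

text \<open>Summation by parts. The partial sums of the drift are nonpositive, so the one-sided
  bound \<open>defect_diff\<close> is enough, and the full sum is 0, so no boundary term remains.
  The resulting sum is evaluated exactly.\<close>

lemma drift_defect_le:
  assumes n: "1 \<le> n"
  shows "2 / real n * (\<Sum>j<n. drift n j * defect j) \<le> 1 + 3 / real n - 2 * (real n + 1) * harm n / (real n)^2"
proof -
  define M where "M k = (\<Sum>j<k. drift n j)" for k
  have Mle: "M k \<le> 0" if "k \<le> n" for k
    unfolding M_def sum_drift using that by (intro divide_nonpos_nonneg mult_nonneg_nonpos) auto
  have "(\<Sum>j<Suc k. drift n j * defect j) \<le> M (Suc k) * defect k + (\<Sum>i<k. - M (Suc i) * (2 / (real i + 2)))"
    if "k < n" for k
    using that
  proof (induction k)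
    case 0 then show ?case by (simp add: M_def)
  next
    case (Suc k)
    have "(\<Sum>j<Suc (Suc k). drift n j * defect j) \<le> M (Suc k) * defect k + (\<Sum>i<k. - M (Suc i) * (2 / (real i + 2))) + drift n (Suc k) * defect (Suc k)"
      using Suc by simp
    moreover have "M (Suc (Suc k)) = M (Suc k) + drift n (Suc k)" by (simp add: M_def)
    moreover have "- M (Suc k) * (defect (Suc k) - defect k) \<le> - M (Suc k) * (2 / (real k + 2))"
      using Mle[of "Suc k"] Suc.prems by (intro mult_left_mono defect_diff) auto
    ultimately show ?case by (simp add: algebra_simps)
  qed
  from this[of "n - 1"] n
  have "(\<Sum>j<n. drift n j * defect j) \<le> M n * defect (n - 1) + (\<Sum>i<n-1. - M (Suc i) * (2 / (real i + 2)))" by simp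
  also have "M n = 0" by (simp add: M_def sum_drift)
  finally have 1: "(\<Sum>j<n. drift n j * defect j) \<le> (\<Sum>i<n-1. - M (Suc i) * (2 / (real i + 2)))" by simp
  have "(\<Sum>i<k. real n * (- M (Suc i) * (2 / (real i + 2)))) = real k * real n - real k * (real k + 1) / 2 - (real n + 1) * (harm (Suc k) - 1) + real k" for k
  proof (induction k)
    case 0 then show ?case by (simp add: harm_def)
  next
    case (Suc k)
    have "harm (Suc (Suc k)) = harm (Suc k) + 1 / (real k + 2)" by (simp add: harm_Suc[of "Suc k"] divide_inverse add.commute)
    moreover have "real n * (- M (Suc k) * (2 / (real k + 2))) = real n - (real k + 1) - (real n + 1) * (1 / (real k + 2)) + 1"
    proof -
      have "m * (- (K * (K - m) / (2 * m)) * (2 / (K + 1))) = m - K - (m + 1) * (1 / (K + 1)) + 1" if "0 < m" "0 < K" for m K :: real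
      proof -
        have "m * (- (K * (K - m) / (2 * m)) * (2 / (K + 1))) = K * (m - K) / (K + 1)"
          using that by (simp add: divide_simps) (simp add: algebra_simps)
        also have "K * (m - K) = (m - K + 1) * (K + 1) - (m + 1)" by (simp add: algebra_simps)
        also have "((m - K + 1) * (K + 1) - (m + 1)) / (K + 1) = (m - K + 1) - (m + 1) / (K + 1)"
          using that by (simp add: diff_divide_distrib)
        finally show ?thesis by simp
      qed
      from this[of "real n" "real k + 1"] n show ?thesis unfolding M_def sum_drift by (simp add: add.commute)
    qed
    moreover define w where "w = 1 / (real k + 2)"
    moreover have "real (Suc k) = real k + 1" by simp
    ultimately show ?case using Suc.IH unfolding sum.lessThan_Suc by algebra
  qed
  from this[of "n - 1"] have 2: "real n * (\<Sum>i<n-1. - M (Suc i) * (2 / (real i + 2))) =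
      (real n - 1) * real n - (real n - 1) * real n / 2 - (real n + 1) * (harm n - 1) + (real n - 1)"
    using n by (simp add: sum_distrib_left of_nat_diff)
  define S where "S = (\<Sum>i<n-1. - M (Suc i) * (2 / (real i + 2)))"
  have "2 / real n * (\<Sum>j<n. drift n j * defect j) \<le> 2 / real n * S" using 1 by (intro mult_left_mono) (auto simp: S_def)
  also have "\<dots> = 2 * (real n * S) / (real n)^2" using n by (simp add: power2_eq_square)
  also have "\<dots> = 1 + 3 / real n - 2 * (real n + 1) * harm n / (real n)^2"
  proof -
    define r where "r = 1 / real n"
    have r: "r * real n = 1" using n by (simp add: r_def)
    have e: "w / (real n)^2 = w * r^2" "3 / real n = 3 * r" for w by (simp_all add: r_def power_divide)
    show ?thesis unfolding S_def 2 e using r by algebra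
  qed
  finally show ?thesis .
qed

section \<open>Induction for the quadratic distance\<close>

lemma Zn_vanishes: "Zn 0 \<omega> = 0" "Zn (Suc 0) \<omega> = 0" "Zn 2 \<omega> = 0"
proof -
  show "Zn 0 \<omega> = 0" by simp
  have p: "pick (Suc 0) u = 0" for u using pick_less[of "Suc 0" u] by simp
  have X1: "Xtree (Suc 0) \<omega> = 0" for \<omega> by (simp add: Xtree_Suc p)
  have X: "Xtree m \<omega> = 0" if "m < 2" for m \<omega>
  proof -
    from that consider "m = 0" | "m = Suc 0" by linarith
    then show ?thesis by cases (simp_all add: X1)
  qed
  have "pick (Suc (Suc 0)) u < 2" for u using pick_less[of "Suc (Suc 0)" u] by simp
  then have "Xtree (Suc (Suc 0)) \<omega> = 1" by (simp add: Xtree_Suc[of "Suc 0"] X)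
  then show "Zn (Suc 0) \<omega> = 0" "Zn 2 \<omega> = 0"
    by (simp_all add: Zn_def X1 qs_mean_def eval_nat_numeral)
qed

text \<open>Up to n = 2 the number of comparisons is deterministic, so only (n+1)^2 times the
  variance of the limit is left.\<close>

lemma Dn_small: "Dn 0 \<le> 7/16" "Dn 1 \<le> 7/4" "Dn 2 \<le> 63/16"
proof -
  have e: "Dn n = (real n + 1)^2 * Yvar" if "\<And>\<omega>. Zn n \<omega> = 0" for n
  proof -
    have "(\<lambda>\<omega>. Zn n \<omega> - (real n + 1) * Ylim \<omega>) = (\<lambda>\<omega>. (- (real n + 1)) * Ylim \<omega>)"
      by (intro ext) (simp only: that diff_0 mult_minus_left)
    then show ?thesis
      unfolding Dn_def using centred_scale(2)[OF centred_Ylim, of "- (real n + 1)"] by (simp only: power2_minus)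
  qed
  have "Dn 0 = Yvar" "Dn 1 = 4 * Yvar" "Dn 2 = 9 * Yvar"
    using e[OF Zn_vanishes(1)] e[OF Zn_vanishes(2)] e[OF Zn_vanishes(3)] by simp_all
  then show "Dn 0 \<le> 7/16" "Dn 1 \<le> 7/4" "Dn 2 \<le> 63/16" using Yvar_le_7_16 by linarith+
qed

lemma weight_nonneg: "0 \<le> weight n j"
  by (simp add: weight_def)

lemma Dn_le_rec:
  assumes n: "1 \<le> n" and B: "\<And>j. j < n \<Longrightarrow> Dn j \<le> B j"
  shows "Dn n \<le> (\<Sum>j<n. weight n j * B j) + (1 + 3 / real n - 2 * (real n + 1) * harm n / (real n)^2)
    + 7/48 * (1 + 1 / real n) + (3 * (1 - 2 * harm (n div 2) / real n) + 11/6 * (1 + 1 / real n)^2)"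
proof -
  have "(\<Sum>j<n. weight n j * Dn j) \<le> (\<Sum>j<n. weight n j * B j)"
    by (intro sum_mono mult_left_mono B weight_nonneg) auto
  moreover have "Yvar * (real n + 1) / (3 * real n) \<le> 7/48 * (1 + 1 / real n)"
  proof -
    have "Yvar * (real n + 1) / (3 * real n) = Yvar * ((1 + 1 / real n) / 3)" using n by (simp add: field_simps)
    also have "\<dots> \<le> 7/16 * ((1 + 1 / real n) / 3)" using Yvar_le_7_16 by (intro mult_right_mono) auto
    finally show ?thesis by simp
  qed
  ultimately show ?thesis
    using Dn_rec[of n] drift_defect_le[OF n] toll_dist2_le[of n] n by linarith
qed

text \<open>Apart from the values at 0, 1 and 3 the induction hypothesis is \<open>Dn j \<le> 15/4 * (j+1) - 25/4\<close>;
  \<open>excess\<close> records the surplus there.\<close>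

definition excess :: "nat \<Rightarrow> real"
  where "excess j = (if j = 0 then 47/16 else if j = 1 then 1/2 else if j = 3 then 9/25 else 0)"

definition Dn_cap :: "nat \<Rightarrow> real" where "Dn_cap j = 15/4 * (real j + 1) - 25/4 + excess j"

text \<open>The recursion evaluated by hand, each bound feeding the next, before the general step
  takes over at 7. The slope 15/4 is fixed here: at 6 the cap equals the bound 20 obtained.\<close>

lemma Dn_cap_small:
  assumes "j < 7" shows "Dn j \<le> Dn_cap j"
proof -
  \<comment> \<open>The first three values come from \<open>Dn_small\<close>; the others are
    admissible outcomes of \<open>Dn_le_rec\<close>, rounded up.\<close>
  define B :: "nat \<Rightarrow> real"
    where "B j = (if j = 0 then 7/16 else if j = 1 then 7/4 else if j = 2 then 63/16 else if j = 3 then 911/100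
      else if j = 4 then 49/4 else if j = 5 then 16 else 20)" for j
  have sums: "(\<Sum>j<3. g j) = g 0 + g 1 + g 2" "(\<Sum>j<4. g j) = g 0 + g 1 + g 2 + g 3"
    "(\<Sum>j<5. g j) = g 0 + g 1 + g 2 + g 3 + g 4" "(\<Sum>j<6. g j) = g 0 + g 1 + g 2 + g 3 + g 4 + g 5" for g :: "nat \<Rightarrow> real"
    by (simp_all add: eval_nat_numeral)
  have b: "Dn j \<le> B j" if "j < 3" for j
  proof -
    from that consider "j = 0" | "j = 1" | "j = 2" by linarith
    then show ?thesis using Dn_small by cases (simp_all add: B_def)
  qed
  have d: "(3::nat) div 2 = 1" "(4::nat) div 2 = 2" "(5::nat) div 2 = 2" "(6::nat) div 2 = 3" by simp_all
  have 3: "Dn 3 \<le> B 3"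
    using Dn_le_rec[of 3 B, OF _ b] unfolding sums d by (simp add: B_def weight_def harm_expand power_divide)
  have b: "Dn j \<le> B j" if "j < 4" for j
    using that 3 by (cases "j = 3") (auto intro: b)
  have 4: "Dn 4 \<le> B 4"
    using Dn_le_rec[of 4 B, OF _ b] unfolding sums d by (simp add: B_def weight_def harm_expand power_divide)
  have b: "Dn j \<le> B j" if "j < 5" for j
    using that 4 by (cases "j = 4") (auto intro: b)
  have 5: "Dn 5 \<le> B 5"
    using Dn_le_rec[of 5 B, OF _ b] unfolding sums d by (simp add: B_def weight_def harm_expand power_divide)
  have b: "Dn j \<le> B j" if "j < 6" for j
    using that 5 by (cases "j = 5") (auto intro: b)
  have 6: "Dn 6 \<le> B 6"
    using Dn_le_rec[of 6 B, OF _ b] unfolding sums d by (simp add: B_def weight_def harm_expand power_divide)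
  have "Dn j \<le> B j" using assms 6 by (cases "j = 6") (auto intro: b)
  moreover have "B j \<le> Dn_cap j"
  proof -
    from assms have "j \<in> {0, 1, 2, 3, 4, 5, 6}" by auto
    then show ?thesis by (auto simp: B_def Dn_cap_def excess_def)
  qed
  ultimately show ?thesis by simp
qed

text \<open>The odd numbers below 2 n sum to n^2, so the weights send j + 1 to n + 1 for any slope.
  A constant is nearly doubled, so -25/4 gains almost another -25/4 to set against the forcing. The
  number 1727/400 collects the three surplus terms.\<close>

lemma sum_weight_Dn_cap:
  assumes n: "4 \<le> n"
  shows "(\<Sum>j<n. weight n j * Dn_cap j)
    = (real n + 1) / (real n)^2 * (15/4 * (real n)^2 - 25/4 * (2 * real n - harm n) + 1727/400)"
proof -
  let ?g = "\<lambda>j. (2 * real j + 1) / (real j + 1)"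
  have "(\<Sum>j<m. ?g j * (15/4 * (real j + 1) - 25/4)) = 15/4 * (real m)^2 - 25/4 * (2 * real m - harm m)" for m
  proof (induction m)
    case (Suc m)
    define w where "w = 1 / (real m + 1)"
    have w: "w * (real m + 1) = 1" by (simp add: w_def)
    have "?g m = (2 * real m + 1) * w" "harm (Suc m) = harm m + w" "real (Suc m) = real m + 1"
      by (simp_all add: w_def harm_Suc inverse_eq_divide add.commute)
    then show ?case using Suc.IH w unfolding sum.lessThan_Suc by algebra
  qed (simp add: harm_expand)
  moreover have "(\<Sum>j<n. ?g j * excess j) = 1727/400"
    using n
  proof (induction n rule: dec_induct)
    case base then show ?case by (simp add: excess_def eval_nat_numeral)
  next
    case (step k) then show ?case by (simp add: excess_def)
  qed
  moreover have "(\<Sum>j<n. weight n j * Dn_cap j)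
      = (real n + 1) / (real n)^2 * ((\<Sum>j<n. ?g j * (15/4 * (real j + 1) - 25/4)) + (\<Sum>j<n. ?g j * excess j))"
  proof -
    have w: "weight n j = (real n + 1) / (real n)^2 * ?g j" for j by (simp add: weight_def)
    show ?thesis
      unfolding w Dn_cap_def sum.distrib[symmetric] sum_distrib_left by (intro sum.cong refl) (simp only: distrib_left mult.assoc)
  qed
  ultimately show ?thesis by simp
qed

text \<open>H_(2m+1) - H_m decreases in m, and at m = 3 it is H_7 - H_3, about 0.7595. This lets the
  negative term with \<open>harm (n div 2)\<close> offset the positive one with
  \<open>harm n\<close> in the recursion.\<close>

lemma harm_half:
  assumes n: "7 \<le> n" shows "harm n - 19/25 \<le> (harm (n div 2) :: real)"
proof -
  have e: "harm (2 * m + 1) - harm m \<le> (19/25 :: real)" if "3 \<le> m" for m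
    using that
  proof (induction m rule: dec_induct)
    case base then show ?case by (simp add: harm_expand)
  next
    case (step m)
    have s: "2 * Suc m + 1 = Suc (Suc (2 * m + 1))" by simp
    have h: "harm (2 * Suc m + 1) = harm (2 * m + 1) + 1 / (2 * (real m + 1)) + 1 / (2 * real m + 3)"
      "harm (Suc m) = harm m + 1 / (real m + 1)"
      unfolding s harm_Suc by (simp_all add: inverse_eq_divide algebra_simps)
    have "1 / (2 * real m + 3) \<le> 1 / (2 * (real m + 1))" by (intro frac_le) auto
    moreover have "1 / (real m + 1) = 1 / (2 * (real m + 1)) + 1 / (2 * (real m + 1))" by (simp add: divide_simps)
    moreover have "A + a + b - (B + c) \<le> 19/25" if "b \<le> a" "c = a + a" "A - B \<le> 19/25" for A B a b c :: real
      using that by linarith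
    ultimately show ?case unfolding h using step.IH by blast
  qed
  have "harm n \<le> (harm (2 * (n div 2) + 1) :: real)" by (rule harm_mono) simp
  moreover have "3 \<le> n div 2" using n by simp
  ultimately show ?thesis using e[of "n div 2"] by linarith
qed

lemma Dn_le_cap: "Dn n \<le> Dn_cap n"
proof (induction n rule: less_induct)
  case (less n)
  show ?case
  proof (cases "n < 7")
    case True then show ?thesis by (rule Dn_cap_small)
  next
    case False
    define x h g :: real where "x = real n" and "h = harm n" and "g = harm (n div 2)"
    have x: "7 \<le> x" using False by (simp add: x_def)
    have g: "h - 19/25 \<le> g" unfolding h_def g_def using False by (intro harm_half) simp
    have "harm 7 \<le> (harm n :: real)" using False by (intro harm_mono) simp
    then have h: "259/100 \<le> h" by (simp add: h_def harm_expand)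
    have "Dn n \<le> (\<Sum>j<n. weight n j * Dn_cap j) + (1 + 3 / x - 2 * (x + 1) * h / x^2)
        + 7/48 * (1 + 1 / x) + (3 * (1 - 2 * g / x) + 11/6 * (1 + 1 / x)^2)"
      unfolding x_def h_def g_def by (rule Dn_le_rec) (use False less in auto)
    also have "(\<Sum>j<n. weight n j * Dn_cap j) = (x + 1) / x^2 * (15/4 * x^2 - 25/4 * (2 * x - h) + 1727/400)"
      unfolding x_def h_def by (rule sum_weight_Dn_cap) (use False in simp)
    finally have D: "Dn n \<le> (x + 1) / x^2 * (15/4 * x^2 - 25/4 * (2 * x - h) + 1727/400) + (1 + 3 / x - 2 * (x + 1) * h / x^2)
        + 7/48 * (1 + 1 / x) + (3 * (1 - 2 * g / x) + 11/6 * (1 + 1 / x)^2)" (is "_ \<le> ?R") .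
    \<comment> \<open>The constant forcing is 1 + 7/48 + 3 + 11/6 = 287/48, and 13/48 is what 25/4
      exceeds it by. This quadratic surplus has to cover the lower-order terms.\<close>
    have "x^2 * ?R = x^2 * (15/4 * (x + 1) - 25/4)
        - (13/48 * x^2 + 137/100 * x - 7381/1200 - 17/4 * ((x + 1) * h) + 6 * (x * g))"
    proof -
      define r where "r = 1 / x"
      have r: "r * x = 1" using x by (simp add: r_def)
      have e: "1 / x = r" "3 / x = 3 * r" "w / x^2 = w * r^2" "2 * g / x = 2 * g * r" for w by (simp_all add: r_def power_divide)
      show ?thesis unfolding e using r by algebra
    qed
    moreover have "0 \<le> 13/48 * x^2 + 137/100 * x - 7381/1200 - 17/4 * ((x + 1) * h) + 6 * (x * g)"
    proof -
      have G: "0 \<le> 13/48 * q + 137/100 * y - 7381/1200 - 17/4 * w + 6 * z"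
        if "p - 19/25 * y \<le> z" "1813/400 * y - 4403/400 \<le> 7/4 * p - 17/4 * k" "7 * y \<le> q" "w = p + k" "7 \<le> y"
        for p q w y z k :: real using that by linarith
      have "x * (h - 19/25) \<le> x * g" using x g by (intro mult_left_mono) auto
      then have 1: "x * h - 19/25 * x \<le> x * g" by (simp add: algebra_simps)
      have "(7/4 * x - 17/4) * (259/100) \<le> (7/4 * x - 17/4) * h" using x h by (intro mult_left_mono) auto
      then have 2: "1813/400 * x - 4403/400 \<le> 7/4 * (x * h) - 17/4 * h" by (simp add: algebra_simps)
      have 3: "7 * x \<le> x^2" using x by (simp add: power2_eq_square)
      show ?thesis by (rule G[OF 1 2 3 _ x]) (simp add: distrib_right)
    qed
    ultimately have "x^2 * ?R \<le> x^2 * (15/4 * (x + 1) - 25/4)" by linarith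
    then have "?R \<le> 15/4 * (x + 1) - 25/4" by (rule mult_left_le_imp_le) (use x in simp)
    then show ?thesis using D False by (simp add: Dn_cap_def excess_def x_def)
  qed
qed

lemma Zn_Ylim_dist:
  assumes n: "1 \<le> n"
  shows "integrable tree_space (\<lambda>\<omega>. (Zn n \<omega> / real n - Ylim \<omega>)^2)"
    "(\<integral>\<omega>. (Zn n \<omega> / real n - Ylim \<omega>)^2 \<partial>tree_space) \<le> 15/4 / real n"
proof -
  define x where "x = real n"
  have x: "1 \<le> x" using n by (simp add: x_def)
  let ?F = "\<lambda>\<omega>. Zn n \<omega> - x * Ylim \<omega>"
  have F: "centred ?F" by (rule centred_diff(1)[OF centred_Zn centred_Ylim])
  have e: "(\<lambda>\<omega>. (Zn n \<omega> / real n - Ylim \<omega>)^2) = (\<lambda>\<omega>. (1 / x * ?F \<omega>)^2)"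
    using n by (intro ext) (simp add: x_def diff_divide_distrib)
  show "integrable tree_space (\<lambda>\<omega>. (Zn n \<omega> / real n - Ylim \<omega>)^2)"
    unfolding e using centred_scale(1)[OF F, of "1 / x"] unfolding centred_def by blast
  have Q: "tnorm2 ?F \<le> 15/4 * x"
  proof (cases "n = 1")
    case True
    have "tnorm2 ?F = tnorm2 (\<lambda>\<omega>. (-1) * Ylim \<omega>)" using True Zn_vanishes(2) by (simp add: x_def)
    also have "\<dots> = Yvar" unfolding centred_scale(2)[OF centred_Ylim] by simp
    finally show ?thesis using Yvar_le_7_16 x by linarith
  next
    case False
    \<comment> \<open>Eliminating \<open>tcov n\<close> between the scalings x and x + 1. With
      \<open>qs_var_le\<close> the change of scaling costs at most \<open>Yvar\<close>, hence at
      most the 7/16 held in reserve in the bound for \<open>Dn n\<close>.\<close>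
    have "(x + 1) * tnorm2 ?F = x * Dn n + qs_var n - x * (x + 1) * Yvar"
      unfolding tnorm2_Zn_Ylim Dn_tcov x_def[symmetric] by algebra
    also have "\<dots> \<le> x * Dn n + (x + 1)^2 * Yvar - x * (x + 1) * Yvar"
      using qs_var_le[of n] n False by (simp add: x_def)
    also have "\<dots> = x * Dn n + (x + 1) * Yvar" by algebra
    also have "\<dots> \<le> (x + 1) * (Dn n + Yvar)" using Dn_nonneg[of n] by (simp add: distrib_left distrib_right)
    finally have "tnorm2 ?F \<le> Dn n + Yvar" by (rule mult_left_le_imp_le) (use x in simp)
    moreover have "Dn n \<le> 15/4 * x - 7/16"
    proof (cases "n \<le> 3")
      case True
      with n False have "n = 2 \<or> n = 3" by linarith
      then show ?thesis using Dn_le_cap[of n] Dn_small(3) by (auto simp: x_def Dn_cap_def excess_def)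
    next
      case False
      then have "excess n = 0" by (simp add: excess_def)
      moreover have "15/4 * (x + 1) - 25/4 = 15/4 * x - 5/2" by (simp add: field_simps)
      moreover have "d \<le> a - 7/16" if "d \<le> b + e" "e = 0" "b = a - 5/2" for a b d e :: real using that by linarith
      ultimately show ?thesis using Dn_le_cap[of n] unfolding Dn_cap_def x_def[symmetric] by blast
    qed
    ultimately show ?thesis using Yvar_le_7_16 by linarith
  qed
  have "(\<integral>\<omega>. (1 / x * ?F \<omega>)^2 \<partial>tree_space) = (1 / x)^2 * tnorm2 ?F"
    using centred_scale(2)[OF F, of "1 / x"] unfolding tnorm2_def .
  also have "\<dots> \<le> (1 / x)^2 * (15/4 * x)" using Q by (intro mult_left_mono) auto
  also have "\<dots> = 15/4 / x" using x by (simp add: power2_eq_square)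
  finally show "(\<integral>\<omega>. (Zn n \<omega> / real n - Ylim \<omega>)^2 \<partial>tree_space) \<le> 15/4 / real n" unfolding e by (simp add: x_def)
qed

section \<open>The main theorem\<close>

lemma Y_law_Ylim: "Y_law = distr tree_space borel Ylim"
  unfolding Y_law_def
  by (rule the_equality) (use fixpoint_law_Ylim fixpoint_unique in blast)+

lemma cube_powr_third:
  fixes d :: real assumes "0 \<le> d" shows "(d^3) powr (1/3) = d"
proof (cases "d = 0")
  case False
  then have "0 < d" using assms by simp
  then show ?thesis by (simp add: powr_powr flip: powr_numeral)
qed simp

lemma cube_root_bound:
  fixes d c x :: real
  assumes d: "0 \<le> d" "d^3 \<le> c / x" and c: "0 \<le> c" and x: "0 < x"
  shows "d \<le> (c / x) powr (1/3)"
proof -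
  have "d = (d^3) powr (1/3)" using cube_powr_third[OF d(1)] by simp
  also have "\<dots> \<le> (c / x) powr (1/3)" using d by (intro powr_mono2) auto
  finally show ?thesis .
qed

theorem theorem5p3:
  fixes n :: nat and f :: "real \<Rightarrow> real"
  assumes "n \<ge> 1"
    and "f \<in> borel_measurable borel"
    and "\<And>x. f x \<ge> 0"
    and "bdd_above (range f)"
    and "Y_law = density lborel (\<lambda>x. ennreal (f x))"
  shows "d_KS (Yn_law n) Y_law \<le> (12 * (SUP x. f x) ^ 2) powr (1/3) * real n powr (-1/3)
       \<and> d_KS (Yn_law n) Y_law < (3072 / real n) powr (1/3)
       \<and> (3072 / real n) powr (1/3) < 15 * real n powr (-1/3)"
proof -
  define K where "K = (SUP x. f x)"
  define d where "d = d_KS (Yn_law n) Y_law"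
  have [measurable]: "f \<in> borel_measurable borel" by fact
  have fK: "f x \<le> K" for x unfolding K_def by (rule cSUP_upper) (use assms in auto)
  have K0: "0 \<le> K" using fK[of 0] assms(3)[of 0] by linarith
  have fp: "qs_fixpoint_law Y_law" unfolding Y_law_Ylim by (rule fixpoint_law_Ylim)
  then interpret Y: real_distribution Y_law by (rule real_distribution_fixpoint)
  have conc: "emeasure Y_law {x..x+h} \<le> ennreal (K * h)" if h: "0 \<le> h" for x h
  proof -
    have "emeasure Y_law {x..x+h} = (\<integral>\<^sup>+y. ennreal (f y) * indicator {x..x+h} y \<partial>lborel)"
      unfolding assms(5) by (rule emeasure_density) auto
    also have "\<dots> \<le> (\<integral>\<^sup>+y. ennreal K * indicator {x..x+h} y \<partial>lborel)"
      by (intro nn_integral_mono mult_right_mono ennreal_leI fK) auto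
    also have "\<dots> = ennreal (K * h)" using h K0 by (simp add: nn_integral_cmult_indicator ennreal_mult)
    finally show ?thesis .
  qed
  \<comment> \<open>Positivity is required by the truncation level, which divides by
    \<open>K\<close>; a vanishing density could not have total mass 1.\<close>
  have K: "0 < K"
  proof (rule ccontr)
    assume "\<not> 0 < K"
    then have "f x = 0" for x using fK[of x] assms(3)[of x] by linarith
    then have "emeasure Y_law (space Y_law) = 0" unfolding assms(5) by (simp add: emeasure_density)
    then show False using Y.emeasure_space_1 by simp
  qed
  have cube: "d^3 \<le> 3 * k^2 * (15/4) / real n"
    if k: "0 < k" and m: "\<And>x h. 0 \<le> h \<Longrightarrow> measure Y_law {x..x+h} \<le> k * h" for k
  proof -
    have "d^3 \<le> 3 * k^2 * (\<integral>\<omega>. (Zn n \<omega> / real n - Ylim \<omega>)^2 \<partial>tree_space)"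
      unfolding d_def Yn_law_eq Y_law_Ylim
    proof (rule prob_space.d_KS_cube_le[OF prob_space_tree])
      fix a b :: real assume "a \<le> b"
      have "measure tree_space {\<omega> \<in> space tree_space. a \<le> Ylim \<omega> \<and> Ylim \<omega> \<le> b} = measure Y_law {a..a + (b - a)}"
        unfolding Y_law_Ylim by (subst measure_distr) (auto intro!: arg_cong[where f="measure tree_space"])
      also have "\<dots> \<le> k * (b - a)" using \<open>a \<le> b\<close> by (intro m) simp
      finally show "measure tree_space {\<omega> \<in> space tree_space. a \<le> Ylim \<omega> \<and> Ylim \<omega> \<le> b} \<le> k * (b - a)" .
    qed (use k Zn_Ylim_dist(1)[OF assms(1)] in auto)
    also have "\<dots> \<le> 3 * k^2 * (15/4 / real n)" using Zn_Ylim_dist(2)[OF assms(1)] by (intro mult_left_mono) auto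
    finally show ?thesis by simp
  qed
  have x: "0 < real n" using assms(1) by simp
  have d0: "0 \<le> d"
  proof -
    have "prob_space (Yn_law n)" unfolding Yn_law_def by (rule measure_pmf.prob_space_distr) simp
    then interpret Yn: prob_space "Yn_law n" .
    have "\<bar>measure (Yn_law n) {..z} - measure Y_law {..z}\<bar> \<le> 1" for z
      using Yn.prob_le_1[of "{..z}"] Y.prob_le_1[of "{..z}"] measure_nonneg[of "Yn_law n" "{..z}"] measure_nonneg[of Y_law "{..z}"]
      by linarith
    then have "\<bar>measure (Yn_law n) {..0} - measure Y_law {..0}\<bar> \<le> d"
      unfolding d_def d_KS_def by (intro cSUP_upper) (auto simp: bdd_above_def)
    then show ?thesis by linarith
  qed
  have mK: "measure Y_law {x..x+h} \<le> K * h" if "0 \<le> h" for x h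
    using conc[OF that] that K by (simp add: Y.emeasure_eq_measure)
  have "d^3 \<le> (12 * K^2) / real n"
  proof -
    have "3 * K^2 * (15/4) / real n \<le> (12 * K^2) / real n" using x by (intro divide_right_mono) auto
    with cube[OF K mK] show ?thesis by linarith
  qed
  then have "d \<le> (12 * K^2 / real n) powr (1/3)" using d0 x by (intro cube_root_bound) auto
  also have "\<dots> = (12 * K^2) powr (1/3) * real n powr (-1/3)"
    using x by (simp add: powr_divide powr_minus_divide)
  finally have 1: "d \<le> (12 * K^2) powr (1/3) * real n powr (-1/3)" .
  \<comment> \<open>The supremum of the density only starts the iteration in
    \<open>concentration\<close>. The constant is 3062.8125, below 3072.\<close>
  have "d^3 \<le> 3 * (33/2)^2 * (15/4) / real n"
    by (rule cube) (use concentration[OF fp K conc] in auto)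
  then have "d \<le> (3 * (33/2)^2 * (15/4) / real n) powr (1/3)" using d0 x by (intro cube_root_bound) auto
  also have "\<dots> < (3072 / real n) powr (1/3)"
    using x by (intro powr_less_mono2 divide_strict_right_mono) (auto simp: power2_eq_square)
  finally have 2: "d < (3072 / real n) powr (1/3)" .
  \<comment> \<open>15^3 = 3375.\<close>
  have "(3072 / real n) powr (1/3) < (15^3 / real n) powr (1/3)"
    using x by (intro powr_less_mono2 divide_strict_right_mono) auto
  also have "\<dots> = ((15::real)^3) powr (1/3) * real n powr (-1/3)"
    using x by (simp add: powr_divide powr_minus_divide)
  also have "((15::real)^3) powr (1/3) = 15"
    by (rule cube_powr_third) simp
  finally have 3: "(3072 / real n) powr (1/3) < 15 * real n powr (-1/3)" .
  show ?thesis using 1 2 3 unfolding d_def K_def by blast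
qed

end
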